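(* The $\mathbb K$-linear map $\Gamma:U_{\mathbf q}^+\to\mathcal F$ defined by $\Gamma(x)=\sum_{w:\,|w|=\mu}\partial_w(x)\,w$ for $x\in(U_{\mathbf q}^+)_\mu$, $\mu\in Q^+$, is injective.
   Context: Let $A=(a_{ij})_{i,j\in I}$ be a symmetrizable generalized Cartan matrix ($I$ finite); $Q^+=\bigoplus_i\mathbb Z_{\ge0}\alpha_i$. Let $q_{ij}$ ($i,j\in I$) be indeterminates over $\mathbb Q$ subject to $q_{ij}q_{ji}=q_{ii}^{a_{ij}}$, and $\mathbb K\supset\mathbb Q(q_{ij}\mid i,j\in I)$ a field containing $q_{ii}^{1/m}$ for all positive integers $m$. The $q_{ii}$ are not roots of unity. Assume there is an involutive $\mathbb Q$-automorphism $\tau$ of $\mathbb K$ with $\tau(q_{ij})=q_{ji}$. Notation: $(n)_v=\frac{v^n-1}{v-1}$, $(n)_v!=(n)_v\cdots(1)_v$, $(0)_v!=1$, $\binom nk_v=\frac{(n)_v!}{(k)_v!(n-k)_v!}$. $U_{\mathbf q}=U_{\mathbf q}(\mathfrak g_A)$ is the associative unital $\mathbb K$-algebra generated by $e_i,f_i,\omega_i^{\pm1},\omega_i'^{\pm1}$ ($i\in I$) with relations: all $\omega_i^{\pm1},\omega_j'^{\pm1}$ commute with each other, $\omega_i\omega_i^{-1}=\omega_i'\omega_i'^{-1}=1$; $\omega_ie_j\omega_i^{-1}=q_{ij}e_j$, $\omega_i'e_j\omega_i'^{-1}=q_{ji}^{-1}e_j$; $\omega_if_j\omega_i^{-1}=q_{ij}^{-1}f_j$,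 $\omega_i'f_j\omega_i'^{-1}=q_{ji}f_j$; $e_if_j-f_je_i=\delta_{ij}\frac{q_{ii}}{q_{ii}-1}(\omega_i-\omega_i')$; and for $i\neq j$ $$\sum_{k=0}^{1-a_{ij}}(-1)^k\tbinom{1-a_{ij}}{k}_{q_{ii}}q_{ii}^{k(k-1)/2}q_{ij}^k e_i^{1-a_{ij}-k}e_je_i^k=0,\qquad \sum_{k=0}^{1-a_{ij}}(-1)^k\tbinom{1-a_{ij}}{k}_{q_{ii}}q_{ii}^{k(k-1)/2}q_{ij}^k f_i^kf_jf_i^{1-a_{ij}-k}=0.$$ It is a Hopf algebra with $\omega_i^{\pm1},\omega_i'^{\pm1}$ group-like, $\Delta(e_i)=e_i\otimes1+\omega_i\otimes e_i$, $\Delta(f_i)=1\otimes f_i+f_i\otimes\omega_i'$. $U_{\mathbf q}^+$ is the subalgebra generated by all $e_i$, graded by $\deg e_i=\alpha_i$ with components $(U_{\mathbf q}^+)_\beta$; $\omega_\nu=\prod\omega_i^{\nu_i}$ for $\nu=\sum\nu_i\alpha_i$. For $x\in(U_{\mathbf q}^+)_\beta$ one has $\Delta(x)\in\bigoplus_{0\le\nu\le\beta}(U_{\mathbf q}^+)_{\beta-\nu}\omega_\nu\otimes(U_{\mathbf q}^+)_\nu$; define $\hat\partial_i(x)\in(U_{\mathbf q}^+)_{\beta-\alpha_i}$ by requiring that the component of $\Delta(x)$ in $(U_{\mathbf q}^+)_{\beta-\alpha_i}\omega_i\otimes(U_{\mathbf q}^+)_{\alpha_i}$ be $\hat\partial_i(x)\omega_i\otimes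 e_i$ (zero if $\beta-\alpha_i\notin Q^+$), and set $\partial_i=\frac{q_{ii}}{1-q_{ii}}\hat\partial_i$, extended linearly. $\mathcal F$ is the free associative unital $\mathbb K$-algebra on letters $w_i$ ($i\in I$), with $|w_i|=\alpha_i$. For a word $w=w_{i_1}\cdots w_{i_k}$ put $\partial_w=\partial_{i_1}\cdots\partial_{i_k}$, $\partial_1=\mathrm{Id}$; the sum defining $\Gamma(x)$ runs over all words $w$ of degree $\mu$, and then $\partial_w(x)\in(U_{\mathbf q}^+)_0=\mathbb K$. *)

theory Defs
  imports
    "HOL-Algebra.Algebraic_Closure_Type"
    "HOL-Algebra.QuotRing"
    "HOL-Algebra.Generated_Rings"
    "HOL-Library.Poly_Mapping"
    "HOL-Library.Product_Plus"
    "HOL-Library.Multiset"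
begin

section \<open>Cartan data and parameters\<close>

definition gen_cartan_matrix :: "('i \<Rightarrow> 'i \<Rightarrow> int) \<Rightarrow> bool" where
  "gen_cartan_matrix A \<longleftrightarrow>
     (\<forall>i. A i i = 2) \<and>
     (\<forall>i j. i \<noteq> j \<longrightarrow> A i j \<le> 0) \<and>
     (\<forall>i j. A i j = 0 \<longleftrightarrow> A j i = 0)"

definition symmetrizable :: "('i \<Rightarrow> 'i \<Rightarrow> int) \<Rightarrow> bool" where
  "symmetrizable A \<longleftrightarrow>
     (\<exists>d :: 'i \<Rightarrow> int. (\<forall>i. d i > 0) \<and> (\<forall>i j. d i * A i j = d j * A j i))"

text \<open>
  ``Indeterminates subject to \<open>q i j * q j i = q i i powi A i j\<close>'': the parameters satisfy these
  relations and are otherwise as independent as possible. A Laurent monomial is encoded by its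
  exponent matrix; \<open>relation_exponents A i j\<close> is the exponent matrix of
  \<open>q i j * q j i * q i i powi (- A i j)\<close>. The lattice \<open>dependent_exponents A\<close> is the
  saturation of the lattice spanned by these: it consists of the exponents of those monomials some
  positive power of which is forced to be 1. The saturation is needed because the quotient by the
  unsaturated lattice can have torsion (e.g. the relations force
  \<open>q 1 1 powi A 1 2 = q 2 2 powi A 2 1\<close>, so for \<open>A 1 2 = A 2 1 = -2\<close> they force
  \<open>q 1 1 = q 2 2\<close> or \<open>q 1 1 = - q 2 2\<close>), and then no family in a field is free modulo
  the unsaturated lattice. Linear independence over the rationals of monomials that are pairwise
  incongruent modulo the saturation says that the field generated by the parameters has the
  largest transcendence degree that the relations allow.
\<close>

definition relation_exponents ::
  "('i \<Rightarrow> 'i \<Rightarrow> int) \<Rightarrow> 'i \<Rightarrow> 'i \<Rightarrow> ('i \<Rightarrow> 'i \<Rightarrow> int)" where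
  "relation_exponents A i j = (\<lambda>k l.
     of_bool (k = i \<and> l = j) + of_bool (k = j \<and> l = i) - A i j * of_bool (k = i \<and> l = i))"

definition dependent_exponents ::
  "('i::finite \<Rightarrow> 'i \<Rightarrow> int) \<Rightarrow> ('i \<Rightarrow> 'i \<Rightarrow> int) set" where
  "dependent_exponents A = {m. \<exists>n::int. n > 0 \<and> (\<exists>c :: 'i \<Rightarrow> 'i \<Rightarrow> int.
     \<forall>k l. n * m k l = (\<Sum>i\<in>UNIV. \<Sum>j\<in>UNIV. c i j * relation_exponents A i j k l))}"

definition laurent_monomial ::
  "('i::finite \<Rightarrow> 'i \<Rightarrow> 'k::field) \<Rightarrow> ('i \<Rightarrow> 'i \<Rightarrow> int) \<Rightarrow> 'k" where
  "laurent_monomial q m = (\<Prod>i\<in>UNIV. \<Prod>j\<in>UNIV. q i j powi m i j)"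

definition indeterminate_parameters ::
  "('i::finite \<Rightarrow> 'i \<Rightarrow> int) \<Rightarrow> ('i \<Rightarrow> 'i \<Rightarrow> 'k::field_char_0) \<Rightarrow> bool" where
  "indeterminate_parameters A q \<longleftrightarrow>
     (\<forall>i j. q i j \<noteq> 0) \<and>
     (\<forall>i j. q i j * q j i = q i i powi A i j) \<and>
     (\<forall>S (c :: ('i \<Rightarrow> 'i \<Rightarrow> int) \<Rightarrow> rat).
        finite S \<longrightarrow>
        (\<forall>m\<in>S. \<forall>m'\<in>S. m \<noteq> m' \<longrightarrow> (\<lambda>k l. m k l - m' k l) \<notin> dependent_exponents A) \<longrightarrow>
        (\<Sum>m\<in>S. of_rat (c m) * laurent_monomial q m) = 0 \<longrightarrow>
        (\<forall>m\<in>S. c m = 0))"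

definition involutive_field_automorphism :: "('k::field \<Rightarrow> 'k) \<Rightarrow> bool" where
  "involutive_field_automorphism \<tau> \<longleftrightarrow>
     (\<forall>x y. \<tau> (x + y) = \<tau> x + \<tau> y) \<and> (\<forall>x y. \<tau> (x * y) = \<tau> x * \<tau> y) \<and>
     \<tau> 1 = 1 \<and> (\<forall>x. \<tau> (\<tau> x) = x)"

definition quantum_int :: "'k::field \<Rightarrow> nat \<Rightarrow> 'k" where
  "quantum_int v n = (v ^ n - 1) / (v - 1)"

definition quantum_fact :: "'k::field \<Rightarrow> nat \<Rightarrow> 'k" where
  "quantum_fact v n = (\<Prod>r = 1..n. quantum_int v r)"

definition quantum_binomial :: "'k::field \<Rightarrow> nat \<Rightarrow> nat \<Rightarrow> 'k" where
  "quantum_binomial v n k = quantum_fact v n / (quantum_fact v k * quantum_fact v (n - k))"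


section \<open>Free algebras\<close>

text \<open>
  The free monoid on a type, written additively, so that finitely supported functions on it,
  with the convolution product of \<open>Poly_Mapping\<close>, form the free associative unital algebra.
  Finitely supported functions on pairs of words form the tensor product of two free algebras.
\<close>

datatype 'x word = Word (letters: "'x list")

instantiation word :: (type) monoid_add
begin

definition zero_word :: "'a word" where
  "zero_word = Word []"

definition plus_word :: "'a word \<Rightarrow> 'a word \<Rightarrow> 'a word" where
  "plus_word u v = Word (letters u @ letters v)"

instance
  by standard (simp_all add: zero_word_def plus_word_def)

end

type_synonym ('x, 'k) free_algebra = "'x word \<Rightarrow>\<^sub>0 'k"
type_synonym ('x, 'k) free_algebra2 = "('x word \<times> 'x word) \<Rightarrow>\<^sub>0 'k"

definition scal :: "'k::zero \<Rightarrow> ('m::zero \<Rightarrow>\<^sub>0 'k)" where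
  "scal c = Poly_Mapping.single 0 c"

definition var :: "'x \<Rightarrow> ('x, 'k::zero_neq_one) free_algebra" where
  "var x = Poly_Mapping.single (Word [x]) 1"

definition tensor ::
  "('x, 'k::semiring_1) free_algebra \<Rightarrow> ('x, 'k) free_algebra \<Rightarrow> ('x, 'k) free_algebra2" where
  "tensor a b = (\<Sum>u\<in>Poly_Mapping.keys a. \<Sum>v\<in>Poly_Mapping.keys b.
     Poly_Mapping.single (u, v) (Poly_Mapping.lookup a u * Poly_Mapping.lookup b v))"

text \<open>The algebra homomorphism out of the free algebra with prescribed values on the letters.\<close>

definition free_extend ::
  "('x \<Rightarrow> ('m::monoid_add \<Rightarrow>\<^sub>0 'k)) \<Rightarrow> ('x, 'k::ring_1) free_algebra \<Rightarrow> ('m \<Rightarrow>\<^sub>0 'k)" where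
  "free_extend g a = (\<Sum>w\<in>Poly_Mapping.keys a.
     scal (Poly_Mapping.lookup a w) * prod_list (map g (letters w)))"


section \<open>The multiparameter quantum group\<close>

datatype 'i gen =
  GenE 'i | GenF 'i | GenOmega 'i | GenOmegaInv 'i | GenOmega' 'i | GenOmegaInv' 'i

abbreviation "fE i \<equiv> var (GenE i)"
abbreviation "fF i \<equiv> var (GenF i)"
abbreviation "fOm i \<equiv> var (GenOmega i)"
abbreviation "fOmInv i \<equiv> var (GenOmegaInv i)"
abbreviation "fOm' i \<equiv> var (GenOmega' i)"
abbreviation "fOmInv' i \<equiv> var (GenOmegaInv' i)"

definition toral :: "('i gen, 'k::zero_neq_one) free_algebra set" where
  "toral = range (\<lambda>i. fOm i) \<union> range (\<lambda>i. fOmInv i) \<union>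
     range (\<lambda>i. fOm' i) \<union> range (\<lambda>i. fOmInv' i)"

text \<open>
  The value of the comultiplication on the generators, lifted to the tensor square of the
  free algebra.
\<close>

fun comult_gen :: "'i gen \<Rightarrow> ('i gen, 'k::ring_1) free_algebra2" where
  "comult_gen (GenE i) = tensor (fE i) 1 + tensor (fOm i) (fE i)"
| "comult_gen (GenF i) = tensor 1 (fF i) + tensor (fF i) (fOm' i)"
| "comult_gen (GenOmega i) = tensor (fOm i) (fOm i)"
| "comult_gen (GenOmegaInv i) = tensor (fOmInv i) (fOmInv i)"
| "comult_gen (GenOmega' i) = tensor (fOm' i) (fOm' i)"
| "comult_gen (GenOmegaInv' i) = tensor (fOmInv' i) (fOmInv' i)"

text \<open>
  Elements of \<open>Q\<^sup>+\<close> are multisets of indices: the simple root of \<open>i\<close> is \<open>{#i#}\<close>, the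
  partial order is \<open>\<subseteq>#\<close>, and the degree of a word is the multiset of its letters.
\<close>

context
  fixes A :: "'i::finite \<Rightarrow> 'i \<Rightarrow> int"
    and q :: "'i \<Rightarrow> 'i \<Rightarrow> 'k::field_char_0"
begin

definition serre_e :: "'i \<Rightarrow> 'i \<Rightarrow> ('i gen, 'k) free_algebra" where
  "serre_e i j = (let n = nat (1 - A i j) in
     \<Sum>k = 0..n. scal ((- 1) ^ k * quantum_binomial (q i i) n k
                       * q i i ^ (k * (k - 1) div 2) * q i j ^ k)
                 * (fE i ^ (n - k) * fE j * fE i ^ k))"

definition serre_f :: "'i \<Rightarrow> 'i \<Rightarrow> ('i gen, 'k) free_algebra" where
  "serre_f i j = (let n = nat (1 - A i j) in
     \<Sum>k = 0..n. scal ((- 1) ^ k * quantum_binomial (q i i) n k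
                       * q i i ^ (k * (k - 1) div 2) * q i j ^ k)
                 * (fF i ^ k * fF j * fF i ^ (n - k)))"

definition Uq_relators :: "('i gen, 'k) free_algebra set" where
  "Uq_relators =
     {s * t - t * s | s t. s \<in> toral \<and> t \<in> toral} \<union>
     (\<Union>i. {fOm i * fOmInv i - 1, fOm' i * fOmInv' i - 1}) \<union>
     (\<Union>i j. {fOm i * fE j * fOmInv i - scal (q i j) * fE j,
             fOm' i * fE j * fOmInv' i - scal (inverse (q j i)) * fE j,
             fOm i * fF j * fOmInv i - scal (inverse (q i j)) * fF j,
             fOm' i * fF j * fOmInv' i - scal (q j i) * fF j,
             fE i * fF j - fF j * fE i
               - (if i = j then scal (q i i / (q i i - 1)) * (fOm i - fOm' i) else 0)}) \<union>
     {serre_e i j | i j. i \<noteq> j} \<union>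
     {serre_f i j | i j. i \<noteq> j}"

definition Uq_ideal :: "('i gen, 'k) free_algebra set" where
  "Uq_ideal = Idl\<^bsub>ring_of_type_algebra\<^esub> Uq_relators"

definition Uq :: "('i gen, 'k) free_algebra set ring" where
  "Uq = ring_of_type_algebra Quot Uq_ideal"

definition Uq_class :: "('i gen, 'k) free_algebra \<Rightarrow> ('i gen, 'k) free_algebra set" where
  "Uq_class a = Uq_ideal +>\<^bsub>ring_of_type_algebra\<^esub> a"

text \<open>
  With \<open>F\<close> the free algebra and \<open>J\<close> the ideal above, the tensor square of \<open>F / J\<close> is the
  quotient of the tensor square of \<open>F\<close> by the ideal \<open>J \<otimes> F + F \<otimes> J\<close>.
\<close>

definition Uq2_ideal :: "('i gen, 'k) free_algebra2 set" where
  "Uq2_ideal = Idl\<^bsub>ring_of_type_algebra\<^esub> {tensor a b | a b. a \<in> Uq_ideal \<or> b \<in> Uq_ideal}"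

definition Uq2 :: "('i gen, 'k) free_algebra2 set ring" where
  "Uq2 = ring_of_type_algebra Quot Uq2_ideal"

definition Uq_tensor ::
  "('i gen, 'k) free_algebra set \<Rightarrow> ('i gen, 'k) free_algebra set
     \<Rightarrow> ('i gen, 'k) free_algebra2 set" where
  "Uq_tensor x y = (\<Union>a\<in>x. \<Union>b\<in>y. Uq2_ideal +>\<^bsub>ring_of_type_algebra\<^esub> tensor a b)"

text \<open>The algebra homomorphism induced by the values on the generators.\<close>

definition comult :: "('i gen, 'k) free_algebra set \<Rightarrow> ('i gen, 'k) free_algebra2 set" where
  "comult x = (\<Union>a\<in>x. Uq2_ideal +>\<^bsub>ring_of_type_algebra\<^esub> free_extend comult_gen a)"

definition Uq_scal :: "'k \<Rightarrow> ('i gen, 'k) free_algebra set" where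
  "Uq_scal c = Uq_class (scal c)"

definition Uq_e :: "'i \<Rightarrow> ('i gen, 'k) free_algebra set" where
  "Uq_e i = Uq_class (fE i)"

definition Uq_omega :: "'i \<Rightarrow> ('i gen, 'k) free_algebra set" where
  "Uq_omega i = Uq_class (fOm i)"

text \<open>The \<open>\<omega>\<^sub>i\<close> commute, so the order in which the factors are multiplied is irrelevant.\<close>

definition Uq_omega_mset :: "'i multiset \<Rightarrow> ('i gen, 'k) free_algebra set" where
  "Uq_omega_mset \<nu> =
     foldr (\<lambda>i x. Uq_omega i \<otimes>\<^bsub>Uq\<^esub> x) (SOME l. mset l = \<nu>) \<one>\<^bsub>Uq\<^esub>"

definition Uq_e_word :: "'i list \<Rightarrow> ('i gen, 'k) free_algebra set" where
  "Uq_e_word l = foldr (\<lambda>i x. Uq_e i \<otimes>\<^bsub>Uq\<^esub> x) l \<one>\<^bsub>Uq\<^esub>"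

definition Uq_plus :: "('i gen, 'k) free_algebra set set" where
  "Uq_plus = generate_ring Uq (range Uq_scal \<union> range Uq_e)"

definition Uq_plus_comp :: "'i multiset \<Rightarrow> ('i gen, 'k) free_algebra set set" where
  "Uq_plus_comp \<beta> =
     generate (add_monoid Uq) {Uq_scal c \<otimes>\<^bsub>Uq\<^esub> Uq_e_word l | c l. mset l = \<beta>}"

definition homogeneous_parts ::
  "('i gen, 'k) free_algebra set \<Rightarrow> 'i multiset \<Rightarrow> ('i gen, 'k) free_algebra set" where
  "homogeneous_parts x = (THE c.
     (\<forall>\<beta>. c \<beta> \<in> Uq_plus_comp \<beta>) \<and>
     finite {\<beta>. c \<beta> \<noteq> \<zero>\<^bsub>Uq\<^esub>} \<and>
     x = (\<Oplus>\<^bsub>Uq\<^esub>\<beta>\<in>{\<beta>. c \<beta> \<noteq> \<zero>\<^bsub>Uq\<^esub>}. c \<beta>))"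

definition degrees :: "('i gen, 'k) free_algebra set \<Rightarrow> 'i multiset set" where
  "degrees x = {\<beta>. homogeneous_parts x \<beta> \<noteq> \<zero>\<^bsub>Uq\<^esub>}"

definition comult_comp :: "'i multiset \<Rightarrow> 'i multiset \<Rightarrow> ('i gen, 'k) free_algebra2 set set" where
  "comult_comp \<beta> \<nu> = generate (add_monoid Uq2)
     {Uq_tensor (a \<otimes>\<^bsub>Uq\<^esub> Uq_omega_mset \<nu>) b | a b.
        a \<in> Uq_plus_comp (\<beta> - \<nu>) \<and> b \<in> Uq_plus_comp \<nu>}"

definition hat_partial_hom ::
  "'i multiset \<Rightarrow> 'i \<Rightarrow> ('i gen, 'k) free_algebra set \<Rightarrow> ('i gen, 'k) free_algebra set" where
  "hat_partial_hom \<beta> i x = (if i \<in># \<beta> then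
     (THE y. y \<in> Uq_plus_comp (\<beta> - {#i#}) \<and>
        (\<exists>t. (\<forall>\<nu>. \<nu> \<subseteq># \<beta> \<longrightarrow> t \<nu> \<in> comult_comp \<beta> \<nu>) \<and>
             comult x = (\<Oplus>\<^bsub>Uq2\<^esub>\<nu>\<in>{\<nu>. \<nu> \<subseteq># \<beta>}. t \<nu>) \<and>
             t {#i#} = Uq_tensor (y \<otimes>\<^bsub>Uq\<^esub> Uq_omega i) (Uq_e i)))
     else \<zero>\<^bsub>Uq\<^esub>)"

definition hat_partial ::
  "'i \<Rightarrow> ('i gen, 'k) free_algebra set \<Rightarrow> ('i gen, 'k) free_algebra set" where
  "hat_partial i x = (\<Oplus>\<^bsub>Uq\<^esub>\<beta>\<in>degrees x. hat_partial_hom \<beta> i (homogeneous_parts x \<beta>))"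

definition skew_partial ::
  "'i \<Rightarrow> ('i gen, 'k) free_algebra set \<Rightarrow> ('i gen, 'k) free_algebra set" where
  "skew_partial i x = Uq_scal (q i i / (1 - q i i)) \<otimes>\<^bsub>Uq\<^esub> hat_partial i x"

definition skew_partial_word ::
  "'i list \<Rightarrow> ('i gen, 'k) free_algebra set \<Rightarrow> ('i gen, 'k) free_algebra set" where
  "skew_partial_word l x = foldr skew_partial l x"

text \<open>The identification of the degree 0 component with the ground field.\<close>

definition scalar_of :: "('i gen, 'k) free_algebra set \<Rightarrow> 'k" where
  "scalar_of x = (THE c. x = Uq_scal c)"

definition Gamma_hom ::
  "'i multiset \<Rightarrow> ('i gen, 'k) free_algebra set \<Rightarrow> ('i, 'k) free_algebra" where
  "Gamma_hom \<mu> x =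
     (\<Sum>l\<in>{l. mset l = \<mu>}. Poly_Mapping.single (Word l) (scalar_of (skew_partial_word l x)))"

definition Gamma :: "('i gen, 'k) free_algebra set \<Rightarrow> ('i, 'k) free_algebra" where
  "Gamma x = (\<Sum>\<mu>\<in>degrees x. Gamma_hom \<mu> (homogeneous_parts x \<mu>))"

end

end

theory Submission
  imports Defs
begin

text \<open>
  Let \<open>S\<close> be the ideal of the free algebra \<open>F\<close> on the letters \<open>i\<close> generated by the quantum Serre
  elements. Up to nonzero factors, the coefficients of \<open>\<Gamma>(x)\<close> are the pairings of a lift of \<open>x\<close> with
  the words, so injectivity means that \<open>U\<^sup>+ = F / S\<close> and that the radical of the pairing is \<open>S\<close>.

  For the first point, \<open>U\<close> acts on \<open>F / S\<close> with \<open>e\<^sub>i\<close> acting by left multiplication, so a relation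
  between the \<open>e\<^sub>i\<close> can be applied to 1. For the second, let \<open>\<beta>\<close> be a minimal degree in which some
  \<open>x \<notin> S\<close> lies in the radical. Both skew derivations in direction \<open>i\<close> map \<open>x\<close> into \<open>S\<close>, so \<open>x\<close> is
  a lowest weight vector for the quantum \<open>sl(2)\<close> attached to \<open>i\<close>; since the adjoint action is
  locally nilpotent modulo \<open>S\<close>, this gives \<open>(\<beta>, \<alpha>\<^sub>i) \<le> 0\<close> for all \<open>i\<close>. A Casimir operator, built from
  dual bases in the degrees below \<open>\<beta>\<close>, fixes \<open>x\<close> modulo \<open>S\<close> and acts on degree \<open>\<beta>\<close> by the scalar
  \<open>\<chi>(\<beta>, \<beta>) / \<Prod> q\<^sub>i\<^sub>i ^ \<beta>\<^sub>i\<close>. As the parameters are independent, this scalar can only be 1 if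
  \<open>(\<beta>, \<beta>) = 2 (\<rho>, \<beta>)\<close>, which contradicts \<open>(\<beta>, \<beta>) \<le> 0 < 2 (\<rho>, \<beta>)\<close>.
\<close>

section \<open>Linear maps on free algebras\<close>

text \<open>All computations take place in the free algebra, modulo \<open>S\<close> or modulo the
  ideal of relations, because derivations, pairing and grading are explicit on words. The module on
  which \<open>U\<close> acts is a Verma module of weight zero, so each letter, seen as a vector, is
  killed by every f_k. This makes the Casimir argument possible: dual families exist only in degrees
  strictly below \<beta>, where the radical is already known to be \<open>S\<close>, and the missing
  term of degree \<beta> would act by zero on degree \<beta> anyway. Independence of the parameters
  enters through one additive function of the exponents, the sum of
  \<open>d k * A k l * m k l\<close>. It vanishes on every forced relation and so turns an identity
  between monomials into one between integers. The objects of the theorem are selected by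
  \<open>THE\<close> among cosets. Evaluating them requires that the coproduct respects the
  relations, that the positive part is graded, and that the component with e_i in the second factor
  determines its first factor. The grading is a consequence of the description of \<open>S\<close>
  as a radical, since a radical is visibly graded.\<close>

abbreviation (input) lk :: "('m \<Rightarrow>\<^sub>0 'k::zero) \<Rightarrow> 'm \<Rightarrow> 'k" where "lk \<equiv> Poly_Mapping.lookup"
abbreviation (input) sg :: "'m \<Rightarrow> 'k::zero \<Rightarrow> ('m \<Rightarrow>\<^sub>0 'k)" where "sg \<equiv> Poly_Mapping.single"

lemma scal_mult_lookup: "lk (scal c * (x :: 'm::monoid_add \<Rightarrow>\<^sub>0 'k::comm_semiring_1)) w = c * lk x w"
proof -
  have "scal c * x = Poly_Mapping.map ((*) c) x"
    by (simp add: scal_def mult_map_scale_conv_mult)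
  thus ?thesis by (simp add: Poly_Mapping.map.rep_eq when_def)
qed

lemma scal_single: "scal c * (sg u d :: 'm::monoid_add \<Rightarrow>\<^sub>0 'k::comm_semiring_1) = sg u (c * d)"
  by (simp add: scal_def mult_single)

lemma scal_0 [simp]: "scal 0 = 0" by (simp add: scal_def)
lemma scal_1 [simp]: "scal 1 = 1" by (simp add: scal_def)
lemma scal_add: "scal (a + b) = scal a + scal (b::'k::comm_monoid_add)"
  by (simp add: scal_def single_add)
lemma scal_mult: "(scal (a * b) :: 'm::monoid_add \<Rightarrow>\<^sub>0 'k::comm_semiring_1) = scal a * scal b"
  by (simp add: scal_def mult_single)
lemma scal_minus: "(scal (- a) :: 'm::monoid_add \<Rightarrow>\<^sub>0 'k::comm_ring_1) = - scal a"
  by (simp add: scal_def single_uminus)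
lemma scal_diff: "(scal (a - b) :: 'm::monoid_add \<Rightarrow>\<^sub>0 'k::comm_ring_1) = scal a - scal b"
  by (simp add: scal_def single_diff)
lemma poly_mapping_sum_single:
  "(x :: 'm \<Rightarrow>\<^sub>0 'k::comm_monoid_add) = (\<Sum>w\<in>Poly_Mapping.keys x. sg w (lk x w))"
  by (rule poly_mapping_eqI)
    (auto simp: lookup_sum lookup_single when_def in_keys_iff)

lemma poly_mapping_linear_induct:
  fixes x :: "'m::monoid_add \<Rightarrow>\<^sub>0 'k::comm_semiring_1"
  assumes "P 0" "\<And>x y. P x \<Longrightarrow> P y \<Longrightarrow> P (x + y)"
    and "\<And>c u. u \<in> Poly_Mapping.keys x \<Longrightarrow> P (scal c * sg u 1)"
  shows "P x"
proof -
  have "P (\<Sum>w\<in>K. sg w (lk x w))" if "finite K" "K \<subseteq> Poly_Mapping.keys x" for K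
    using that
  proof (induction K rule: finite_induct)
    case (insert u K)
    have "P (scal (lk x u) * sg u 1)" using insert assms(3) by auto
    thus ?case using insert assms(2) by (simp add: scal_single)
  qed (use assms(1) in simp)
  from this[of "Poly_Mapping.keys x"] show ?thesis
    using poly_mapping_sum_single[of x] by simp
qed

lemma scal_commute: "scal c * (x :: 'm::monoid_add \<Rightarrow>\<^sub>0 'k::comm_semiring_1) = x * scal c"
proof (induction x rule: poly_mapping_linear_induct)
  case (3 d u) show ?case
    by (simp add: scal_single) (simp add: scal_def mult_single mult_ac)
qed (simp_all add: algebra_simps)

lemma mult_scal_left: "x * (scal c * y) = scal c * (x * (y :: 'm::monoid_add \<Rightarrow>\<^sub>0 'k::comm_semiring_1))"
  by (metis mult.assoc scal_commute)

lemma scal_scal: "scal a * (scal b * x) = scal (a * b) * (x :: 'm::monoid_add \<Rightarrow>\<^sub>0 'k::comm_semiring_1)"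
  by (simp add: scal_mult mult.assoc)

text \<open>Scalars act as multiplication by the central elements \<open>scal c\<close>, so
  linearity over the field is a predicate on plain functions between algebras of finitely supported
  functions.\<close>

definition klin :: "(('m::monoid_add \<Rightarrow>\<^sub>0 'k::comm_ring_1) \<Rightarrow> ('n::monoid_add \<Rightarrow>\<^sub>0 'k)) \<Rightarrow> bool" where
  "klin f \<longleftrightarrow> (\<forall>x y. f (x + y) = f x + f y) \<and> (\<forall>c x. f (scal c * x) = scal c * f x)"

lemma klinI:
  assumes "\<And>x y. f (x + y) = f x + f y" "\<And>c x. f (scal c * x) = scal c * f x"
  shows "klin f" using assms by (simp add: klin_def)

lemma klin_add: "klin f \<Longrightarrow> f (x + y) = f x + f y" by (simp add: klin_def)
lemma klin_scal: "klin f \<Longrightarrow> f (scal c * x) = scal c * f x" by (simp add: klin_def)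
lemma klin_zero: "klin f \<Longrightarrow> f 0 = 0" using klin_scal[of f 0 0] by simp
lemma klin_uminus: "klin f \<Longrightarrow> f (- x) = - f x"
  using klin_add[of f x "- x"] by (simp add: klin_zero eq_neg_iff_add_eq_0 add.commute)
lemma klin_diff: "klin f \<Longrightarrow> f (x - y) = f x - f y"
  using klin_add[of f x "- y"] by (simp add: klin_uminus)
lemma klin_sum: assumes "klin f" shows "f (sum g K) = (\<Sum>k\<in>K. f (g k))"
  by (induction K rule: infinite_finite_induct) (simp_all add: klin_zero[OF assms] klin_add[OF assms])
lemmas klin_simps = klin_add klin_scal klin_zero klin_uminus klin_diff klin_sum

lemma klin_id [intro]: "klin (\<lambda>x. x)" by (simp add: klin_def)
lemma klin_0 [intro]: "klin (\<lambda>x. 0)" by (simp add: klin_def)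
lemma klin_comp: "klin f \<Longrightarrow> klin g \<Longrightarrow> klin (\<lambda>x. f (g x))" by (simp add: klin_def)
lemma klin_plus: "klin f \<Longrightarrow> klin g \<Longrightarrow> klin (\<lambda>x. f x + g x)" by (simp add: klin_def algebra_simps)
lemma klin_minus: "klin f \<Longrightarrow> klin g \<Longrightarrow> klin (\<lambda>x. f x - g x)" by (simp add: klin_def algebra_simps)
lemma klin_mult_left: "klin f \<Longrightarrow> klin (\<lambda>x. a * f x)"
  by (simp add: klin_def algebra_simps mult_scal_left)
lemma klin_mult_right: "klin f \<Longrightarrow> klin (\<lambda>x. f x * a)" by (simp add: klin_def algebra_simps)
lemma klin_setsum: "(\<And>k. k \<in> K \<Longrightarrow> klin (f k)) \<Longrightarrow> klin (\<lambda>x. \<Sum>k\<in>K. f k x)"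
  by (induction K rule: infinite_finite_induct) (simp_all add: klin_0 klin_plus)
lemma klin_foldr: "(\<And>k. klin (f k)) \<Longrightarrow> klin (foldr f w)"
proof (induction w)
  case (Cons a w) thus ?case using klin_comp[of "f a" "foldr f w"] by (simp add: o_def)
qed (simp add: klin_def)

lemma klin_eq_on:
  assumes "klin f" "klin g" "\<And>u. u \<in> Poly_Mapping.keys x \<Longrightarrow> f (sg u 1) = g (sg u 1)"
  shows "f x = g x"
  by (rule poly_mapping_linear_induct[of "\<lambda>x. f x = g x"]) (use assms(3) in \<open>auto simp: klin_simps[OF assms(1)] klin_simps[OF assms(2)]\<close>)

definition lin :: "('m::monoid_add \<Rightarrow> ('n::monoid_add \<Rightarrow>\<^sub>0 'k)) \<Rightarrow> ('m \<Rightarrow>\<^sub>0 'k::comm_ring_1) \<Rightarrow> ('n \<Rightarrow>\<^sub>0 'k)" where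
  "lin g x = (\<Sum>w\<in>Poly_Mapping.keys x. scal (lk x w) * g w)"

lemma lin_superset:
  assumes "finite K" "Poly_Mapping.keys x \<subseteq> K"
  shows "lin g x = (\<Sum>w\<in>K. scal (lk x w) * g w)"
  unfolding lin_def by (rule sum.mono_neutral_left) (use assms in \<open>auto simp: in_keys_iff\<close>)

lemma klin_lin [intro]:
  fixes g :: "'m::monoid_add \<Rightarrow> ('n::monoid_add \<Rightarrow>\<^sub>0 'k::comm_ring_1)"
  shows "klin (lin g)"
proof (rule klinI)
  fix x y :: "'m \<Rightarrow>\<^sub>0 'k"
  let ?K = "Poly_Mapping.keys x \<union> Poly_Mapping.keys y"
  have "lin g (x + y) = (\<Sum>w\<in>?K. scal (lk (x + y) w) * g w)"
    by (rule lin_superset) (use keys_add[of x y] in auto)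
  also have "\<dots> = (\<Sum>w\<in>?K. scal (lk x w) * g w) + (\<Sum>w\<in>?K. scal (lk y w) * g w)"
    by (simp add: lookup_add scal_add algebra_simps sum.distrib)
  also have "\<dots> = lin g x + lin g y"
    by (simp add: lin_superset[of ?K x] lin_superset[of ?K y])
  finally show "lin g (x + y) = lin g x + lin g y" .
next
  fix c and x :: "'m \<Rightarrow>\<^sub>0 'k"
  have "lin g (scal c * x) = (\<Sum>w\<in>Poly_Mapping.keys x. scal (lk (scal c * x) w) * g w)"
    by (rule lin_superset) (auto simp: in_keys_iff scal_mult_lookup)
  also have "\<dots> = scal c * lin g x"
    by (simp add: lin_def scal_mult_lookup scal_mult sum_distrib_left mult.assoc)
  finally show "lin g (scal c * x) = scal c * lin g x" .
qed

lemma lin_single [simp]: "lin g (sg u c) = scal c * g u"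
  by (cases "c = 0") (simp_all add: lin_def)

lemma free_extend_eq_lin: "free_extend g = lin (\<lambda>w. prod_list (map g (letters w)))"
  by (simp add: fun_eq_iff free_extend_def lin_def)

lemma klin_mult_eqI:
  assumes "klin f" "\<And>u v. f (sg u 1 * sg v 1) = f (sg u 1) * f (sg v 1)"
  shows "f (x * y) = f x * f y"
proof -
  have *: "f (sg u 1 * y) = f (sg u 1) * f y" for u
  proof (rule klin_eq_on[of "\<lambda>y. f (sg u 1 * y)" "\<lambda>y. f (sg u 1) * f y"])
    show "klin (\<lambda>y. f (sg u 1 * y))" by (rule klin_comp[OF assms(1) klin_mult_left[OF klin_id]])
  qed (rule klin_mult_left[OF assms(1)], rule assms(2))
  show ?thesis
  proof (rule klin_eq_on[of "\<lambda>x. f (x * y)" "\<lambda>x. f x * f y"])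
    show "klin (\<lambda>x. f (x * y))" by (rule klin_comp[OF assms(1) klin_mult_right[OF klin_id]])
  qed (rule klin_mult_right[OF assms(1)], rule *)
qed

lemma zero_word [simp]: "Word [] = 0" by (simp only: zero_word_def)
lemma letters_zero [simp]: "letters 0 = []" by (simp only: zero_word_def word.sel)
lemma Word_eq_0 [simp]: "Word l = 0 \<longleftrightarrow> l = []" "0 = Word l \<longleftrightarrow> l = []"
  by (auto simp only: zero_word_def word.inject)
lemma letters_plus [simp]: "letters (u + v) = letters u @ letters v" by (simp add: plus_word_def)
lemma Word_plus: "Word u + Word v = Word (u @ v)" by (simp add: plus_word_def)

definition mono :: "'x list \<Rightarrow> ('x, 'k::comm_ring_1) free_algebra" where
  "mono l = sg (Word l) 1"

lemma single_eq_mono: "sg w 1 = mono (letters w)" by (simp add: mono_def)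
lemma mono_Nil [simp]: "mono [] = 1" by (simp add: mono_def)
lemma mono_append: "mono (u @ v) = mono u * mono v" by (simp add: mono_def mult_single Word_plus)
lemma mono_Cons: "mono (j # v) = mono [j] * mono v" by (simp add: mono_append[symmetric])
lemma var_eq_mono: "var i = mono [i]" by (simp add: var_def mono_def)
lemma lookup_mono: "lk (mono l) w = (if w = Word l then 1 else 0)"
  by (simp add: mono_def lookup_single when_def)
lemma keys_mono [simp]: "Poly_Mapping.keys (mono l :: ('x,'k::comm_ring_1) free_algebra) = {Word l}"
  by (simp add: mono_def)

lemma free_extend_mult: "free_extend g (x * y) = free_extend g x * free_extend g (y :: ('x,'k::comm_ring_1) free_algebra)"
  unfolding free_extend_eq_lin
  by (rule klin_mult_eqI) (auto simp: mult_single)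

lemma klin_free_extend: "klin (free_extend g)" for g :: "'x \<Rightarrow> ('m::monoid_add \<Rightarrow>\<^sub>0 'k::comm_ring_1)"
  unfolding free_extend_eq_lin by auto

lemma free_extend_mono: "free_extend g (mono l) = prod_list (map g l)"
  by (simp add: free_extend_eq_lin mono_def)

definition lext :: "('x list \<Rightarrow> ('n::monoid_add \<Rightarrow>\<^sub>0 'k)) \<Rightarrow> ('x, 'k::comm_ring_1) free_algebra \<Rightarrow> ('n \<Rightarrow>\<^sub>0 'k)" where
  "lext g = lin (\<lambda>w. g (letters w))"

lemma klin_lext [intro]: "klin (lext g)" by (simp add: lext_def klin_lin)
lemma lext_mono [simp]: "lext g (mono l) = g l" by (simp add: lext_def mono_def)

section \<open>Homogeneous elements and homogeneous components\<close>

definition homog :: "'x multiset \<Rightarrow> ('x, 'k::comm_ring_1) free_algebra \<Rightarrow> bool" where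
  "homog \<gamma> x \<longleftrightarrow> (\<forall>w\<in>Poly_Mapping.keys x. mset (letters w) = \<gamma>)"

lemma homog_0 [simp]: "homog \<gamma> 0" by (simp add: homog_def)
lemma homog_mono: "homog \<gamma> (mono l) \<longleftrightarrow> mset l = \<gamma>" by (simp add: homog_def)
lemma homog_one [simp]: "homog \<gamma> 1 \<longleftrightarrow> \<gamma> = {#}" using homog_mono[of \<gamma> "[]"] by auto
lemma homog_add: "homog \<gamma> x \<Longrightarrow> homog \<gamma> y \<Longrightarrow> homog \<gamma> (x + y)"
  using keys_add[of x y] by (auto simp: homog_def)
lemma homog_scal: "homog \<gamma> x \<Longrightarrow> homog \<gamma> (scal c * x)"
  by (auto simp: homog_def in_keys_iff scal_mult_lookup)
lemma homog_uminus: "homog \<gamma> x \<Longrightarrow> homog \<gamma> (- x)"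
  by (auto simp: homog_def in_keys_iff)
lemma homog_diff: "homog \<gamma> x \<Longrightarrow> homog \<gamma> y \<Longrightarrow> homog \<gamma> (x - y)"
  using homog_add[of \<gamma> x "- y"] homog_uminus[of \<gamma> y] by simp
lemma homog_mult: "homog \<gamma> x \<Longrightarrow> homog \<delta> y \<Longrightarrow> homog (\<gamma> + \<delta>) (x * y)"
  using keys_mult[of x y] by (fastforce simp: homog_def)

lemma homog_induct [consumes 1, case_names zero add mono]:
  assumes "homog \<gamma> x" "P 0" "\<And>x y. homog \<gamma> x \<Longrightarrow> homog \<gamma> y \<Longrightarrow> P x \<Longrightarrow> P y \<Longrightarrow> P (x + y)"
    and "\<And>c l. mset l = \<gamma> \<Longrightarrow> P (scal c * mono l)"
  shows "P x"
proof -
  have "homog \<gamma> x \<and> P x"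
  proof (rule poly_mapping_linear_induct[of "\<lambda>x. homog \<gamma> x \<and> P x"])
    fix c u assume "u \<in> Poly_Mapping.keys x"
    hence u: "mset (letters u) = \<gamma>" using assms(1) by (simp add: homog_def)
    show "homog \<gamma> (scal c * sg u 1) \<and> P (scal c * sg u 1)"
      unfolding single_eq_mono using assms(4)[OF u] by (simp add: homog_scal homog_mono u)
  qed (use assms in \<open>auto intro: homog_add\<close>)
  thus ?thesis ..
qed

lemma free_algebra_induct [case_names add mono]:
  assumes "\<And>x y. P x \<Longrightarrow> P y \<Longrightarrow> P (x + y)" "\<And>c l. P (scal c * mono l)"
  shows "P (x :: ('x,'k::comm_ring_1) free_algebra)"
proof (rule poly_mapping_linear_induct[of P])
  show "P 0" using assms(2)[of 0] by simp
  show "P (scal c * sg u 1)" for c u unfolding single_eq_mono by (rule assms(2))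
qed (rule assms(1))

lemma klin_eq_homog:
  assumes "klin f" "klin g" "homog \<gamma> x" "\<And>l. mset l = \<gamma> \<Longrightarrow> f (mono l) = g (mono l)"
  shows "f x = g x"
proof (rule klin_eq_on[OF assms(1,2)])
  fix u assume "u \<in> Poly_Mapping.keys x"
  thus "f (sg u 1) = g (sg u 1)"
    unfolding single_eq_mono using assms(3,4) by (simp add: homog_def)
qed

lemma klin_eq:
  assumes "klin f" "klin g" "\<And>l. f (mono l) = g (mono l)"
  shows "f x = g x"
  by (rule klin_eq_on[OF assms(1,2)]) (simp only: single_eq_mono assms(3))

lemma homog_klin:
  assumes "klin f" "homog \<gamma> x" "\<And>l. mset l = \<gamma> \<Longrightarrow> homog \<delta> (f (mono l))"
  shows "homog \<delta> (f x)"
  using assms(2)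
proof (induction rule: homog_induct)
  case (mono c l) thus ?case using assms(3) by (simp add: klin_scal[OF assms(1)] homog_scal)
qed (simp_all add: klin_zero[OF assms(1)] klin_add[OF assms(1)] homog_add)

lemma finite_mset_eq [simp]: "finite {l. mset l = \<gamma>}"
proof (rule finite_subset)
  show "{l. mset l = \<gamma>} \<subseteq> {l. set l \<subseteq> set_mset \<gamma> \<and> length l = size \<gamma>}" by auto
qed (rule finite_lists_length_eq, simp)

definition hcomp :: "'x multiset \<Rightarrow> ('x, 'k::comm_ring_1) free_algebra \<Rightarrow> ('x, 'k) free_algebra" where
  "hcomp \<gamma> = lext (\<lambda>l. if mset l = \<gamma> then mono l else 0)"

definition mdegs :: "('x, 'k::comm_ring_1) free_algebra \<Rightarrow> 'x multiset set" where
  "mdegs x = (\<lambda>w. mset (letters w)) ` Poly_Mapping.keys x"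

lemma finite_mdegs [simp]: "finite (mdegs x)" by (simp add: mdegs_def)
lemma klin_cmp [intro]: "klin (hcomp \<gamma>)" by (auto simp: hcomp_def)
lemma cmp_mono: "hcomp \<gamma> (mono l) = (if mset l = \<gamma> then mono l else 0)" by (simp add: hcomp_def)
lemma homog_cmp [simp]: "homog \<gamma> (hcomp \<gamma> x)"
  by (induction x rule: free_algebra_induct)
    (auto simp: klin_simps[OF klin_cmp] cmp_mono homog_mono intro: homog_add homog_scal)
lemma cmp_homog: "homog \<gamma> x \<Longrightarrow> hcomp \<delta> x = (if \<delta> = \<gamma> then x else 0)"
  by (induction rule: homog_induct) (auto simp: klin_simps[OF klin_cmp] cmp_mono)
lemma lookup_cmp: "lk (hcomp \<gamma> x) w = (if mset (letters w) = \<gamma> then lk x w else 0)"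
proof (induction x rule: free_algebra_induct)
  case (mono c l) thus ?case
    by (auto simp: klin_simps[OF klin_cmp] cmp_mono scal_mult_lookup lookup_mono)
qed (auto simp: klin_simps[OF klin_cmp] lookup_add)
lemma cmp_eq_0: "\<gamma> \<notin> mdegs x \<Longrightarrow> hcomp \<gamma> x = 0"
  by (rule poly_mapping_eqI) (auto simp: lookup_cmp mdegs_def in_keys_iff)

lemma sum_cmp: "finite D \<Longrightarrow> mdegs x \<subseteq> D \<Longrightarrow> (\<Sum>\<gamma>\<in>D. hcomp \<gamma> x) = x"
  by (rule poly_mapping_eqI)
    (auto simp: lookup_sum lookup_cmp mdegs_def image_subset_iff in_keys_iff)

section \<open>Skew derivations of the free algebra\<close>

text \<open>The bicharacter of \<open>Q^+\<close> with values \<open>p i j\<close> on simple roots: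
  \<open>chi q {#i#} \<gamma>\<close> is the factor picked up when \<omega>_i moves past an element
  of degree \<gamma>.\<close>

definition chi :: "('i \<Rightarrow> 'i \<Rightarrow> 'k::comm_ring_1) \<Rightarrow> 'i multiset \<Rightarrow> 'i multiset \<Rightarrow> 'k" where
  "chi p \<mu> \<nu> = (\<Prod>i\<in>#\<mu>. \<Prod>j\<in>#\<nu>. p i j)"

lemma chi_empty [simp]: "chi p {#} \<nu> = 1" "chi p \<mu> {#} = 1"
  by (simp_all add: chi_def)
lemma chi_add_left: "chi p (\<mu> + \<mu>') \<nu> = chi p \<mu> \<nu> * chi p \<mu>' \<nu>"
  by (simp add: chi_def)
lemma chi_add_right: "chi p \<mu> (\<nu> + \<nu>') = chi p \<mu> \<nu> * chi p \<mu> \<nu>'"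
  by (simp add: chi_def prod_mset.distrib)
lemma chi_add_mset_left: "chi p (add_mset i \<mu>) \<nu> = chi p {#i#} \<nu> * chi p \<mu> \<nu>"
  using chi_add_left[of p "{#i#}" \<mu> \<nu>] by simp
lemma chi_add_mset_right: "chi p \<mu> (add_mset i \<nu>) = chi p \<mu> {#i#} * chi p \<mu> \<nu>"
  using chi_add_right[of p \<mu> "{#i#}" \<nu>] by simp
lemma chi_single [simp]: "chi p {#i#} {#j#} = p i j"
  by (simp add: chi_def)

definition swap_param :: "('i \<Rightarrow> 'i \<Rightarrow> 'k) \<Rightarrow> 'i \<Rightarrow> 'i \<Rightarrow> 'k" where
  "swap_param p = (\<lambda>i j. p j i)"
text \<open>For these parameters the right derivation becomes, up to a scalar on each degree, the
  left derivation for \<open>p\<close>; see \<open>dR_inv_param\<close>.\<close>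

definition inv_param :: "('i \<Rightarrow> 'i \<Rightarrow> 'k::field) \<Rightarrow> 'i \<Rightarrow> 'i \<Rightarrow> 'k" where
  "inv_param p = (\<lambda>i j. inverse (p j i))"

lemma chi_swap_param: "chi (swap_param p) \<mu> \<nu> = chi p \<nu> \<mu>"
proof (induction \<mu>)
  case (add i \<mu>)
  have "chi (swap_param p) {#i#} \<nu> = chi p \<nu> {#i#}"
  proof (induction \<nu>)
    case (add x \<nu>)
    thus ?case using chi_add_mset_left[of p x \<nu> "{#i#}"] chi_add_mset_right[of "swap_param p" "{#i#}" x \<nu>]
      by (simp add: swap_param_def)
  qed simp
  thus ?case using add by (simp add: chi_add_mset_left[of _ i \<mu>] chi_add_mset_right[of _ _ i \<mu>])
qed simp

lemma chi_inv_param: "chi (inv_param p) \<mu> \<nu> = inverse (chi p \<nu> (\<mu> :: 'i multiset) :: 'k::field)"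
proof (induction \<mu>)
  case (add i \<mu>)
  have "chi (inv_param p) {#i#} \<nu> = inverse (chi p \<nu> {#i#})"
  proof (induction \<nu>)
    case (add x \<nu>)
    thus ?case using chi_add_mset_left[of p x \<nu> "{#i#}"] chi_add_mset_right[of "inv_param p" "{#i#}" x \<nu>]
      by (simp add: inv_param_def)
  qed simp
  thus ?case using add by (simp add: chi_add_mset_left[of _ i \<mu>] chi_add_mset_right[of _ _ i \<mu>])
qed simp

lemma chi_nonzero: "(\<And>i j. p i j \<noteq> (0::'k::field)) \<Longrightarrow> chi p \<mu> \<nu> \<noteq> 0"
  by (simp add: chi_def prod_mset_zero_iff image_iff)

text \<open>\<open>dR q k\<close> lifts the map \<open>hat_partial k\<close> to the free algebra; \<open>dL\<close> is its mirror image, which reads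
  off the letters from the other end of a word.\<close>

fun dRw :: "('i \<Rightarrow> 'i \<Rightarrow> 'k::comm_ring_1) \<Rightarrow> 'i \<Rightarrow> 'i list \<Rightarrow> ('i, 'k) free_algebra" where
  "dRw p k [] = 0"
| "dRw p k (j # w) = mono [j] * dRw p k w + (if j = k then scal (chi p {#k#} (mset w)) * mono w else 0)"

fun dLw :: "('i \<Rightarrow> 'i \<Rightarrow> 'k::comm_ring_1) \<Rightarrow> 'i \<Rightarrow> 'i list \<Rightarrow> ('i, 'k) free_algebra" where
  "dLw p k [] = 0"
| "dLw p k (j # w) = scal (p j k) * (mono [j] * dLw p k w) + (if j = k then mono w else 0)"

definition dR :: "('i \<Rightarrow> 'i \<Rightarrow> 'k::comm_ring_1) \<Rightarrow> 'i \<Rightarrow> ('i, 'k) free_algebra \<Rightarrow> ('i, 'k) free_algebra" where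
  "dR p k = lext (dRw p k)"
definition dL :: "('i \<Rightarrow> 'i \<Rightarrow> 'k::comm_ring_1) \<Rightarrow> 'i \<Rightarrow> ('i, 'k) free_algebra \<Rightarrow> ('i, 'k) free_algebra" where
  "dL p k = lext (dLw p k)"

lemma klin_dR [intro!]: "klin (dR p k)" by (simp add: dR_def klin_lext)
lemma klin_dL [intro!]: "klin (dL p k)" by (simp add: dL_def klin_lext)
lemmas dR_simps = klin_simps[OF klin_dR]
lemmas dL_simps = klin_simps[OF klin_dL]
lemma dR_mono: "dR p k (mono w) = dRw p k w" by (simp add: dR_def)
lemma dL_mono: "dL p k (mono w) = dLw p k w" by (simp add: dL_def)
lemma dR_one [simp]: "dR p k 1 = 0" using dR_mono[of p k "[]"] by simp
lemma dL_one [simp]: "dL p k 1 = 0" using dL_mono[of p k "[]"] by simp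

lemma homog_dRw: "homog (mset w - {#k#}) (dRw p k w)"
proof (induction w)
  case (Cons j w)
  have "homog ({#j#} + (mset w - {#k#})) (mono [j] * dRw p k w)"
    by (rule homog_mult) (use Cons in \<open>auto simp: homog_mono\<close>)
  moreover have "k \<in># mset w \<or> dRw p k w = 0"
    by (induction w) auto
  ultimately show ?case
    by (cases "j = k") (auto intro!: homog_add homog_scal simp: homog_mono)
qed auto
lemma dRw_0: "k \<notin> set w \<Longrightarrow> dRw p k w = 0"
  by (induction w) auto
lemma homog_dLw: "homog (mset w - {#k#}) (dLw p k w)"
proof (induction w)
  case (Cons j w)
  have "homog ({#j#} + (mset w - {#k#})) (mono [j] * dLw p k w)"
    by (rule homog_mult) (use Cons in \<open>auto simp: homog_mono\<close>)
  moreover have "k \<in># mset w \<or> dLw p k w = 0"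
    by (induction w) auto
  ultimately show ?case
    by (cases "j = k") (auto intro!: homog_add homog_scal simp: homog_mono)
qed auto
lemma dLw_0: "k \<notin> set w \<Longrightarrow> dLw p k w = 0"
  by (induction w) auto

lemma homog_dR: "homog \<gamma> x \<Longrightarrow> homog (\<gamma> - {#k#}) (dR p k x)"
  by (erule homog_klin[OF klin_dR]) (auto simp: dR_mono homog_dRw)
lemma homog_dL: "homog \<gamma> x \<Longrightarrow> homog (\<gamma> - {#k#}) (dL p k x)"
  by (erule homog_klin[OF klin_dL]) (auto simp: dL_mono homog_dLw)
lemma dR_0: "homog \<gamma> x \<Longrightarrow> k \<notin># \<gamma> \<Longrightarrow> dR p k x = 0"
  by (rule klin_eq_homog[OF klin_dR klin_0]) (auto simp: dR_mono dRw_0)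
lemma dL_0: "homog \<gamma> x \<Longrightarrow> k \<notin># \<gamma> \<Longrightarrow> dL p k x = 0"
  by (rule klin_eq_homog[OF klin_dL klin_0]) (auto simp: dL_mono dLw_0)

text \<open>Skew Leibniz rule: a letter \<open>k\<close> removed from \<open>x\<close> still has to
  travel to the right end past all of \<open>y\<close>, whence the factor
  \<open>chi p {#k#} \<delta>\<close>.\<close>

lemma dR_mult:
  assumes "homog \<delta> y"
  shows "dR p k (x * y) = x * dR p k y + scal (chi p {#k#} \<delta>) * (dR p k x * y)"
proof (rule klin_eq[of "\<lambda>x. dR p k (x * y)"])
  show "klin (\<lambda>x. dR p k (x * y))"
    by (rule klin_comp[OF klin_dR klin_mult_right[OF klin_id]])
  show "klin (\<lambda>x. x * dR p k y + scal (chi p {#k#} \<delta>) * (dR p k x * y))"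
    by (intro klin_plus klin_mult_left klin_mult_right klin_id klin_dR)
  fix l
  show "dR p k (mono l * y) = mono l * dR p k y + scal (chi p {#k#} \<delta>) * (dR p k (mono l) * y)"
  proof (rule klin_eq_homog[where f="\<lambda>y. dR p k (mono l * y)" and g="\<lambda>y. mono l * dR p k y + scal (chi p {#k#} \<delta>) * (dR p k (mono l) * y)", OF _ _ assms])
    show "klin (\<lambda>y. dR p k (mono l * y))"
      by (rule klin_comp[OF klin_dR klin_mult_left[OF klin_id]])
    show "klin (\<lambda>y. mono l * dR p k y + scal (chi p {#k#} \<delta>) * (dR p k (mono l) * y))"
      by (intro klin_plus klin_mult_left klin_id klin_dR)
    fix v assume v: "mset v = \<delta>"
    show "dR p k (mono l * mono v) = mono l * dR p k (mono v) + scal (chi p {#k#} \<delta>) * (dR p k (mono l) * mono v)"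
    proof (induction l)
      case (Cons j l)
      thus ?case
        unfolding mono_append[symmetric] dR_mono
        by (simp add: mono_Cons[of j l] mono_append algebra_simps chi_add_right mult_scal_left[of "mono l" for l] scal_scal v)
    qed simp
  qed
qed

lemma dL_mult:
  assumes "homog \<gamma> x"
  shows "dL p k (x * y) = dL p k x * y + scal (chi p \<gamma> {#k#}) * (x * dL p k y)"
proof (rule klin_eq_homog[where f="\<lambda>x. dL p k (x * y)" and g="\<lambda>x. dL p k x * y + scal (chi p \<gamma> {#k#}) * (x * dL p k y)", OF _ _ assms])
  show "klin (\<lambda>x. dL p k (x * y))"
    by (rule klin_comp[OF klin_dL klin_mult_right[OF klin_id]])
  show "klin (\<lambda>x. dL p k x * y + scal (chi p \<gamma> {#k#}) * (x * dL p k y))"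
    by (intro klin_plus klin_mult_left klin_mult_right klin_id klin_dL)
  fix l assume l: "mset l = \<gamma>"
  have "dL p k (mono l * y) = dL p k (mono l) * y + scal (chi p (mset l) {#k#}) * (mono l * dL p k y)"
  proof (rule klin_eq[where f="\<lambda>y. dL p k (mono l * y)" and g="\<lambda>y. dL p k (mono l) * y + scal (chi p (mset l) {#k#}) * (mono l * dL p k y)"])
    show "klin (\<lambda>y. dL p k (mono l * y))"
      by (rule klin_comp[OF klin_dL klin_mult_left[OF klin_id]])
    show "klin (\<lambda>y. dL p k (mono l) * y + scal (chi p (mset l) {#k#}) * (mono l * dL p k y))"
      by (intro klin_plus klin_mult_left klin_id klin_dL)
    fix v
    show "dL p k (mono l * mono v) = dL p k (mono l) * mono v + scal (chi p (mset l) {#k#}) * (mono l * dL p k (mono v))"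
    proof (induction l)
      case (Cons j l)
      thus ?case
        unfolding mono_append[symmetric] dL_mono
        by (simp add: mono_Cons[of j l] mono_append algebra_simps chi_add_mset_left[of _ j "mset l"] mult_scal_left[of "mono l" for l] scal_scal)
    qed simp
  qed
  thus "dL p k (mono l * y) = dL p k (mono l) * y + scal (chi p \<gamma> {#k#}) * (mono l * dL p k y)"
    by (simp add: l)
qed

lemma dR_gen [simp]: "dR p k (mono [j]) = (if j = k then 1 else 0)" by (simp add: dR_mono)
lemma dL_gen [simp]: "dL p k (mono [j]) = (if j = k then 1 else 0)" by (simp add: dL_mono)
lemma homog_gen [simp]: "homog \<gamma> (mono [j]) \<longleftrightarrow> \<gamma> = {#j#}" by (auto simp: homog_mono)

lemma dR_Cons: "homog \<gamma> y \<Longrightarrow> dR p k (mono [j] * y) =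
    mono [j] * dR p k y + (if j = k then scal (chi p {#k#} \<gamma>) * y else 0)"
  by (simp add: dR_mult)
lemma dR_snoc: "dR p k (y * mono [j]) = scal (p k j) * (dR p k y * mono [j]) + (if j = k then y else 0)"
  by (simp add: dR_mult[of "{#j#}"])
lemma dL_Cons: "dL p k (mono [j] * y) = scal (p j k) * (mono [j] * dL p k y) + (if j = k then y else 0)"
  by (simp add: dL_mult[of "{#j#}"])
lemma dL_snoc: "homog \<gamma> y \<Longrightarrow> dL p k (y * mono [j]) =
    dL p k y * mono [j] + (if j = k then scal (chi p \<gamma> {#k#}) * y else 0)"
  by (simp add: dL_mult)

text \<open>\<open>dR\<close> carries the removed \<open>j\<close> to the right end,
  \<open>dL\<close> carries the removed \<open>k\<close> to the left end. The two letters cross only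
  if \<open>j\<close> stands before \<open>k\<close>, and the crossing then costs
  \<open>p j k\<close> in either order of removal.\<close>

lemma dL_dR_commute: "dL p k (dR p j x) = dR p j (dL p k x)"
proof (rule klin_eq[where f="\<lambda>x. dL p k (dR p j x)" and g="\<lambda>x. dR p j (dL p k x)"])
  show "klin (\<lambda>x. dL p k (dR p j x))" by (rule klin_comp[OF klin_dL klin_dR])
  show "klin (\<lambda>x. dR p j (dL p k x))" by (rule klin_comp[OF klin_dR klin_dL])
  fix l
  show "dL p k (dR p j (mono l)) = dR p j (dL p k (mono l))"
  proof (induction l)
    case (Cons a l)
    have h: "homog (mset l - {#k#}) (dL p k (mono l))" by (rule homog_dL) (simp add: homog_mono)
    show ?case
    proof (cases "k \<in> set l")
      case True
      hence "chi p {#j#} (mset l) = p j k * chi p {#j#} (mset l - {#k#})"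
        using chi_add_mset_right[of p "{#j#}" k "mset l - {#k#}"] by simp
      thus ?thesis
        by (simp add: mono_Cons[of a l] dR_Cons[OF h] dR_Cons[of "mset l"] homog_mono dL_Cons dR_simps dL_simps Cons algebra_simps scal_scal mult.commute)
    next
      case False
      hence "dL p k (mono l) = 0" by (simp add: dL_mono dLw_0)
      thus ?thesis using Cons
        by (simp add: mono_Cons[of a l] dR_Cons[of "mset l"] homog_mono dL_Cons dR_simps dL_simps algebra_simps)
    qed
  qed (simp add: dR_simps dL_simps)
qed

lemma lookup_Cons_0: "lk (mono [a] * x) 0 = (0 :: 'k::comm_ring_1)"
proof (induction x rule: free_algebra_induct)
  case (mono c l)
  thus ?case by (simp add: mult_scal_left[of "mono l" for l] scal_mult_lookup mono_Cons[symmetric] lookup_mono)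
qed (simp add: distrib_left lookup_add)

text \<open>Only the word with the single letter \<open>k\<close> contributes, and both derivations
  send it to 1.\<close>

lemma dR_dL_lookup_0: "lk (dR p k x) 0 = lk (dL p k x) 0"
proof (induction x rule: free_algebra_induct)
  case (mono c l)
  have "lk (dRw p k l) 0 = lk (dLw p k l) 0"
    by (cases l) (auto simp: lookup_add lookup_Cons_0 scal_mult_lookup lookup_mono)
  thus ?case by (simp add: dR_simps dL_simps scal_mult_lookup dR_mono dL_mono)
qed (simp add: lookup_add dR_simps dL_simps)

text \<open>The free algebra acts on a space through arbitrary operators assigned to its letters.
  The construction is used with \<open>dR\<close> for the pairing, with \<open>Phi\<close> for the
  f_k, and with \<open>gact\<close> for all generators of \<open>U\<close>.\<close>

definition opx :: "('i \<Rightarrow> ('n::monoid_add \<Rightarrow>\<^sub>0 'k) \<Rightarrow> ('n \<Rightarrow>\<^sub>0 'k)) \<Rightarrow> ('i, 'k::comm_ring_1) free_algebra \<Rightarrow> ('n \<Rightarrow>\<^sub>0 'k) \<Rightarrow> ('n \<Rightarrow>\<^sub>0 'k)" where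
  "opx f u y = lext (\<lambda>w. foldr f w y) u"

lemma klin_opx1: "klin (\<lambda>u. opx f u y)" by (simp add: opx_def klin_lext)
lemmas opx_simps = klin_simps[OF klin_opx1]
lemma opx_mono [simp]: "opx f (mono w) y = foldr f w y" by (simp add: opx_def)
lemma klin_opx2: assumes "\<And>k. klin (f k)" shows "klin (opx f u)"
proof (induction u rule: free_algebra_induct)
  case (add x y)
  have "opx f (x + y) = (\<lambda>z. opx f x z + opx f y z)" by (simp add: fun_eq_iff opx_simps)
  thus ?case using klin_plus[OF add] by simp
next
  case (mono c l)
  have "opx f (scal c * mono l) = (\<lambda>z. scal c * foldr f l z)" by (simp add: fun_eq_iff opx_simps)
  thus ?case using klin_mult_left[OF klin_foldr[OF assms]] by simp
qed
lemma opx_Cons: assumes "\<And>k. klin (f k)" shows "opx f (mono [j] * u) y = f j (opx f u y)"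
proof (rule klin_eq[where f="\<lambda>u. opx f (mono [j] * u) y" and g="\<lambda>u. f j (opx f u y)"])
  show "klin (\<lambda>u. opx f (mono [j] * u) y)" by (rule klin_comp[OF klin_opx1 klin_mult_left[OF klin_id]])
  show "klin (\<lambda>u. f j (opx f u y))" by (rule klin_comp[OF assms klin_opx1])
qed (simp add: mono_append[symmetric])
lemma opx_snoc: "opx f (u * mono [j]) y = opx f u (f j y)"
proof (rule klin_eq[where f="\<lambda>u. opx f (u * mono [j]) y" and g="\<lambda>u. opx f u (f j y)"])
  show "klin (\<lambda>u. opx f (u * mono [j]) y)" by (rule klin_comp[OF klin_opx1 klin_mult_right[OF klin_id]])
  show "klin (\<lambda>u. opx f u (f j y))" by (rule klin_opx1)
qed (simp add: mono_append[symmetric])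

section \<open>The pairing and its adjunctions\<close>

definition pair :: "('i \<Rightarrow> 'i \<Rightarrow> 'k::comm_ring_1) \<Rightarrow> 'i list \<Rightarrow> ('i, 'k) free_algebra \<Rightarrow> 'k" where
  "pair p w y = lk (foldr (dR p) w y) 0"
definition bil :: "('i \<Rightarrow> 'i \<Rightarrow> 'k::comm_ring_1) \<Rightarrow> ('i, 'k) free_algebra \<Rightarrow> ('i, 'k) free_algebra \<Rightarrow> 'k" where
  "bil p u y = lk (opx (dR p) u y) 0"

lemma bil_mono: "bil p (mono w) y = pair p w y" by (simp add: bil_def pair_def)
lemma bil_left: "bil p (u + v) y = bil p u y + bil p v y" "bil p (scal c * u) y = c * bil p u y" "bil p 0 y = 0"
  by (simp_all add: bil_def opx_simps lookup_add scal_mult_lookup)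
lemmas opx_dR = klin_simps[OF klin_opx2[of "dR p" for p, OF klin_dR]]
lemma bil_right: "bil p u (y + z) = bil p u y + bil p u z" "bil p u (scal c * y) = c * bil p u y" "bil p u 0 = 0"
  "bil p u (- y) = - bil p u y" "bil p u (y - z) = bil p u y - bil p u z"
  by (simp_all add: bil_def opx_dR lookup_add scal_mult_lookup lookup_minus)
lemmas pair_right = bil_right[of p "mono w" for p w, unfolded bil_mono]
lemma pair_Nil [simp]: "pair p [] y = lk y 0" by (simp add: pair_def)
lemma pair_snoc: "pair p (w @ [k]) y = pair p w (dR p k y)" by (simp add: pair_def)

lemma foldr_dR_dL: "foldr (dR p) w (dL p k y) = dL p k (foldr (dR p) w y)"
  by (induction w) (simp_all add: dL_dR_commute)

text \<open>The last letter of a word is adjoint to \<open>dR\<close> by construction. The first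
  letter is adjoint to \<open>dL\<close>, because \<open>dL\<close> can be moved inside past all the
  \<open>dR\<close> and has the same constant term as \<open>dR\<close>.\<close>

lemma pair_Cons: "pair p (k # w) y = pair p w (dL p k y)"
  by (simp add: pair_def foldr_dR_dL dR_dL_lookup_0)

lemma bil_snoc: "bil p (u * mono [k]) y = bil p u (dR p k y)"
  by (simp add: bil_def opx_snoc)
lemma bil_Cons: "bil p (mono [k] * u) y = bil p u (dL p k y)"
proof (induction u rule: free_algebra_induct)
  case (mono c l)
  show ?case by (simp add: mult_scal_left[of "mono l" for l] bil_left mono_Cons[symmetric] bil_mono pair_Cons)
qed (simp add: distrib_left bil_left)

lemma homog_foldr_dR:
  assumes "homog \<gamma> y"
  shows "homog (\<gamma> - mset w) (foldr (dR p) w y)"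
    and "\<not> mset w \<subseteq># \<gamma> \<Longrightarrow> foldr (dR p) w y = 0"
proof (induction w)
  case Nil
  { case 1 show ?case using assms by simp next case 2 thus ?case by simp }
next
  case (Cons k w)
  { case 1 show ?case using homog_dR[OF Cons(1), of k p] by (simp add: diff_diff_add_mset) }
  { case 2
    show ?case
    proof (cases "mset w \<subseteq># \<gamma>")
      case True
      have "k \<notin># \<gamma> - mset w"
        using 2 subset_mset.le_diff_conv2[OF True, of "{#k#}"] by simp
      thus ?thesis using dR_0[OF Cons(1)] by simp
    qed (use Cons(2) in \<open>simp add: dR_simps\<close>) }
qed

lemma pair_degree:
  assumes "homog \<gamma> y" "mset w \<noteq> \<gamma>"
  shows "pair p w y = 0"
proof (rule ccontr)
  assume nz: "pair p w y \<noteq> 0"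
  hence sub: "mset w \<subseteq># \<gamma>"
    using homog_foldr_dR(2)[OF assms(1), of w p] by (cases "mset w \<subseteq># \<gamma>") (auto simp: pair_def)
  have "0 \<in> Poly_Mapping.keys (foldr (dR p) w y)"
    using nz by (simp add: pair_def in_keys_iff)
  from bspec[OF homog_foldr_dR(1)[OF assms(1), of w p, unfolded homog_def] this]
  have "\<gamma> - mset w = {#}" by simp
  thus False using sub assms(2) by (simp add: Diff_eq_empty_iff_mset subset_mset.order_antisym)
qed

text \<open>Adjunction in the second argument. The parameters are transposed because exchanging the
  two arguments of the pairing transposes \<open>p\<close>.\<close>

lemma bil_mult_gen: "bil p u (y * mono [k]) = bil p (dR (swap_param p) k u) y"
proof (induction u rule: free_algebra_induct)
  case (mono c w)
  have "bil p (mono w) (y * mono [k]) = bil p (dR (swap_param p) k (mono w)) y"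
  proof (induction w arbitrary: y rule: rev_induct)
    case Nil
    have "lk (y * mono [k]) 0 = 0"
    proof (induction y rule: free_algebra_induct)
      case (mono c l)
      thus ?case by (simp add: mult.assoc scal_mult_lookup mono_append[symmetric] lookup_mono)
    qed (simp add: distrib_right lookup_add)
    thus ?case by (simp add: bil_def opx_simps opx_mono[of _ "[]", simplified])
  next
    case (snoc j w)
    show ?case
      by (simp add: mono_append bil_snoc dR_snoc bil_right bil_left snoc swap_param_def[of p])
  qed
  thus ?case by (simp add: bil_left dR_simps)
qed (simp add: bil_left dR_simps)

lemma bil_gen_mult: "bil p u (mono [k] * y) = bil p (dL (swap_param p) k u) y"
proof (induction u rule: free_algebra_induct)
  case (mono c w)
  have "bil p (mono w) (mono [k] * y) = bil p (dL (swap_param p) k (mono w)) y"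
  proof (induction w arbitrary: y)
    case Nil
    thus ?case by (simp add: bil_def opx_simps opx_mono[of _ "[]", simplified] lookup_Cons_0)
  next
    case (Cons j w)
    show ?case
      by (simp add: mono_Cons[of j w] bil_Cons dL_Cons bil_right bil_left Cons)
         (simp add: swap_param_def)
  qed
  thus ?case by (simp add: bil_left dL_simps)
qed (simp add: bil_left dL_simps)

lemma mult_scal_gen: "mono [j] * (scal c * y) = scal c * (mono [j] * (y :: ('i,'k::comm_ring_1) free_algebra))"
  by (rule mult_scal_left)

text \<open>Up to a scalar, this is the action of \<open>f\<^sub>k\<close> on the Verma module with underlying space \<open>F\<close>.\<close>

definition Phi :: "('i \<Rightarrow> 'i \<Rightarrow> 'k::field) \<Rightarrow> 'i \<Rightarrow> ('i, 'k) free_algebra \<Rightarrow> ('i, 'k) free_algebra" where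
  "Phi q k x = dR (inv_param q) k x - dR q k x"

lemma klin_Phi [intro!]: "klin (Phi q k)"
  unfolding Phi_def[abs_def] by (rule klin_minus[OF klin_dR klin_dR])
lemmas Phi_simps = klin_simps[OF klin_Phi]
lemma Phi_one [simp]: "Phi q k 1 = 0" by (simp add: Phi_def)
lemma Phi_gen [simp]: "Phi q k (mono [j]) = 0" by (simp add: Phi_def)
lemma homog_Phi: "homog \<gamma> x \<Longrightarrow> homog (\<gamma> - {#k#}) (Phi q k x)"
  unfolding Phi_def by (intro homog_diff homog_dR)
lemma Phi_0: "homog \<gamma> x \<Longrightarrow> k \<notin># \<gamma> \<Longrightarrow> Phi q k x = 0"
  by (simp add: Phi_def dR_0)

text \<open>The relation between e_j and f_k in the Verma module:
  \<open>inverse (chi q \<gamma> {#k#})\<close> and \<open>chi q {#k#} \<gamma>\<close> are the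
  eigenvalues of \<omega>'_k and \<omega>_k on degree \<gamma>.\<close>

lemma Phi_Cons: "homog \<gamma> z \<Longrightarrow> Phi q k (mono [j] * z) = mono [j] * Phi q k z
    + (if j = k then scal (inverse (chi q \<gamma> {#k#}) - chi q {#k#} \<gamma>) * z else 0)"
  by (simp add: Phi_def dR_Cons chi_inv_param scal_diff algebra_simps)

text \<open>Moving the removed letter to the right with inverted parameters, instead of to the left
  with \<open>q\<close>, changes the scalar by the bicharacter with all the letters that
  remain.\<close>

lemma dR_inv_param:
  assumes "\<And>i j. q i j \<noteq> (0::'k::field)" "homog \<gamma> x"
  shows "dR (inv_param q) k x = scal (inverse (chi q (\<gamma> - {#k#}) {#k#})) * dL q k x"
proof -
  have "dR (inv_param q) k (mono l) = scal (inverse (chi q (mset l - {#k#}) {#k#})) * dL q k (mono l)" for l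
  proof (induction l)
    case (Cons j l)
    have nz: "chi q \<mu> \<nu> \<noteq> 0" for \<mu> \<nu> by (rule chi_nonzero) (rule assms(1))
    have "scal (inverse (chi q (mset (j # l) - {#k#}) {#k#})) * (scal (q j k) * (mono [j] * dL q k (mono l)))
        = scal (inverse (chi q (mset l - {#k#}) {#k#})) * (mono [j] * dL q k (mono l))"
    proof (cases "k \<in> set l")
      case True
      have "mset (j # l) - {#k#} = add_mset j (mset l - {#k#})" using True by auto
      thus ?thesis using assms(1)
        by (simp add: chi_add_mset_left[of _ j "mset l - {#k#}"] scal_scal field_simps nz)
    next
      case False thus ?thesis by (simp add: dL_mono dLw_0)
    qed
    thus ?case using Cons
      by (simp add: mono_Cons[of j l] dR_Cons[of "mset l"] dL_Cons homog_mono mult_scal_gen chi_inv_param distrib_left)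
  qed simp
  thus ?thesis
    by (intro klin_eq_homog[OF klin_dR klin_mult_left[OF klin_dL] assms(2)]) simp
qed

lemma homog_foldr_Phi:
  assumes "homog \<gamma> y"
  shows "homog (\<gamma> - mset w) (foldr (Phi q) w y)"
    and "\<not> mset w \<subseteq># \<gamma> \<Longrightarrow> foldr (Phi q) w y = 0"
proof (induction w)
  case Nil
  { case 1 show ?case using assms by simp next case 2 thus ?case by simp }
next
  case (Cons k w)
  { case 1 show ?case using homog_Phi[OF Cons(1), of k q] by (simp add: diff_diff_add_mset) }
  { case 2
    show ?case
    proof (cases "mset w \<subseteq># \<gamma>")
      case True
      have "k \<notin># \<gamma> - mset w"
        using 2 subset_mset.le_diff_conv2[OF True, of "{#k#}"] by simp
      thus ?thesis using Phi_0[OF Cons(1)] by simp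
    qed (use Cons(2) in \<open>simp add: Phi_simps\<close>) }
qed

text \<open>The two derivations in \<open>Phi\<close> agree on letters, so \<open>Phi\<close> kills
  degree one and a word of full degree \<gamma> cannot reach the constants. This is what permits the
  truncation of the Casimir operator.\<close>

lemma foldr_Phi_strict:
  assumes "homog \<gamma> y" "\<gamma> \<noteq> {#}" "\<not> mset w \<subset># \<gamma>"
  shows "foldr (Phi q) w y = 0"
proof (cases "mset w = \<gamma>")
  case True
  with assms(2) obtain k v where w: "w = k # v" by (cases w) auto
  have "\<gamma> - mset v = {#k#}" using True w by auto
  hence h: "homog {#k#} (foldr (Phi q) v y)" using homog_foldr_Phi(1)[OF assms(1), of v q] by simp
  have "Phi q k (foldr (Phi q) v y) = 0"
    using h by (induction rule: homog_induct) (auto simp: Phi_simps)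
  thus ?thesis by (simp add: w)
next
  case False thus ?thesis
    using homog_foldr_Phi(2)[OF assms(1), of w q] assms(3) by (auto simp: subset_mset_def)
qed

text \<open>Scalars in front of the action of \<open>w\<close> need to agree only when
  \<open>w\<close> fits into \<gamma>; this avoids degrees computed by truncated
  subtraction.\<close>

lemma opx_scal_homog_0:
  "(mset w \<subseteq># \<gamma> \<Longrightarrow> a = b) \<Longrightarrow> homog \<gamma> y \<Longrightarrow> scal a * foldr (Phi q) w y = scal b * foldr (Phi q) w y"
  by (cases "mset w \<subseteq># \<gamma>") (auto simp: homog_foldr_Phi(2))

text \<open>Commuting e_k past a word of f's produces, for each \<open>k\<close> in the word, an
  eigenvalue of \<omega>'_k minus one of \<omega>_k. The former involves the letters to the right of
  that \<open>k\<close>, which \<open>dR\<close> records. The latter involves the inverse of the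
  same letters; it is rewritten with the letters to the left, which \<open>dL\<close> records, and
  this is the origin of \<open>inverse (chi q {#k#} (mset w)) * q k k\<close>.\<close>

lemma foldr_Phi_Cons:
  assumes nz: "\<And>i j. q i j \<noteq> (0::'k::field)" and z: "homog \<gamma> z"
  shows "foldr (Phi q) w (mono [k] * z) = mono [k] * foldr (Phi q) w z
     + scal (inverse (chi q \<gamma> {#k#})) * opx (Phi q) (dR (swap_param q) k (mono w)) z
     - scal (chi q {#k#} \<gamma> * inverse (chi q {#k#} (mset w)) * q k k)
         * opx (Phi q) (dL (swap_param q) k (mono w)) z"
proof (induction w)
  case Nil thus ?case by (simp add: opx_simps)
next
  case (Cons j w)
  have cnz: "chi q \<mu> \<nu> \<noteq> 0" for \<mu> \<nu> by (rule chi_nonzero) (rule nz)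
  let ?F = "foldr (Phi q) w z"
  let ?R = "opx (Phi q) (dR (swap_param q) k (mono w)) z"
  let ?L = "opx (Phi q) (dL (swap_param q) k (mono w)) z"
  let ?A = "inverse (chi q \<gamma> {#k#})" and ?B = "chi q {#k#} \<gamma> * inverse (chi q {#k#} (mset w)) * q k k"
  let ?B' = "chi q {#k#} \<gamma> * inverse (chi q {#k#} (mset (j # w))) * q k k"
  have h: "homog (\<gamma> - mset w) ?F" by (rule homog_foldr_Phi(1)[OF z])
  have R: "opx (Phi q) (dR (swap_param q) k (mono (j # w))) z = Phi q j ?R
      + (if j = k then scal (chi q (mset w) {#k#}) * ?F else 0)"
    by (simp add: mono_Cons[of j w] dR_Cons[of "mset w"] homog_mono opx_simps opx_Cons[OF klin_Phi] chi_swap_param)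
  have L: "opx (Phi q) (dL (swap_param q) k (mono (j # w))) z = scal (q k j) * Phi q j ?L
      + (if j = k then ?F else 0)"
    by (simp add: mono_Cons[of j w] dL_Cons opx_simps opx_Cons[OF klin_Phi] swap_param_def[of q])
  have B: "?B' * q k j = ?B"
    using nz[of k j] cnz by (simp add: chi_add_mset_right[of _ _ j "mset w"] field_simps)
  have D: "scal (inverse (chi q (\<gamma> - mset w) {#k#}) - chi q {#k#} (\<gamma> - mset w)) * ?F
      = scal (?A * chi q (mset w) {#k#} - chi q {#k#} \<gamma> * inverse (chi q {#k#} (mset w))) * ?F"
  proof (rule opx_scal_homog_0[OF _ z])
    assume sub: "mset w \<subseteq># \<gamma>"
    hence "\<gamma> = mset w + (\<gamma> - mset w)" by simp
    hence "chi q \<gamma> {#k#} = chi q (mset w) {#k#} * chi q (\<gamma> - mset w) {#k#}"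
      "chi q {#k#} \<gamma> = chi q {#k#} (mset w) * chi q {#k#} (\<gamma> - mset w)"
      by (metis chi_add_left, metis chi_add_right)
    thus "inverse (chi q (\<gamma> - mset w) {#k#}) - chi q {#k#} (\<gamma> - mset w)
      = ?A * chi q (mset w) {#k#} - chi q {#k#} \<gamma> * inverse (chi q {#k#} (mset w))"
      using cnz by (simp add: field_simps)
  qed
  have "foldr (Phi q) (j # w) (mono [k] * z) = Phi q j (mono [k] * ?F) + scal ?A * Phi q j ?R - scal ?B * Phi q j ?L"
    using Cons by (simp add: Phi_simps)
  also have "Phi q j (mono [k] * ?F) = mono [k] * Phi q j ?F
      + (if j = k then scal (?A * chi q (mset w) {#k#} - chi q {#k#} \<gamma> * inverse (chi q {#k#} (mset w))) * ?F else 0)"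
    using Phi_Cons[OF h, of q j k] D by auto
  finally have *: "foldr (Phi q) (j # w) (mono [k] * z) = mono [k] * Phi q j ?F
      + (if j = k then scal (?A * chi q (mset w) {#k#} - chi q {#k#} \<gamma> * inverse (chi q {#k#} (mset w))) * ?F else 0)
      + scal ?A * Phi q j ?R - scal ?B * Phi q j ?L" .
  have B2: "j = k \<Longrightarrow> ?B' = chi q {#k#} \<gamma> * inverse (chi q {#k#} (mset w))"
    using nz[of k k] by (simp add: chi_add_mset_right[of _ _ k "mset w"] field_simps)
  show ?case
  proof (cases "j = k")
    case True
    show ?thesis unfolding * R L distrib_left scal_scal B if_P[OF True]
      unfolding B2[OF True] by (simp add: scal_diff algebra_simps)
  next
    case False
    show ?thesis unfolding * R L distrib_left scal_scal B if_not_P[OF False] by simp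
  qed
qed

text \<open>The action of the free algebra through \<open>Phi\<close> is dual, with respect to the pairing, to a
  coaction; hence it vanishes on the radical of the pairing.\<close>

definition coact :: "('i \<Rightarrow> 'i \<Rightarrow> 'k::field) \<Rightarrow> 'i multiset \<Rightarrow> ('i, 'k) free_algebra \<Rightarrow> (('i, 'k) free_algebra \<times> ('i, 'k) free_algebra) list \<Rightarrow> bool" where
  "coact q \<nu> z ps \<longleftrightarrow> (\<forall>u. homog \<nu> u \<longrightarrow> opx (Phi q) u z = (\<Sum>(y, z') \<leftarrow> ps. scal (bil q u y) * z'))"

lemma coactI:
  fixes q :: "'i \<Rightarrow> 'i \<Rightarrow> 'k::field"
  assumes "\<And>v. mset v = \<nu> \<Longrightarrow> foldr (Phi q) v z = (\<Sum>(y, z') \<leftarrow> ps. scal (pair q v y) * z')"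
  shows "coact q \<nu> z ps"
  unfolding coact_def
proof (intro allI impI)
  fix u :: "('i, 'k) free_algebra" assume "homog \<nu> u"
  thus "opx (Phi q) u z = (\<Sum>(y, z') \<leftarrow> ps. scal (bil q u y) * z')"
  proof (induction rule: homog_induct)
    case zero show ?case by (simp add: opx_simps bil_left split_def)
  next
    case (add x y)
    thus ?case by (simp add: opx_simps bil_left split_def scal_add distrib_right sum_list_addf)
  next
    case (mono c l)
    show ?case using assms[OF mono]
      by (simp add: opx_simps bil_left bil_mono split_def scal_mult sum_list_const_mult[symmetric] mult.assoc)
  qed
qed

text \<open>Induction on words \<open>z\<close>. By \<open>foldr_Phi_Cons\<close>, a new letter
  \<open>k\<close> of \<open>z\<close> applies \<open>dR\<close> and \<open>dL\<close> to
  \<open>u\<close>; by adjunction these become right and left multiplication by \<open>k\<close> on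
  the elements paired with \<open>u\<close>.\<close>

lemma coact_exists:
  assumes nz: "\<And>i j. q i j \<noteq> (0::'k::field)"
  shows "\<exists>ps. coact q \<nu> z ps"
proof -
  have mono_case: "\<exists>ps. coact q \<nu> (mono l) ps" for l \<nu>
  proof (induction l arbitrary: \<nu>)
    case Nil
    have "foldr (Phi q) v 1 = (\<Sum>(y, z') \<leftarrow> [(1, 1)]. scal (pair q v y) * z')" for v
    proof (cases v rule: rev_cases)
      case (snoc w j)
      have "foldr f w 0 = 0" if "\<And>j. klin (f j)" for f w using klin_zero[OF klin_foldr[of f w, OF that]] .
      from this[of "Phi q" w] this[of "dR q" w] show ?thesis
        by (simp add: snoc pair_def klin_Phi klin_dR)
    qed simp
    hence "coact q \<nu> (mono []) [(1, 1)]" by (intro coactI) (simp only: mono_Nil)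
    thus ?case ..
  next
    case (Cons k l)
    let ?m = "mset l" and ?z = "mono l"
    obtain ps where ps: "coact q \<nu> ?z ps" using Cons by blast
    obtain rs where rs: "coact q (\<nu> - {#k#}) ?z rs" using Cons by blast
    let ?a = "inverse (chi q ?m {#k#})" and ?b = "chi q {#k#} ?m * inverse (chi q {#k#} \<nu>) * q k k"
    have "foldr (Phi q) v (mono [k] * ?z) = (\<Sum>(y, z') \<leftarrow> map (\<lambda>(y, z'). (y, mono [k] * z')) ps
        @ map (\<lambda>(y, z'). (y * mono [k], scal ?a * z')) rs
        @ map (\<lambda>(y, z'). (mono [k] * y, scal (- ?b) * z')) rs. scal (pair q v y) * z')" (is "_ = ?rhs")
      if v: "mset v = \<nu>" for v
    proof -
      have hv: "homog \<nu> (mono v)" using v by (simp add: homog_mono)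
      have 1: "foldr (Phi q) v ?z = (\<Sum>(y, z') \<leftarrow> ps. scal (pair q v y) * z')"
        using ps[unfolded coact_def, rule_format, OF hv] by (simp add: bil_mono)
      have 2: "opx (Phi q) (dR (swap_param q) k (mono v)) ?z = (\<Sum>(y, z') \<leftarrow> rs. scal (pair q v (y * mono [k])) * z')"
        using rs[unfolded coact_def, rule_format, OF homog_dR[OF hv]]
        by (simp add: bil_mono[symmetric] bil_mult_gen)
      have 3: "opx (Phi q) (dL (swap_param q) k (mono v)) ?z = (\<Sum>(y, z') \<leftarrow> rs. scal (pair q v (mono [k] * y)) * z')"
        using rs[unfolded coact_def, rule_format, OF homog_dL[OF hv]]
        by (simp add: bil_mono[symmetric] bil_gen_mult)
      have "foldr (Phi q) v (mono [k] * ?z) = mono [k] * (\<Sum>(y, z') \<leftarrow> ps. scal (pair q v y) * z')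
          + scal ?a * (\<Sum>(y, z') \<leftarrow> rs. scal (pair q v (y * mono [k])) * z')
          - scal ?b * (\<Sum>(y, z') \<leftarrow> rs. scal (pair q v (mono [k] * y)) * z')"
        by (subst foldr_Phi_Cons[OF nz, of ?m]) (simp_all add: homog_mono 1 2 3 v)
      also have "\<dots> = ?rhs"
        by (simp add: split_def o_def sum_list_const_mult[symmetric] mult_scal_gen scal_minus
            uminus_sum_list_map scal_scal mult.commute[of ?a] mult.commute[of ?b] sum_list_subtractf)
      finally show ?thesis .
    qed
    hence "coact q \<nu> (mono (k # l)) (map (\<lambda>(y, z'). (y, mono [k] * z')) ps
        @ map (\<lambda>(y, z'). (y * mono [k], scal ?a * z')) rs
        @ map (\<lambda>(y, z'). (mono [k] * y, scal (- ?b) * z')) rs)"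
      by (intro coactI) (simp only: mono_Cons[of k l])
    thus ?case ..
  qed
  show ?thesis
  proof (induction z rule: free_algebra_induct)
    case (add x y)
    then obtain ps rs where "coact q \<nu> x ps" "coact q \<nu> y rs" by blast
    hence "coact q \<nu> (x + y) (ps @ rs)"
      by (simp add: coact_def klin_add[OF klin_opx2[OF klin_Phi]])
    thus ?case ..
  next
    case (mono c l)
    obtain ps where ps: "coact q \<nu> (mono l) ps" using mono_case by blast
    have "coact q \<nu> (scal c * mono l) (map (\<lambda>(y, z'). (y, scal c * z')) ps)"
      using ps by (simp add: coact_def klin_scal[OF klin_opx2[OF klin_Phi]] o_def split_def
        sum_list_const_mult[symmetric] scal_scal mult.commute)
    thus ?case ..
  qed
qed

section \<open>Ideals of the free algebra and the quantum Serre elements\<close>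

definition fideal :: "'r::ring_1 set \<Rightarrow> bool" where
  "fideal T \<longleftrightarrow> 0 \<in> T \<and> (\<forall>x\<in>T. \<forall>y\<in>T. x + y \<in> T) \<and> (\<forall>x\<in>T. \<forall>a. a * x \<in> T \<and> x * a \<in> T)"

lemma fideal_0: "fideal T \<Longrightarrow> 0 \<in> T" by (simp add: fideal_def)
lemma fideal_add: "fideal T \<Longrightarrow> x \<in> T \<Longrightarrow> y \<in> T \<Longrightarrow> x + y \<in> T" by (simp add: fideal_def)
lemma fideal_left: "fideal T \<Longrightarrow> x \<in> T \<Longrightarrow> a * x \<in> T" by (simp add: fideal_def)
lemma fideal_right: "fideal T \<Longrightarrow> x \<in> T \<Longrightarrow> x * a \<in> T" by (simp add: fideal_def)
lemma fideal_uminus: "fideal T \<Longrightarrow> x \<in> T \<Longrightarrow> - x \<in> T"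
  using fideal_left[of T x "-1"] by simp
lemma fideal_diff: "fideal T \<Longrightarrow> x \<in> T \<Longrightarrow> y \<in> T \<Longrightarrow> x - y \<in> T"
  using fideal_add[of T x "- y"] fideal_uminus[of T y] by simp
lemma fideal_sum: "fideal T \<Longrightarrow> (\<And>k. k \<in> K \<Longrightarrow> f k \<in> T) \<Longrightarrow> sum f K \<in> T"
  by (induction K rule: infinite_finite_induct) (auto intro: fideal_0 fideal_add)
lemma fideal_scal_iff: "fideal T \<Longrightarrow> (c :: 'k::field) \<noteq> 0 \<Longrightarrow> scal c * x \<in> T \<longleftrightarrow> x \<in> T"
  using fideal_left[of T "scal c * x" "scal (inverse c)"] fideal_left[of T x "scal c"]
  by (auto simp: scal_scal)
lemma fideal_zero: "fideal {0}" by (simp add: fideal_def)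

text \<open>The braided commutator with e_i, which is the raising operator of the quantum sl(2);
  \<open>dL q i\<close> is the lowering operator.\<close>

definition ad :: "('i \<Rightarrow> 'i \<Rightarrow> 'k::comm_ring_1) \<Rightarrow> 'i \<Rightarrow> ('i, 'k) free_algebra \<Rightarrow> ('i, 'k) free_algebra" where
  "ad q i = lext (\<lambda>w. mono [i] * mono w - scal (chi q {#i#} (mset w)) * (mono w * mono [i]))"

lemma klin_ad [intro!]: "klin (ad q i)" by (auto simp: ad_def)
lemmas ad_simps = klin_simps[OF klin_ad]
lemma ad_homog: "homog \<gamma> y \<Longrightarrow> ad q i y = mono [i] * y - scal (chi q {#i#} \<gamma>) * (y * mono [i])"
  by (rule klin_eq_homog[where f = "ad q i" and g = "\<lambda>y. mono [i] * y - scal (chi q {#i#} \<gamma>) * (y * mono [i])"])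
    (auto intro!: klin_minus klin_mult_left klin_mult_right klin_id simp: ad_def)
lemma homog_ad: "homog \<gamma> y \<Longrightarrow> homog (add_mset i \<gamma>) (ad q i y)"
  using homog_mult[of "{#i#}" "mono [i]" \<gamma> y] homog_mult[of \<gamma> y "{#i#}" "mono [i]"]
  by (simp add: ad_homog homog_diff homog_scal)
lemma klin_ad_power: "klin (ad q i ^^ m)"
proof (induction m)
  case (Suc m) show ?case using klin_comp[OF klin_ad Suc] by (simp add: o_def)
qed (simp add: klin_def)
lemma homog_ad_power: "homog \<gamma> y \<Longrightarrow> homog (\<gamma> + replicate_mset m i) ((ad q i ^^ m) y)"
  by (induction m) (auto dest: homog_ad)

lemma ad_mult: "homog \<gamma> u \<Longrightarrow> homog \<delta> v \<Longrightarrow> ad q i (u * v) = ad q i u * v + scal (chi q {#i#} \<gamma>) * (u * ad q i v)"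
  by (simp add: ad_homog[of \<gamma> u] ad_homog[of \<delta> v] ad_homog[OF homog_mult] chi_add_right
      left_diff_distrib right_diff_distrib mult.assoc mult_scal_left[of u] scal_scal)

text \<open>Deriving \<open>mono [i] * y\<close> and \<open>y * mono [i]\<close> returns
  \<open>y\<close> with the factors \<open>chi q {#i#} \<gamma>\<close> and 1, and the coefficient
  in \<open>ad\<close> is chosen so that these cancel.\<close>

lemma dR_ad_0: "homog \<gamma> y \<Longrightarrow> dR q i y = 0 \<Longrightarrow> dR q i (ad q i y) = 0"
  by (simp add: ad_homog dR_simps dR_Cons dR_snoc)
lemma dR_ad_power_0: "homog \<gamma> y \<Longrightarrow> dR q i y = 0 \<Longrightarrow> dR q i ((ad q i ^^ m) y) = 0"
  by (induction m) (auto intro: dR_ad_0 homog_ad_power)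

lemma chi_replicate: "chi p {#i#} (replicate_mset m j) = p i j ^ m" "chi p (replicate_mset m i) {#j#} = p i j ^ m"
  by (simp_all add: chi_def)

text \<open>The sl(2) coefficient \<open>[m]_v (1 - h v^(m-1))\<close>. If \<open>v\<close> is not a
  root of unity and \<open>m > 0\<close>, it vanishes only for \<open>h v^(m-1) = 1\<close>.\<close>

definition qcoef :: "'k::field \<Rightarrow> 'k \<Rightarrow> nat \<Rightarrow> 'k" where
  "qcoef v h m = (\<Sum>r<m. v ^ r) * (1 - h * v ^ (m - 1))"

lemma qcoef_Suc: "qcoef v h (Suc m) = 1 - h * v ^ (2 * m) + v * qcoef v h m"
proof (cases m)
  case (Suc n)
  have "(\<Sum>r<Suc m. v ^ r) = 1 + v * (\<Sum>r<m. v ^ r)"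
    unfolding sum.lessThan_Suc_shift by (simp add: sum_distrib_left)
  moreover have "(\<Sum>r<Suc m. v ^ r) = (\<Sum>r<m. v ^ r) + v ^ m" by simp
  ultimately have e: "v ^ m = 1 + v * (\<Sum>r<m. v ^ r) - (\<Sum>r<m. v ^ r)" by (simp add: algebra_simps)
  have "qcoef v h (Suc m) = (\<Sum>r<Suc m. v ^ r) - h * v ^ m * ((\<Sum>r<m. v ^ r) + v ^ m)"
    by (simp add: qcoef_def algebra_simps)
  also have "\<dots> = 1 - h * (v ^ m * v ^ m) + v * ((\<Sum>r<m. v ^ r) - h * v ^ n * (\<Sum>r<m. v ^ r))"
    unfolding \<open>(\<Sum>r<Suc m. v ^ r) = 1 + v * (\<Sum>r<m. v ^ r)\<close>
    by (simp add: algebra_simps Suc)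
  also have "(\<Sum>r<m. v ^ r) - h * v ^ n * (\<Sum>r<m. v ^ r) = qcoef v h m"
    by (simp add: qcoef_def Suc algebra_simps)
  finally show ?thesis by (simp only: mult_2 power_add)
qed (simp add: qcoef_def)

text \<open>The sl(2) computation for a vector that is of lowest weight modulo \<open>T\<close>.
  With \<open>T = {0}\<close> it yields a derivative of the Serre elements, with
  \<open>T = S\<close> the weight bound of \<open>lowest_weight\<close>.\<close>

lemma dL_ad_power:
  assumes T: "fideal T" and x: "homog \<beta> x" "dL q i x \<in> T"
  shows "dL q i ((ad q i ^^ m) x)
      - scal (qcoef (q i i) (chi q {#i#} \<beta> * chi q \<beta> {#i#}) m) * (ad q i ^^ (m - 1)) x \<in> T"
proof (induction m)
  case 0 thus ?case using x by (simp add: qcoef_def)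
next
  case (Suc m)
  let ?h = "chi q {#i#} \<beta> * chi q \<beta> {#i#}"
  let ?y = "(ad q i ^^ m) x" and ?y' = "(ad q i ^^ (m - 1)) x"
  let ?c = "chi q {#i#} \<beta> * q i i ^ m" and ?C = "qcoef (q i i) ?h m"
  have y: "homog (\<beta> + replicate_mset m i) ?y" by (rule homog_ad_power[OF x(1)])
  have y': "homog (\<beta> + replicate_mset (m - 1) i) ?y'" by (rule homog_ad_power[OF x(1)])
  have ay: "ad q i ?y = mono [i] * ?y - scal ?c * (?y * mono [i])"
    by (simp add: ad_homog[OF y] chi_add_right chi_replicate)
  \<comment> \<open>For \<open>m = 0\<close> the coefficient \<open>?C\<close> is 0, so the
    truncated \<open>m - 1\<close> does no harm.\<close>
  have "scal ?C * (scal (q i i) * (mono [i] * ?y') - scal ?c * (?y' * mono [i])) = scal (q i i * ?C) * ?y"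
  proof (cases m)
    case (Suc n)
    have "scal ?C * (scal (q i i) * (mono [i] * ?y') - scal ?c * (?y' * mono [i]))
        = scal (q i i * ?C) * (mono [i] * ?y' - scal (chi q {#i#} \<beta> * q i i ^ n) * (?y' * mono [i]))"
      by (simp add: right_diff_distrib scal_scal Suc mult_ac)
    also have "mono [i] * ?y' - scal (chi q {#i#} \<beta> * q i i ^ n) * (?y' * mono [i]) = ?y"
      using ad_homog[OF y', of q i] by (simp add: Suc chi_add_right chi_replicate)
    finally show ?thesis .
  qed (simp add: qcoef_def)
  moreover have "dL q i (ad q i ?y) = scal (q i i) * (mono [i] * dL q i ?y) + ?y
      - scal ?c * (dL q i ?y * mono [i]) - scal (?h * q i i ^ (2 * m)) * ?y"
    by (simp add: ay dL_simps dL_Cons dL_snoc[OF y] chi_add_left chi_replicate algebra_simps scal_scal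
        power_mult power2_eq_square power_mult_distrib)
  ultimately have "dL q i (ad q i ?y) - scal (qcoef (q i i) ?h (Suc m)) * ?y
      = scal (q i i) * (mono [i] * (dL q i ?y - scal ?C * ?y')) - scal ?c * ((dL q i ?y - scal ?C * ?y') * mono [i])"
    by (simp add: qcoef_Suc scal_add scal_diff algebra_simps scal_scal mult_scal_gen)
  moreover have "\<dots> \<in> T"
    by (intro fideal_diff[OF T] fideal_left[OF T] fideal_right[OF T] Suc.IH)
  ultimately show ?case by simp
qed

locale qserre =
  fixes A :: "'i::finite \<Rightarrow> 'i \<Rightarrow> int" and q :: "'i \<Rightarrow> 'i \<Rightarrow> 'k::field_char_0"
  assumes A_off: "i \<noteq> j \<Longrightarrow> A i j \<le> 0"
    and q_nz: "q i j \<noteq> 0"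
    and q_rel: "q i j * q j i = q i i powi A i j"
    and q_root: "m > 0 \<Longrightarrow> q i i ^ m \<noteq> 1"
begin

lemma chi_nz: "chi q \<mu> \<nu> \<noteq> 0" by (rule chi_nonzero) (rule q_nz)

lemma geom_nz: "m > 0 \<Longrightarrow> (\<Sum>r<m. q i i ^ r) \<noteq> 0"
  using q_root[of m i] q_root[of 1 i] geometric_sum[of "q i i" m] by auto

definition serre :: "'i \<Rightarrow> 'i \<Rightarrow> ('i, 'k) free_algebra" where
  "serre i j = (ad q i ^^ nat (1 - A i j)) (mono [j])"

lemma q_rel_pow: "i \<noteq> j \<Longrightarrow> q i j * q j i * q i i ^ nat (- A i j) = 1"
  using A_off[of i j] q_nz[of i i]
  by (simp add: q_rel power_int_def power_mult_distrib[symmetric])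

lemma nat_1_A: "i \<noteq> j \<Longrightarrow> nat (1 - A i j) = Suc (nat (- A i j))"
  using A_off[of i j] by simp

lemma homog_serre: "homog (add_mset j (replicate_mset (nat (1 - A i j)) i)) (serre i j)"
  using homog_ad_power[of "{#j#}" "mono [j]" "nat (1 - A i j)" i q] by (simp add: serre_def)

text \<open>In direction \<open>i\<close> this is \<open>dR_ad_0\<close>. In direction
  \<open>j\<close> the derivative of the m-th power of \<open>ad\<close> applied to e_j is a
  multiple of e_i^m whose coefficient contains the factor
  \<open>1 - q i j * q j i * q i i ^ r\<close> for each \<open>r < m\<close>; at
  \<open>r = - A i j\<close> this factor is zero.\<close>

lemma dR_serre: assumes "i \<noteq> j" shows "dR q k (serre i j) = 0"
proof -
  consider "k = i" | "k = j" | "k \<noteq> i" "k \<noteq> j" by blast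
  thus ?thesis
  proof cases
    case 1 thus ?thesis unfolding serre_def
      using assms by (auto intro!: dR_ad_power_0[of "{#j#}"])
  next
    case 2
    have *: "dR q j ((ad q i ^^ m) (mono [j])) = scal (\<Prod>r<m. 1 - q i j * q j i * q i i ^ r) * mono (replicate m i)" for m
    proof (induction m)
      case (Suc m)
      have h: "homog ({#j#} + replicate_mset m i) ((ad q i ^^ m) (mono [j]))" by (rule homog_ad_power) simp
      have r: "mono (replicate m i) * mono [i] = mono [i] * (mono (replicate m i) :: ('i,'k) free_algebra)"
        by (simp add: mono_append[symmetric] replicate_append_same)
      have "dR q j ((ad q i ^^ Suc m) (mono [j])) = scal (\<Prod>r<m. 1 - q i j * q j i * q i i ^ r) * (mono [i] * mono (replicate m i))
          - scal (q i j * q i i ^ m * q j i * (\<Prod>r<m. 1 - q i j * q j i * q i i ^ r)) * (mono [i] * mono (replicate m i))"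
        using assms Suc
        by (simp add: ad_homog[OF h] dR_simps dR_Cons[OF h] dR_snoc chi_add_mset_right[of _ _ j "replicate_mset m i"] chi_replicate mult_scal_gen
            scal_scal mult.assoc r)
      thus ?case by (simp add: mono_Cons[of i "replicate m i"] left_diff_distrib[symmetric] scal_diff[symmetric] algebra_simps)
    qed simp
    show ?thesis using q_rel_pow[OF assms] 2 unfolding serre_def nat_1_A[OF assms]
      by (simp add: * del: funpow.simps)
  next
    case 3 thus ?thesis by (intro dR_0[OF homog_serre]) auto
  qed
qed

text \<open>In direction \<open>i\<close> the coefficient \<open>qcoef\<close> vanishes at the
  exponent \<open>1 - A i j\<close>. In direction \<open>j\<close> a single application of
  \<open>ad\<close> already suffices, since both terms of the commutator contribute
  \<open>q i j\<close> times e_i.\<close>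

lemma dL_serre: assumes "i \<noteq> j" shows "dL q k (serre i j) = 0"
proof -
  consider "k = i" | "k = j" | "k \<noteq> i" "k \<noteq> j" by blast
  thus ?thesis
  proof cases
    case 1
    have "dL q i (mono [j]) \<in> {0}" using assms by simp
    from dL_ad_power[OF fideal_zero _ this, of "{#j#}" "nat (1 - A i j)"]
    show ?thesis using q_rel_pow[OF assms] 1
      unfolding serre_def nat_1_A[OF assms] by (simp add: qcoef_def)
  next
    case 2
    have "dL q j ((ad q i ^^ Suc m) (mono [j])) = 0" for m
    proof (induction m)
      case 0 show ?case using assms by (simp add: ad_homog[of "{#j#}"] dL_simps dL_Cons dL_snoc[of "{#j#}"])
    next
      case (Suc m)
      have h: "homog ({#j#} + replicate_mset (Suc m) i) ((ad q i ^^ Suc m) (mono [j]))" by (rule homog_ad_power) simp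
      show ?case unfolding funpow.simps(2)[of "Suc m"] o_apply ad_homog[OF h]
        using Suc assms by (simp add: dL_simps dL_Cons dL_snoc[OF h[simplified]] )
    qed
    thus ?thesis using 2 unfolding serre_def nat_1_A[OF assms] by simp
  next
    case 3 thus ?thesis by (intro dL_0[OF homog_serre]) auto
  qed
qed

text \<open>Generated additively by scaled products with words, so that stability under a linear map
  has to be checked only on \<open>mono u * serre i j * mono v\<close>; see
  \<open>S_klin\<close>.\<close>

inductive_set S :: "('i, 'k) free_algebra set" where
  zero: "0 \<in> S"
| add: "x \<in> S \<Longrightarrow> y \<in> S \<Longrightarrow> x + y \<in> S"
| gen: "i \<noteq> j \<Longrightarrow> scal c * (mono u * serre i j * mono v) \<in> S"

lemma S_scal: "x \<in> S \<Longrightarrow> scal c * x \<in> S"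
  by (induction rule: S.induct) (auto simp: distrib_left scal_scal intro: S.intros)

lemma fideal_S: "fideal S"
proof -
  have "a * x \<in> S" if "x \<in> S" for a x
    using that
  proof (induction a rule: free_algebra_induct)
    case (mono c l)
    from mono have "mono l * x \<in> S"
    proof (induction rule: S.induct)
      case (gen i j d u v)
      have "mono l * (scal d * (mono u * serre i j * mono v)) = scal d * (mono (l @ u) * serre i j * mono v)"
        by (simp add: mult_scal_left[of "mono l"] mono_append mult.assoc)
      thus ?case using gen by (simp add: S.gen)
    qed (auto simp: distrib_left intro: S.intros)
    thus ?case by (simp add: mult.assoc S_scal)
  qed (auto simp: distrib_right intro: S.intros)
  moreover have "x * a \<in> S" if "x \<in> S" for a x
    using that
  proof (induction a rule: free_algebra_induct)
    case (mono c l)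
    from mono have "x * mono l \<in> S"
    proof (induction rule: S.induct)
      case (gen i j d u v)
      have "(scal d * (mono u * serre i j * mono v)) * mono l = scal d * (mono u * serre i j * mono (v @ l))"
        by (simp add: mono_append mult.assoc)
      thus ?case using gen by (simp add: S.gen)
    qed (auto simp: distrib_right intro: S.intros)
    thus ?case by (simp add: mult_scal_left[of x] S_scal)
  qed (auto simp: distrib_left intro: S.intros)
  ultimately show ?thesis by (simp add: fideal_def S.intros)
qed

lemmas S_left = fideal_left[OF fideal_S]
lemmas S_right = fideal_right[OF fideal_S]
lemmas S_add = fideal_add[OF fideal_S]
lemmas S_diff = fideal_diff[OF fideal_S]
lemmas S_sum = fideal_sum[OF fideal_S]

lemma serre_S: "i \<noteq> j \<Longrightarrow> serre i j \<in> S"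
  using S.gen[of i j 1 "[]" "[]"] by simp

lemma S_klin:
  assumes "klin f" "\<And>i j u v. i \<noteq> j \<Longrightarrow> f (mono u * serre i j * mono v) \<in> S" "x \<in> S"
  shows "f x \<in> S"
  using assms(3)
  by (induction rule: S.induct) (use assms(2) in \<open>auto simp: klin_simps[OF assms(1)] intro: S.intros S_scal\<close>)

lemma homog_usv: "homog (mset u + (add_mset j (replicate_mset (nat (1 - A i j)) i)) + mset v) (mono u * serre i j * mono v)"
  by (intro homog_mult homog_serre) (simp_all add: homog_mono)

lemma S_dR: "x \<in> S \<Longrightarrow> dR q k x \<in> S"
proof (rule S_klin[OF klin_dR])
  fix i j :: 'i and u v assume ij: "i \<noteq> j"
  show "dR q k (mono u * serre i j * mono v) \<in> S"
    by (simp add: dR_mult[of "mset v"] homog_mono dR_mult[OF homog_serre] dR_serre[OF ij])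
      (intro S_add S_left S_right serre_S[OF ij])
qed

lemma S_dL: "x \<in> S \<Longrightarrow> dL q k x \<in> S"
proof (rule S_klin[OF klin_dL])
  fix i j :: 'i and u v assume ij: "i \<noteq> j"
  have "homog (mset u + (add_mset j (replicate_mset (nat (1 - A i j)) i))) (mono u * serre i j)"
    by (intro homog_mult homog_serre) (simp_all add: homog_mono)
  thus "dL q k (mono u * serre i j * mono v) \<in> S"
    by (simp add: dL_mult dL_mult[of "mset u"] homog_mono dL_serre[OF ij])
      (intro S_add S_left S_right serre_S[OF ij])
qed

lemma S_Phi: "x \<in> S \<Longrightarrow> Phi q k x \<in> S"
proof (rule S_klin[OF klin_Phi])
  fix i j :: 'i and u v assume ij: "i \<noteq> j"
  show "Phi q k (mono u * serre i j * mono v) \<in> S"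
    unfolding Phi_def dR_inv_param[OF q_nz homog_usv]
    by (intro S_diff S_scal S_dL S_dR S_right S_left serre_S[OF ij])
qed

lemma S_ad: "x \<in> S \<Longrightarrow> ad q k x \<in> S"
proof (rule S_klin[OF klin_ad])
  fix i j :: 'i and u v assume ij: "i \<noteq> j"
  show "ad q k (mono u * serre i j * mono v) \<in> S"
    unfolding ad_homog[OF homog_usv]
    by (intro S_diff S_scal S_right S_left serre_S[OF ij])
qed

lemma S_ad_power: "x \<in> S \<Longrightarrow> (ad q k ^^ m) x \<in> S"
  by (induction m) (auto intro: S_ad)

text \<open>As \<open>S\<close> is stable under \<open>dR\<close>, only constant terms remain, and
  these vanish because each Serre element has positive degree.\<close>

lemma S_pair: "x \<in> S \<Longrightarrow> pair q w x = 0"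
proof (induction w arbitrary: x rule: rev_induct)
  case Nil
  have "lk (mono u * serre i j * mono v) 0 = 0" for u i j v
  proof (rule ccontr)
    assume "\<not> ?thesis"
    hence "0 \<in> Poly_Mapping.keys (mono u * serre i j * mono v)" by (simp add: in_keys_iff)
    with homog_usv[of u j i v] have "{#} = mset u + add_mset j (replicate_mset (nat (1 - A i j)) i) + mset v"
      unfolding homog_def by fastforce
    thus False by simp
  qed
  with Nil show ?case
    by (induction rule: S.induct) (simp_all add: lookup_add scal_mult_lookup)
next
  case (snoc k w) thus ?case by (simp add: pair_snoc S_dR)
qed

end

section \<open>Local nilpotence of the adjoint action and lowest weights\<close>

context qserre
begin

text \<open>These elements form the complement to the powers of e_i. Nilpotence of \<open>ad\<close>
  modulo \<open>S\<close> is part of the definition so that it is carried through sums and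
  products.\<close>

definition good :: "'i \<Rightarrow> 'i multiset \<Rightarrow> ('i, 'k) free_algebra \<Rightarrow> bool" where
  "good i \<gamma> u \<longleftrightarrow> homog \<gamma> u \<and> dR q i u = 0 \<and> (\<exists>m. (ad q i ^^ m) u \<in> S)"

lemma ad_power_S_mono: "(ad q i ^^ m) u \<in> S \<Longrightarrow> m \<le> n \<Longrightarrow> (ad q i ^^ n) u \<in> S"
  using S_ad_power[where x = "(ad q i ^^ m) u" and k = i and m = "n - m"]
    funpow_add[of "n - m" m "ad q i"] by simp

lemma good_0: "good i \<gamma> 0"
  by (auto simp: good_def dR_simps intro!: exI[of _ 0] S.zero)

lemma good_add: "good i \<gamma> u \<Longrightarrow> good i \<gamma> v \<Longrightarrow> good i \<gamma> (u + v)"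
proof -
  assume u: "good i \<gamma> u" and v: "good i \<gamma> v"
  then obtain m n where mn: "(ad q i ^^ m) u \<in> S" "(ad q i ^^ n) v \<in> S" by (auto simp: good_def)
  have "(ad q i ^^ (m + n)) (u + v) \<in> S"
    unfolding klin_add[OF klin_ad_power]
    by (intro S_add ad_power_S_mono[OF mn(1)] ad_power_S_mono[OF mn(2)]) auto
  thus ?thesis using u v by (auto simp: good_def homog_add dR_simps)
qed

lemma good_scal: "good i \<gamma> u \<Longrightarrow> good i \<gamma> (scal c * u)"
  unfolding good_def by (auto simp: homog_scal dR_simps klin_scal[OF klin_ad_power] intro: S_scal)

lemma good_ad: "good i \<gamma> u \<Longrightarrow> good i (add_mset i \<gamma>) (ad q i u)"
proof -
  assume u: "good i \<gamma> u"
  then obtain m where "(ad q i ^^ m) u \<in> S" by (auto simp: good_def)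
  hence "(ad q i ^^ m) (ad q i u) \<in> S"
    using S_ad[of "(ad q i ^^ m) u" i] by (simp add: funpow_swap1)
  thus ?thesis using u by (auto simp: good_def homog_ad intro: dR_ad_0)
qed

text \<open>By the skew Leibniz rule each application of \<open>ad\<close> falls on \<open>u\<close>
  or on \<open>v\<close>, and after \<open>m + n\<close> of them one factor has been sent into
  \<open>S\<close>. Induction on \<open>m + n\<close> replaces an explicit expansion.\<close>

lemma ad_power_mult_S:
  "(ad q i ^^ m) u \<in> S \<Longrightarrow> (ad q i ^^ n) v \<in> S \<Longrightarrow> homog \<gamma> u \<Longrightarrow> homog \<delta> v \<Longrightarrow>
    (ad q i ^^ (m + n)) (u * v) \<in> S"
proof (induction "m + n" arbitrary: m n u v \<gamma> \<delta>)
  case 0 thus ?case by (simp add: S_right)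
next
  case (Suc k)
  show ?case
  proof (cases "m = 0 \<or> n = 0")
    case True
    hence "u * v \<in> S" using Suc.prems by (auto intro: S_left S_right)
    thus ?thesis by (rule S_ad_power)
  next
    case False
    then obtain a b where ab: "m = Suc a" "n = Suc b" by (cases m; cases n) auto
    have 1: "(ad q i ^^ (a + n)) (ad q i u * v) \<in> S"
      using Suc.prems Suc.hyps(2) ab
      by (intro Suc.hyps(1)[of a n "ad q i u" v "add_mset i \<gamma>" \<delta>]) (auto simp: funpow_swap1 homog_ad)
    have 2: "(ad q i ^^ (m + b)) (u * ad q i v) \<in> S"
      using Suc.prems Suc.hyps(2) ab
      by (intro Suc.hyps(1)[of m b u "ad q i v" \<gamma> "add_mset i \<delta>"]) (auto simp: funpow_swap1 homog_ad)
    have "(ad q i ^^ (m + n)) (u * v) = (ad q i ^^ (a + n)) (ad q i (u * v))"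
      by (simp add: ab funpow_swap1)
    also have "\<dots> = (ad q i ^^ (a + n)) (ad q i u * v) + scal (chi q {#i#} \<gamma>) * (ad q i ^^ (m + b)) (u * ad q i v)"
      by (simp add: ad_mult[OF Suc.prems(3,4)] klin_add[OF klin_ad_power] klin_scal[OF klin_ad_power] ab ad_simps)
    finally show ?thesis using 1 2 by (simp add: S_add S_scal)
  qed
qed

lemma good_mult: "good i \<gamma> u \<Longrightarrow> good i \<delta> v \<Longrightarrow> good i (\<gamma> + \<delta>) (u * v)"
proof -
  assume u: "good i \<gamma> u" and v: "good i \<delta> v"
  then obtain m n where "(ad q i ^^ m) u \<in> S" "(ad q i ^^ n) v \<in> S" by (auto simp: good_def)
  hence "(ad q i ^^ (m + n)) (u * v) \<in> S"
    using u v by (intro ad_power_mult_S) (auto simp: good_def)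
  thus ?thesis using u v by (auto simp: good_def homog_mult dR_mult[of \<delta> v])
qed

lemma good_gen: "i \<noteq> j \<Longrightarrow> good i {#j#} (mono [j])"
  using serre_S[of i j] by (auto simp: good_def serre_def)

definition e_pow :: "'i \<Rightarrow> nat \<Rightarrow> ('i, 'k) free_algebra" where
  "e_pow i n = mono (replicate n i)"

lemma e_pow_Suc: "mono [i] * e_pow i n = e_pow i (Suc n)" "e_pow i n * mono [i] = e_pow i (Suc n)"
  by (simp_all add: e_pow_def mono_append[symmetric] replicate_append_same)

text \<open>A polynomial in e_i with good coefficients on the left. Requiring \<open>u n = 0\<close>
  when \<open>n\<close> copies of \<open>i\<close> do not fit into \<gamma> makes up for the
  truncated difference in the degree of \<open>u n\<close>.\<close>

definition decomp :: "'i \<Rightarrow> 'i multiset \<Rightarrow> ('i, 'k) free_algebra \<Rightarrow> (nat \<Rightarrow> ('i, 'k) free_algebra) \<Rightarrow> bool" where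
  "decomp i \<gamma> x u \<longleftrightarrow> (\<forall>n. good i (\<gamma> - replicate_mset n i) (u n) \<and> (\<not> replicate_mset n i \<subseteq># \<gamma> \<longrightarrow> u n = 0))
     \<and> x = (\<Sum>n\<le>size \<gamma>. u n * e_pow i n)"

lemma decompD: "decomp i \<gamma> x u \<Longrightarrow> size \<gamma> \<le> N \<Longrightarrow> x = (\<Sum>n\<le>N. u n * e_pow i n)"
proof -
  assume d: "decomp i \<gamma> x u" and N: "size \<gamma> \<le> N"
  have "(\<Sum>n\<le>N. u n * e_pow i n) = (\<Sum>n\<le>size \<gamma>. u n * e_pow i n)"
  proof (rule sum.mono_neutral_right)
    show "\<forall>n\<in>{..N} - {..size \<gamma>}. u n * e_pow i n = 0"
    proof
      fix n assume "n \<in> {..N} - {..size \<gamma>}"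
      hence "\<not> replicate_mset n i \<subseteq># \<gamma>" using size_mset_mono[of "replicate_mset n i" \<gamma>] by auto
      thus "u n * e_pow i n = 0" using d by (simp add: decomp_def)
    qed
  qed (use N in auto)
  thus ?thesis using d by (simp add: decomp_def)
qed

text \<open>Induction on the letters. A letter different from \<open>i\<close> is good by the Serre
  relation and is absorbed by the coefficients. For the letter \<open>i\<close>, the identity
  \<open>e_i u = ad(u) + c u e_i\<close> yields a new good coefficient at the same power and a
  multiple of the old one at the next power.\<close>

lemma decomp_exists_mono: "\<exists>u. decomp i (mset l) (mono l) u"
proof (induction l)
  case Nil
  have "good i {#} 1" by (auto simp: good_def S.zero ad_homog[of "{#}" 1] intro!: exI[of _ 1])
  hence "decomp i {#} 1 (\<lambda>n. if n = 0 then 1 else 0)"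
    by (auto simp: decomp_def good_0 e_pow_def)
  thus ?case by auto
next
  case (Cons j l)
  then obtain u where u: "decomp i (mset l) (mono l) u" by blast
  hence g: "good i (mset l - replicate_mset n i) (u n)" and z: "\<not> replicate_mset n i \<subseteq># mset l \<Longrightarrow> u n = 0" for n
    by (auto simp: decomp_def)
  let ?N = "size (mset (j # l))"
  have s: "mono l = (\<Sum>n\<le>?N. u n * e_pow i n)" by (rule decompD[OF u]) simp
  show ?case
  proof (cases "j = i")
    case False
    have "good i (mset (j # l) - replicate_mset n i) (mono [j] * u n)" for n
    proof (cases "replicate_mset n i \<subseteq># mset l")
      case True
      have e: "mset (j # l) - replicate_mset n i = {#j#} + (mset l - replicate_mset n i)"
        using multiset_diff_union_assoc[OF True, of "{#j#}"] by simp
      show ?thesis unfolding e by (rule good_mult[OF good_gen g]) (use False in simp)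
    qed (simp add: z good_0)
    moreover have "mono [j] * u n = 0" if "\<not> replicate_mset n i \<subseteq># mset (j # l)" for n
      using that z[of n] subset_mset.order_trans[of "replicate_mset n i" "mset l" "mset (j # l)"]
      by fastforce
    moreover have "mono (j # l) = (\<Sum>n\<le>?N. mono [j] * u n * e_pow i n)"
      by (simp only: mono_Cons[of j l] s sum_distrib_left mult.assoc)
    ultimately have "decomp i (mset (j # l)) (mono (j # l)) (\<lambda>n. mono [j] * u n)"
      unfolding decomp_def by blast
    thus ?thesis by blast
  next
    case True
    define c where "c n = chi q {#i#} (mset l - replicate_mset n i)" for n
    define v where "v n = ad q i (u n) + (if n = 0 then 0 else scal (c (n - 1)) * u (n - 1))" for n
    have "good i (mset (i # l) - replicate_mset n i) (v n)" for n
    proof -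
      have "good i (mset (i # l) - replicate_mset n i) (ad q i (u n))"
      proof (cases "replicate_mset n i \<subseteq># mset l")
        case True
        have e: "mset (i # l) - replicate_mset n i = add_mset i (mset l - replicate_mset n i)"
          using multiset_diff_union_assoc[OF True, of "{#i#}"] by simp
        show ?thesis unfolding e by (rule good_ad[OF g])
      qed (simp add: z good_0 ad_simps)
      moreover have "good i (mset (i # l) - replicate_mset n i) (if n = 0 then 0 else scal (c (n - 1)) * u (n - 1))"
      proof (cases n)
        case (Suc m) thus ?thesis using good_scal[OF g, of m] by simp
      qed (simp add: good_0)
      ultimately show ?thesis unfolding v_def by (rule good_add)
    qed
    moreover have "v n = 0" if "\<not> replicate_mset n i \<subseteq># mset (i # l)" for n
    proof -
      have "u n = 0"
        using that z[of n] subset_mset.order_trans[of "replicate_mset n i" "mset l" "mset (i # l)"]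
        by fastforce
      moreover have "n \<noteq> 0 \<Longrightarrow> u (n - 1) = 0"
        using that z[of "n - 1"] by (cases n) auto
      ultimately show ?thesis by (simp add: v_def ad_simps)
    qed
    moreover have "mono (i # l) = (\<Sum>n\<le>?N. v n * e_pow i n)"
    proof -
      have e: "mono [i] * (u n * e_pow i n) = ad q i (u n) * e_pow i n + scal (c n) * u n * e_pow i (Suc n)" for n
      proof -
        have "mono [i] * u n = ad q i (u n) + scal (c n) * u n * mono [i]"
          using ad_homog[of "mset l - replicate_mset n i" "u n" q i] g[of n]
          by (simp add: good_def c_def mult.assoc)
        thus ?thesis by (simp add: mult.assoc[symmetric] distrib_right) (simp add: mult.assoc e_pow_Suc)
      qed
      have s': "mono l = (\<Sum>n\<le>size (mset l). u n * e_pow i n)" by (rule decompD[OF u]) simp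
      have "mono (i # l) = (\<Sum>n\<le>size (mset l). ad q i (u n) * e_pow i n) + (\<Sum>n\<le>size (mset l). scal (c n) * u n * e_pow i (Suc n))"
        unfolding mono_Cons[of i l] s' sum_distrib_left e by (rule sum.distrib)
      also have "(\<Sum>n\<le>size (mset l). ad q i (u n) * e_pow i n) = (\<Sum>n\<le>?N. ad q i (u n) * e_pow i n)"
      proof -
        have "\<not> replicate_mset (Suc (length l)) i \<subseteq># mset l"
          using size_mset_mono[of "replicate_mset (Suc (length l)) i" "mset l"] by (auto simp del: replicate_mset_Suc)
        hence "u (Suc (length l)) = 0" by (rule z)
        thus ?thesis by (simp add: ad_simps)
      qed
      also have "(\<Sum>n\<le>size (mset l). scal (c n) * u n * e_pow i (Suc n))
          = (\<Sum>n\<le>?N. (if n = 0 then 0 else scal (c (n - 1)) * u (n - 1)) * e_pow i n)"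
        by (simp add: sum.atMost_Suc_shift del: sum.atMost_Suc)
      finally show ?thesis by (simp add: v_def distrib_right sum.distrib del: sum.atMost_Suc)
    qed
    ultimately have "decomp i (mset (i # l)) (mono (i # l)) v"
      unfolding decomp_def by (simp del: sum.atMost_Suc)
    thus ?thesis using True by blast
  qed
qed

lemma decomp_exists: "homog \<gamma> x \<Longrightarrow> \<exists>u. decomp i \<gamma> x u"
proof (induction rule: homog_induct)
  case zero
  have "decomp i \<gamma> 0 (\<lambda>_. 0)" by (simp add: decomp_def good_0)
  thus ?case by blast
next
  case (add x y)
  then obtain u v where "decomp i \<gamma> x u" "decomp i \<gamma> y v" by blast
  hence "decomp i \<gamma> (x + y) (\<lambda>n. u n + v n)"
    by (simp add: decomp_def good_add distrib_right sum.distrib)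
  thus ?case by blast
next
  case (mono c l)
  obtain u where "decomp i (mset l) (mono l) u" using decomp_exists_mono by blast
  hence "decomp i \<gamma> (scal c * mono l) (\<lambda>n. scal c * u n)"
    using mono by (simp add: decomp_def good_scal sum_distrib_left mult.assoc)
  thus ?case by blast
qed

lemma dR_e_pow: "dR q i (e_pow i n) = scal (\<Sum>r<n. q i i ^ r) * e_pow i (n - 1)"
proof (induction n)
  case (Suc n)
  have "dR q i (e_pow i (Suc n)) = mono [i] * dR q i (e_pow i n) + scal (q i i ^ n) * e_pow i n"
    unfolding e_pow_Suc(1)[symmetric]
    by (subst dR_Cons[of "replicate_mset n i"]) (simp_all add: e_pow_def homog_mono chi_replicate)
  also have "mono [i] * dR q i (e_pow i n) = scal (\<Sum>r<n. q i i ^ r) * e_pow i n"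
    by (subst Suc, cases n) (simp_all add: mult_scal_gen e_pow_Suc)
  finally show ?case by (simp add: scal_add distrib_right)
qed (simp add: e_pow_def)

text \<open>The coefficient is a product of geometric sums in \<open>q i i\<close>, which are
  nonzero because \<open>q i i\<close> is not a root of unity.\<close>

lemma dR_power_e_pow:
  assumes "dR q i u = 0"
  shows "\<exists>c. (dR q i ^^ n) (u * e_pow i m) = scal c * (u * e_pow i (m - n)) \<and> (n \<le> m \<longrightarrow> c \<noteq> 0) \<and> (m < n \<longrightarrow> c = 0)"
proof (induction n)
  case 0 show ?case by (rule exI[of _ 1]) simp
next
  case (Suc n)
  then obtain c where c: "(dR q i ^^ n) (u * e_pow i m) = scal c * (u * e_pow i (m - n))"
    "n \<le> m \<longrightarrow> c \<noteq> 0" "m < n \<longrightarrow> c = 0" by blast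
  have h: "homog (replicate_mset (m - n) i) (e_pow i (m - n))" by (simp add: e_pow_def homog_mono)
  have "(dR q i ^^ Suc n) (u * e_pow i m) = scal (c * (\<Sum>r<m - n. q i i ^ r)) * (u * e_pow i (m - Suc n))"
    by (simp add: c(1) dR_simps dR_mult[OF h] assms dR_e_pow mult_scal_left[of u] scal_scal)
  moreover have "Suc n \<le> m \<longrightarrow> c * (\<Sum>r<m - n. q i i ^ r) \<noteq> 0" using c(2) geom_nz[of "m - n" i] by auto
  moreover have "m < Suc n \<longrightarrow> c * (\<Sum>r<m - n. q i i ^ r) = 0" using c(3) by auto
  ultimately show ?case by blast
qed

text \<open>Deriving as often as the top exponent says kills all lower powers and leaves a nonzero
  multiple of the top coefficient. That coefficient lies in \<open>S\<close> and can be discarded;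
  repeating this leaves only \<open>u 0\<close>.\<close>

lemma decomp_dR_S:
  assumes "\<And>n. dR q i (u n) = 0" "dR q i (\<Sum>n\<le>N. u n * e_pow i n) \<in> S"
  shows "(\<Sum>n\<le>N. u n * e_pow i n) - u 0 \<in> S"
  using assms(2)
proof (induction N)
  case 0 show ?case by (simp add: e_pow_def S.zero)
next
  case (Suc N)
  let ?x = "\<Sum>n\<le>Suc N. u n * e_pow i n"
  have kl: "klin (dR q i ^^ m)" for m
  proof (induction m)
    case (Suc m) show ?case using klin_comp[OF klin_dR Suc] by (simp add: o_def)
  qed (simp add: klin_def)
  have "(dR q i ^^ n) y \<in> S" if "y \<in> S" for n y
    using that by (induction n) (auto intro: S_dR)
  from this[OF Suc.prems] have "(dR q i ^^ N) (dR q i ?x) \<in> S" .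
  hence *: "(dR q i ^^ Suc N) ?x \<in> S" by (simp add: funpow_swap1)
  have "(dR q i ^^ Suc N) (u n * e_pow i n) = 0" if "n \<le> N" for n
    using dR_power_e_pow[OF assms(1)[of n], of "Suc N" n] that by auto
  hence "(dR q i ^^ Suc N) ?x = (dR q i ^^ Suc N) (u (Suc N) * e_pow i (Suc N))"
    by (simp add: klin_add[OF kl] klin_sum[OF kl] del: funpow.simps)
  then obtain c where "(dR q i ^^ Suc N) ?x = scal c * (u (Suc N) * e_pow i 0)" "c \<noteq> 0"
    using dR_power_e_pow[OF assms(1)[of "Suc N"], of "Suc N" "Suc N"]
    by (auto simp del: funpow.simps)
  with * have "u (Suc N) \<in> S" by (simp add: fideal_scal_iff[OF fideal_S] e_pow_def del: funpow.simps)
  hence uS: "u (Suc N) * e_pow i (Suc N) \<in> S" by (rule S_right)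
  have "dR q i (\<Sum>n\<le>N. u n * e_pow i n) = dR q i ?x - dR q i (u (Suc N) * e_pow i (Suc N))"
    by (simp add: dR_simps)
  also have "\<dots> \<in> S" by (intro S_diff Suc.prems S_dR uS)
  finally have "(\<Sum>n\<le>N. u n * e_pow i n) - u 0 \<in> S" by (rule Suc.IH)
  from S_add[OF this uS] show ?case by (simp add: algebra_simps)
qed

text \<open>An element killed by both derivations is a lowest weight vector of an integrable module for
  the quantum \<open>sl(2)\<close> attached to \<open>i\<close>, so its weight is nonpositive.\<close>

lemma lowest_weight:
  assumes x: "homog \<beta> x" "x \<notin> S" and d: "dR q i x \<in> S" "dL q i x \<in> S"
  shows "\<exists>m. chi q {#i#} \<beta> * chi q \<beta> {#i#} * q i i ^ m = 1"
proof -
  obtain u where u: "decomp i \<beta> x u" using decomp_exists[OF x(1)] by blast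
  have xs: "x = (\<Sum>n\<le>size \<beta>. u n * e_pow i n)" by (rule decompD[OF u order_refl])
  have g: "good i (\<beta> - replicate_mset n i) (u n)" for n using u by (simp add: decomp_def)
  \<comment> \<open>Modulo \<open>S\<close> only the coefficient \<open>u 0\<close> survives, so
    \<open>x\<close> inherits nilpotence of \<open>ad\<close> from it.\<close>
  have "x - u 0 \<in> S"
    unfolding xs by (rule decomp_dR_S) (use g d(1) in \<open>simp_all add: good_def flip: xs\<close>)
  moreover obtain m where m: "(ad q i ^^ m) (u 0) \<in> S" using g[of 0] by (auto simp: good_def)
  ultimately have "(ad q i ^^ m) (x - u 0) + (ad q i ^^ m) (u 0) \<in> S"
    using S_add[OF S_ad_power[of "x - u 0" m i]] by blast
  hence ex: "(ad q i ^^ m) x \<in> S" by (simp add: klin_diff[OF klin_ad_power])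
  \<comment> \<open>At the least exponent, applying \<open>dL\<close> to an element of
    \<open>S\<close> shows that \<open>qcoef\<close> times an element outside \<open>S\<close> lies
    in \<open>S\<close>, so \<open>qcoef\<close> is zero.\<close>
  define M where "M = (LEAST m. (ad q i ^^ m) x \<in> S)"
  have M: "(ad q i ^^ M) x \<in> S" unfolding M_def by (rule LeastI[of "\<lambda>m. (ad q i ^^ m) x \<in> S", OF ex])
  have "M \<noteq> 0" using M x(2) by (intro notI) simp
  then obtain n where n: "M = Suc n" by (cases M) auto
  have nS: "(ad q i ^^ n) x \<notin> S" using not_less_Least[of n "\<lambda>m. (ad q i ^^ m) x \<in> S"] n M_def by auto
  let ?h = "chi q {#i#} \<beta> * chi q \<beta> {#i#}"
  have "dL q i ((ad q i ^^ M) x) - scal (qcoef (q i i) ?h M) * (ad q i ^^ (M - 1)) x \<in> S"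
    by (rule dL_ad_power[OF fideal_S x(1) d(2)])
  from S_diff[OF S_dL[OF M, of i] this] have "scal (qcoef (q i i) ?h M) * (ad q i ^^ n) x \<in> S"
    by (simp add: n del: funpow.simps)
  hence "qcoef (q i i) ?h M = 0" using nS fideal_scal_iff[OF fideal_S] by blast
  hence "?h * q i i ^ n = 1" using geom_nz[of M i] by (simp add: qcoef_def n)
  thus ?thesis by blast
qed

end

lemma pair_hcomp: "pair p w (hcomp (mset w) y) = pair p w y"
proof (induction y rule: free_algebra_induct)
  case (mono c l)
  show ?case
    using pair_degree[of "mset l" "mono l" w p]
    by (auto simp: klin_simps[OF klin_cmp] cmp_mono pair_right homog_mono)
qed (simp add: klin_simps[OF klin_cmp] pair_right)

lemma bil_hcomp: "homog \<nu> u \<Longrightarrow> bil p u (hcomp \<nu> y) = bil p u y"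
  by (induction rule: homog_induct) (auto simp: bil_left bil_mono pair_hcomp)

lemma coact_homog_exists:
  fixes q :: "'i \<Rightarrow> 'i \<Rightarrow> 'k::field"
  assumes nz: "\<And>i j. q i j \<noteq> (0::'k::field)"
  shows "\<exists>ps. coact q \<nu> z ps \<and> (\<forall>(y, z') \<in> set ps. homog \<nu> y)"
proof -
  obtain ps where ps: "coact q \<nu> z ps" using coact_exists[of q \<nu> z, OF nz] by blast
  have "coact q \<nu> z (map (\<lambda>(y, z'). (hcomp \<nu> y, z')) ps)"
    unfolding coact_def
  proof (intro allI impI)
    fix u :: "('i, 'k) free_algebra" assume u: "homog \<nu> u"
    show "opx (Phi q) u z = (\<Sum>(y, z') \<leftarrow> map (\<lambda>(y, z'). (hcomp \<nu> y, z')) ps. scal (bil q u y) * z')"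
      using ps[unfolded coact_def, rule_format, OF u] by (simp add: bil_hcomp[OF u] o_def split_def)
  qed
  thus ?thesis by (intro exI conjI) auto
qed

lemma finite_submsets [simp]: "finite {\<nu>. \<nu> \<subseteq># \<gamma>}" "finite {\<nu>. \<nu> \<subset># \<gamma>}"
proof -
  have "{\<nu>. \<nu> \<subseteq># \<gamma>} \<subseteq> mset ` {l. set l \<subseteq> set_mset \<gamma> \<and> length l \<le> size \<gamma>}"
  proof
    fix \<nu> assume "\<nu> \<in> {\<nu>. \<nu> \<subseteq># \<gamma>}"
    moreover obtain l where "mset l = \<nu>" using ex_mset by blast
    ultimately show "\<nu> \<in> mset ` {l. set l \<subseteq> set_mset \<gamma> \<and> length l \<le> size \<gamma>}"
      using size_mset_mono[of \<nu> \<gamma>] set_mset_mono[of \<nu> \<gamma>] by auto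
  qed
  thus f: "finite {\<nu>. \<nu> \<subseteq># \<gamma>}"
    by (rule finite_subset) (intro finite_imageI finite_lists_length_le, simp)
  show "finite {\<nu>. \<nu> \<subset># \<gamma>}"
    by (rule finite_subset[OF _ f]) (auto simp: subset_mset_def)
qed

lemma sum_list_in_fideal: "fideal T \<Longrightarrow> (\<And>x. x \<in> set xs \<Longrightarrow> f x \<in> T) \<Longrightarrow> sum_list (map f xs) \<in> T"
  by (induction xs) (auto intro: fideal_0 fideal_add)

lemma klin_linear: "klin f \<Longrightarrow> Vector_Spaces.linear (\<lambda>c x. scal c * x) (\<lambda>c x. scal c * x) f"
  for f :: "('m::monoid_add \<Rightarrow>\<^sub>0 'k::field) \<Rightarrow> ('n::monoid_add \<Rightarrow>\<^sub>0 'k)"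
  by unfold_locales (auto simp: klin_def scal_scal scal_add algebra_simps)

context qserre
begin

section \<open>The Casimir operator\<close>

text \<open>Words of degree \<nu> may be dependent modulo the radical, so no dual basis is chosen.
  Instead \<open>b w\<close> is the value at \<open>w\<close> of a linear right inverse of the map
  \<open>G\<close>, which lists all pairings of an element; then \<open>y\<close> and its image
  under the composite have equal pairings, and \<open>H\<close> puts their difference into
  \<open>S\<close>.\<close>

lemma section_exists:
  assumes H: "\<And>y. homog \<nu> y \<Longrightarrow> (\<And>w. mset w = \<nu> \<Longrightarrow> pair q w y = 0) \<Longrightarrow> y \<in> S"
  shows "\<exists>b. (\<forall>w. homog \<nu> (b w)) \<and>
    (\<forall>y. homog \<nu> y \<longrightarrow> y - (\<Sum>w | mset w = \<nu>. scal (pair q w y) * b w) \<in> S)"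
proof -
  define G :: "('i, 'k) free_algebra \<Rightarrow> ('i, 'k) free_algebra" where
    "G y = (\<Sum>w | mset w = \<nu>. scal (pair q w y) * mono w)" for y
  let ?s = "\<lambda>c (x :: ('i, 'k) free_algebra). scal c * x"
  have kG: "klin G"
    by (rule klinI) (simp_all add: G_def pair_right scal_add distrib_right sum.distrib scal_mult mult.assoc sum_distrib_left)
  interpret V: vector_space_pair ?s ?s
    by unfold_locales (auto simp: scal_scal scal_add algebra_simps)
  have sub: "V.vs1.subspace {y. homog \<nu> y}"
    unfolding V.vs1.subspace_def by (auto intro: homog_add homog_scal)
  obtain g where g: "range g \<subseteq> {y. homog \<nu> y}" "Vector_Spaces.linear ?s ?s g" "\<forall>v\<in>G ` {y. homog \<nu> y}. G (g v) = v"
    using V.linear_exists_right_inverse_on[OF klin_linear[OF kG] sub] by blast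
  have kg: "klin g"
    using g(2) unfolding Vector_Spaces.linear_iff by (intro klinI) auto
  have lk: "lk (G y) (Word w) = pair q w y" if "mset w = \<nu>" for w y
    using that by (simp add: G_def lookup_sum scal_mult_lookup lookup_mono if_distrib[of "(*) _"] eq_commute[of w] cong: if_cong)
  show ?thesis
  proof (intro exI conjI allI impI)
    show "homog \<nu> (g (mono w))" for w using g(1) by auto
    fix y :: "('i, 'k) free_algebra" assume y: "homog \<nu> y"
    have hg: "homog \<nu> (g (G y))" using g(1) by auto
    have "G (g (G y)) = G y" using g(3) y by auto
    hence "pair q w (y - g (G y)) = 0" if "mset w = \<nu>" for w
      using lk[OF that, of y] lk[OF that, of "g (G y)"] by (simp add: pair_right)
    hence "y - g (G y) \<in> S" by (intro H homog_diff y hg)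
    thus "y - (\<Sum>w | mset w = \<nu>. scal (pair q w y) * g (mono w)) \<in> S"
      by (simp add: G_def klin_sum[OF kg] klin_scal[OF kg])
  qed
qed

text \<open>For \<open>w\<close> of degree \<open>\<nu>\<close>, \<open>b w\<close> below plays the role of the dual of \<open>w\<close> under the pairing, so
  \<open>\<Theta> \<nu>\<close> corresponds to a component of the quasi-R-matrix and \<open>\<Omega>\<close> to a truncated Casimir operator.
  The factors \<open>K \<nu> \<gamma>\<close> are what makes \<open>casimir_step\<close> hold.\<close>

definition K :: "'i multiset \<Rightarrow> 'i multiset \<Rightarrow> 'k" where
  "K \<nu> \<gamma> = chi q \<gamma> \<nu> * (\<Prod>j\<in>#\<nu>. - inverse (q j j))"

text \<open>For \<open>q i j = v^(alpha_i, alpha_j)\<close> this is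
  \<open>v^((\<gamma>, \<gamma>) - 2 (\<rho>, \<gamma>))\<close>.\<close>

definition casimir_eigenvalue :: "'i multiset \<Rightarrow> 'k" where
  "casimir_eigenvalue \<gamma> = chi q \<gamma> \<gamma> / (\<Prod>j\<in>#\<gamma>. q j j)"

context
  fixes \<beta> :: "'i multiset" and b :: "'i list \<Rightarrow> ('i, 'k) free_algebra"
  assumes b_homog: "\<And>w. mset w \<subset># \<beta> \<Longrightarrow> homog (mset w) (b w)"
    and b_dual: "\<And>\<nu> y. \<nu> \<subset># \<beta> \<Longrightarrow> homog \<nu> y \<Longrightarrow> y - (\<Sum>w | mset w = \<nu>. scal (pair q w y) * b w) \<in> S"
begin

definition \<Theta> :: "'i multiset \<Rightarrow> ('i, 'k) free_algebra \<Rightarrow> ('i, 'k) free_algebra" where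
  "\<Theta> \<nu> z = (\<Sum>w | mset w = \<nu>. b w * foldr (Phi q) w z)"

definition \<Omega> :: "'i multiset \<Rightarrow> ('i, 'k) free_algebra \<Rightarrow> ('i, 'k) free_algebra" where
  "\<Omega> \<gamma> z = (\<Sum>\<nu> | \<nu> \<subset># \<gamma>. scal (K \<nu> \<gamma>) * \<Theta> \<nu> z)"

text \<open>The sum of the tensors of \<open>b w\<close> and \<open>w\<close> behaves like the
  canonical element of the pairing, so an operator on the second factor may be replaced by its
  adjoint \<open>f\<close> on the first. By the coaction the second factor acts only through its
  pairings, and the duality of \<open>b\<close> modulo \<open>S\<close> is then enough.\<close>

lemma b_contract:
  assumes nu: "\<nu>' \<subset># \<beta>" "\<nu> \<subset># \<beta>" and f: "klin f"
    and M: "\<And>u. homog \<nu>' u \<Longrightarrow> homog \<nu> (M u)" and hf: "\<And>y. homog \<nu> y \<Longrightarrow> homog \<nu>' (f y)"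
    and adj: "\<And>u y. bil q (M u) y = bil q u (f y)" and fS: "\<And>x. x \<in> S \<Longrightarrow> f x \<in> S"
  shows "(\<Sum>w | mset w = \<nu>'. b w * opx (Phi q) (M (mono w)) z) - (\<Sum>v | mset v = \<nu>. f (b v) * foldr (Phi q) v z) \<in> S"
proof -
  obtain ps where ps: "coact q \<nu> z ps" and hps: "\<And>y z'. (y, z') \<in> set ps \<Longrightarrow> homog \<nu> y"
    using coact_homog_exists[of q \<nu> z, OF q_nz] by blast
  let ?W' = "{w. mset w = \<nu>'}" and ?W = "{w. mset w = \<nu>}"
  have 1: "opx (Phi q) (M (mono w)) z = (\<Sum>(y, z') \<leftarrow> ps. scal (pair q w (f y)) * z')" if "mset w = \<nu>'" for w
    using ps[unfolded coact_def, rule_format, OF M, of "mono w"] that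
    by (simp add: homog_mono adj bil_mono)
  have 2: "foldr (Phi q) v z = (\<Sum>(y, z') \<leftarrow> ps. scal (pair q v y) * z')" if "mset v = \<nu>" for v
    using ps[unfolded coact_def, rule_format, of "mono v"] that by (simp add: homog_mono bil_mono)
  have sw: "(\<Sum>w\<in>W. c w * (\<Sum>(y, z') \<leftarrow> ps. scal (g w y) * z')) = (\<Sum>(y, z') \<leftarrow> ps. (\<Sum>w\<in>W. scal (g w y) * c w) * z')"
    for W and c :: "'i list \<Rightarrow> ('i, 'k) free_algebra" and g
    by (induction ps) (simp_all add: split_def distrib_left sum.distrib sum_distrib_right mult.assoc mult_scal_left[of "c w" for w])
  have "(\<Sum>w\<in>?W'. b w * opx (Phi q) (M (mono w)) z) - (\<Sum>v\<in>?W. f (b v) * foldr (Phi q) v z)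
      = (\<Sum>w\<in>?W'. b w * (\<Sum>(y, z') \<leftarrow> ps. scal (pair q w (f y)) * z')) - (\<Sum>v\<in>?W. f (b v) * (\<Sum>(y, z') \<leftarrow> ps. scal (pair q v y) * z'))"
    by (intro arg_cong2[of _ _ _ _ "(-)"] sum.cong refl) (auto simp: 1 2)
  also have "\<dots> = (\<Sum>(y, z') \<leftarrow> ps. ((\<Sum>w\<in>?W'. scal (pair q w (f y)) * b w) - (\<Sum>v\<in>?W. scal (pair q v y) * f (b v))) * z')"
    unfolding sw by (simp add: sum_list_subtractf[symmetric] split_def left_diff_distrib)
  also have "\<dots> \<in> S"
  proof (rule sum_list_in_fideal[OF fideal_S], clarify, rule S_right)
    fix y z' assume "(y, z') \<in> set ps"
    hence y: "homog \<nu> y" by (rule hps)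
    have A: "f y - (\<Sum>w\<in>?W'. scal (pair q w (f y)) * b w) \<in> S" by (rule b_dual[OF nu(1) hf[OF y]])
    have "f (y - (\<Sum>v\<in>?W. scal (pair q v y) * b v)) \<in> S" by (rule fS[OF b_dual[OF nu(2) y]])
    hence B: "f y - (\<Sum>v\<in>?W. scal (pair q v y) * f (b v)) \<in> S"
      by (simp add: klin_simps[OF f])
    from S_diff[OF B A] show "(\<Sum>w\<in>?W'. scal (pair q w (f y)) * b w) - (\<Sum>v\<in>?W. scal (pair q v y) * f (b v)) \<in> S"
      by simp
  qed
  finally show ?thesis .
qed

lemma subset_add_mset_less: "add_mset k \<nu> \<subset># \<gamma> \<Longrightarrow> \<nu> \<subset># \<gamma>" for k :: 'i and \<nu> \<gamma>
  using subset_mset.less_trans[of \<nu> "add_mset k \<nu>" \<gamma>] by simp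

lemma contract_right:
  assumes nu: "add_mset k \<nu> \<subset># \<beta>"
  shows "(\<Sum>w | mset w = add_mset k \<nu>. b w * opx (Phi q) (dR (swap_param q) k (mono w)) z)
     - (\<Sum>v | mset v = \<nu>. b v * mono [k] * foldr (Phi q) v z) \<in> S"
proof (rule b_contract[OF nu subset_add_mset_less[OF nu], where f = "\<lambda>y. y * mono [k]"])
  show "klin (\<lambda>y. y * mono [k])" by (rule klin_mult_right[OF klin_id])
  show "homog \<nu> (dR (swap_param q) k u)" if "homog (add_mset k \<nu>) u" for u :: "('i, 'k) free_algebra"
    using homog_dR[OF that, of k] by simp
  show "homog (add_mset k \<nu>) (y * mono [k])" if "homog \<nu> y" for y :: "('i, 'k) free_algebra"
    using homog_mult[OF that, of "{#k#}" "mono [k]"] by simp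
qed (simp_all add: bil_mult_gen S_right)

lemma contract_left:
  assumes nu: "add_mset k \<nu> \<subset># \<beta>"
  shows "(\<Sum>w | mset w = add_mset k \<nu>. b w * opx (Phi q) (dL (swap_param q) k (mono w)) z)
     - mono [k] * \<Theta> \<nu> z \<in> S"
proof -
  have "(\<Sum>w | mset w = add_mset k \<nu>. b w * opx (Phi q) (dL (swap_param q) k (mono w)) z)
     - (\<Sum>v | mset v = \<nu>. mono [k] * b v * foldr (Phi q) v z) \<in> S"
  proof (rule b_contract[OF nu subset_add_mset_less[OF nu], where f = "\<lambda>y. mono [k] * y"])
    show "klin (\<lambda>y. mono [k] * y)" by (rule klin_mult_left[OF klin_id])
    show "homog \<nu> (dL (swap_param q) k u)" if "homog (add_mset k \<nu>) u" for u :: "('i, 'k) free_algebra"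
      using homog_dL[OF that, of k] by simp
    show "homog (add_mset k \<nu>) (mono [k] * y)" if "homog \<nu> y" for y :: "('i, 'k) free_algebra"
      using homog_mult[of "{#k#}" "mono [k]", OF _ that] by simp
  qed (simp_all add: bil_gen_mult S_left)
  thus ?thesis by (simp add: \<Theta>_def sum_distrib_left mult.assoc)
qed

lemma K_add_mset: "K \<nu> (add_mset k \<gamma>) = chi q {#k#} \<nu> * K \<nu> \<gamma>"
  by (simp add: K_def chi_add_mset_left[of q k \<gamma> \<nu>])
text \<open>The sign and the factor \<open>chi q \<gamma> {#k#}\<close> are what lets the
  contribution of \<open>add_mset k \<nu>\<close> cancel that of \<nu> in
  \<open>casimir_step\<close>.\<close>

lemma K_add_mset_both: "K (add_mset k \<nu>) (add_mset k \<gamma>) = - chi q \<gamma> {#k#} * K \<nu> (add_mset k \<gamma>)"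
  using q_nz[of k k]
  by (simp add: K_def chi_add_mset_right[of q _ k \<nu>] chi_add_mset_left[of q k \<gamma>])

lemma sum_strict_submset_add_mset:
  fixes f :: "'i multiset \<Rightarrow> ('i, 'k) free_algebra"
  assumes "\<And>\<nu>. k \<notin># \<nu> \<Longrightarrow> f \<nu> = 0"
  shows "(\<Sum>\<nu> | \<nu> \<subset># add_mset k \<gamma>. f \<nu>) = (\<Sum>\<nu> | \<nu> \<subset># \<gamma>. f (add_mset k \<nu>))"
proof -
  have "(\<Sum>\<nu> | \<nu> \<subset># add_mset k \<gamma>. f \<nu>) = (\<Sum>\<nu>\<in>add_mset k ` {\<nu>. \<nu> \<subset># \<gamma>}. f \<nu>)"
  proof (rule sum.mono_neutral_right)
    show "\<forall>\<nu>\<in>{\<nu>. \<nu> \<subset># add_mset k \<gamma>} - add_mset k ` {\<nu>. \<nu> \<subset># \<gamma>}. f \<nu> = 0"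
    proof
      fix \<nu> assume \<nu>: "\<nu> \<in> {\<nu>. \<nu> \<subset># add_mset k \<gamma>} - add_mset k ` {\<nu>. \<nu> \<subset># \<gamma>}"
      have "k \<notin># \<nu>"
      proof
        assume "k \<in># \<nu>"
        hence "\<nu> = add_mset k (\<nu> - {#k#})" by simp
        moreover from this have "\<nu> - {#k#} \<subset># \<gamma>" using \<nu> by (metis DiffD1 mem_Collect_eq mset_subset_add_mset)
        ultimately show False using \<nu> by blast
      qed
      thus "f \<nu> = 0" by (rule assms)
    qed
  qed auto
  thus ?thesis by (simp add: sum.reindex inj_on_def)
qed

text \<open>Commuting e_k past the words in \<open>\<Theta>\<close> gives three families of terms.
  By \<open>contract_right\<close>, \<open>X2\<close> at \<open>add_mset k \<nu>\<close> equals
  \<open>X1\<close> at \<nu> modulo \<open>S\<close>, and the two cancel. By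
  \<open>contract_left\<close>, \<open>X3\<close> at \<open>add_mset k \<nu>\<close> is e_k times
  \<open>\<Theta> \<nu> z\<close>, which reassembles \<open>\<Omega> \<gamma> z\<close>.\<close>

lemma casimir_step:
  assumes z: "homog \<gamma> z" "\<gamma> \<noteq> {#}" and sub: "add_mset k \<gamma> \<subseteq># \<beta>"
  shows "\<Omega> (add_mset k \<gamma>) (mono [k] * z) - scal (chi q \<gamma> {#k#} * chi q {#k#} \<gamma>) * (mono [k] * \<Omega> \<gamma> z) \<in> S"
proof -
  define X1 where "X1 \<nu> = (\<Sum>w | mset w = \<nu>. b w * mono [k] * foldr (Phi q) w z)" for \<nu>
  define X2 where "X2 \<nu> = (\<Sum>w | mset w = \<nu>. b w * opx (Phi q) (dR (swap_param q) k (mono w)) z)" for \<nu>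
  define X3 where "X3 \<nu> = (\<Sum>w | mset w = \<nu>. b w * opx (Phi q) (dL (swap_param q) k (mono w)) z)" for \<nu>
  let ?\<gamma> = "add_mset k \<gamma>"
  let ?a = "inverse (chi q \<gamma> {#k#})"
  let ?c = "\<lambda>\<nu>. chi q {#k#} \<gamma> * inverse (chi q {#k#} \<nu>) * q k k"
  have T: "\<Theta> \<nu> (mono [k] * z) = X1 \<nu> + scal ?a * X2 \<nu> - scal (?c \<nu>) * X3 \<nu>" for \<nu>
  proof -
    have "\<Theta> \<nu> (mono [k] * z) = (\<Sum>w | mset w = \<nu>. b w * mono [k] * foldr (Phi q) w z
        + scal ?a * (b w * opx (Phi q) (dR (swap_param q) k (mono w)) z)
        - scal (?c \<nu>) * (b w * opx (Phi q) (dL (swap_param q) k (mono w)) z))"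
      unfolding \<Theta>_def
      by (rule sum.cong[OF refl], subst foldr_Phi_Cons[OF q_nz z(1)])
        (simp add: distrib_left right_diff_distrib mult_scal_left[of "b w" for w] mult.assoc)
    thus ?thesis by (simp add: X1_def X2_def X3_def sum_distrib_left sum.distrib sum_subtractf)
  qed
  \<comment> \<open>Here \<gamma> must be nonempty: the term at \<nu> = \<gamma> drops out, so all
    three sums run over the degrees strictly below \<gamma>.\<close>
  have X1_0: "X1 \<nu> = 0" if "\<not> \<nu> \<subset># \<gamma>" for \<nu>
    unfolding X1_def by (rule sum.neutral) (use that foldr_Phi_strict[OF z] in auto)
  have X2_0: "X2 \<nu> = 0" if "k \<notin># \<nu>" for \<nu>
    unfolding X2_def by (rule sum.neutral) (use that in \<open>auto simp: dR_mono dRw_0 opx_simps\<close>)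
  have X3_0: "X3 \<nu> = 0" if "k \<notin># \<nu>" for \<nu>
    unfolding X3_def by (rule sum.neutral) (use that in \<open>auto simp: dL_mono dLw_0 opx_simps\<close>)
  have s1: "(\<Sum>\<nu> | \<nu> \<subset># ?\<gamma>. scal (K \<nu> ?\<gamma>) * X1 \<nu>) = (\<Sum>\<nu> | \<nu> \<subset># \<gamma>. scal (K \<nu> ?\<gamma>) * X1 \<nu>)"
  proof (rule sum.mono_neutral_right)
    show "{\<nu>. \<nu> \<subset># \<gamma>} \<subseteq> {\<nu>. \<nu> \<subset># ?\<gamma>}"
      using subset_mset.less_trans[of _ \<gamma> ?\<gamma>] by auto
  qed (auto simp: X1_0)
  have s2: "(\<Sum>\<nu> | \<nu> \<subset># ?\<gamma>. scal (K \<nu> ?\<gamma>) * (scal ?a * X2 \<nu>)) = (\<Sum>\<nu> | \<nu> \<subset># \<gamma>. scal (- K \<nu> ?\<gamma>) * X2 (add_mset k \<nu>))"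
  proof (subst sum_strict_submset_add_mset)
    have "K (add_mset k \<nu>) ?\<gamma> * ?a = - K \<nu> ?\<gamma>" for \<nu>
      using chi_nz[of \<gamma> "{#k#}"] by (simp add: K_add_mset_both)
    thus "(\<Sum>\<nu> | \<nu> \<subset># \<gamma>. scal (K (add_mset k \<nu>) ?\<gamma>) * (scal ?a * X2 (add_mset k \<nu>))) =
      (\<Sum>\<nu> | \<nu> \<subset># \<gamma>. scal (- K \<nu> ?\<gamma>) * X2 (add_mset k \<nu>))"
      by (intro sum.cong) (simp_all only: scal_scal)
  qed (simp_all add: X2_0)
  have s3: "(\<Sum>\<nu> | \<nu> \<subset># ?\<gamma>. scal (K \<nu> ?\<gamma>) * (scal (?c \<nu>) * X3 \<nu>))
     = (\<Sum>\<nu> | \<nu> \<subset># \<gamma>. scal (- (chi q \<gamma> {#k#} * chi q {#k#} \<gamma>) * K \<nu> \<gamma>) * X3 (add_mset k \<nu>))"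
  proof (subst sum_strict_submset_add_mset)
    have "K (add_mset k \<nu>) ?\<gamma> * ?c (add_mset k \<nu>) = - (chi q \<gamma> {#k#} * chi q {#k#} \<gamma>) * K \<nu> \<gamma>" for \<nu>
      using chi_nz[of "{#k#}" \<nu>] q_nz[of k k]
      unfolding K_add_mset_both K_add_mset[of \<nu>] by (simp add: chi_add_mset_right[of q _ k \<nu>] field_simps)
    thus "(\<Sum>\<nu> | \<nu> \<subset># \<gamma>. scal (K (add_mset k \<nu>) ?\<gamma>) * (scal (?c (add_mset k \<nu>)) * X3 (add_mset k \<nu>))) =
      (\<Sum>\<nu> | \<nu> \<subset># \<gamma>. scal (- (chi q \<gamma> {#k#} * chi q {#k#} \<gamma>) * K \<nu> \<gamma>) * X3 (add_mset k \<nu>))"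
      by (intro sum.cong) (simp_all only: scal_scal)
  qed (simp_all add: X3_0)
  have "\<Omega> ?\<gamma> (mono [k] * z) - scal (chi q \<gamma> {#k#} * chi q {#k#} \<gamma>) * (mono [k] * \<Omega> \<gamma> z)
    = (\<Sum>\<nu> | \<nu> \<subset># \<gamma>. scal (- K \<nu> ?\<gamma>) * (X2 (add_mset k \<nu>) - X1 \<nu>))
    + (\<Sum>\<nu> | \<nu> \<subset># \<gamma>. scal (chi q \<gamma> {#k#} * chi q {#k#} \<gamma> * K \<nu> \<gamma>) * (X3 (add_mset k \<nu>) - mono [k] * \<Theta> \<nu> z))"
  proof -
    have "\<Omega> ?\<gamma> (mono [k] * z) = (\<Sum>\<nu> | \<nu> \<subset># \<gamma>. scal (K \<nu> ?\<gamma>) * X1 \<nu>)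
        + (\<Sum>\<nu> | \<nu> \<subset># \<gamma>. scal (- K \<nu> ?\<gamma>) * X2 (add_mset k \<nu>))
        - (\<Sum>\<nu> | \<nu> \<subset># \<gamma>. scal (- (chi q \<gamma> {#k#} * chi q {#k#} \<gamma>) * K \<nu> \<gamma>) * X3 (add_mset k \<nu>))"
      unfolding s1[symmetric] s2[symmetric] s3[symmetric]
      by (simp add: \<Omega>_def T distrib_left right_diff_distrib sum.distrib sum_subtractf)
    moreover have "scal (chi q \<gamma> {#k#} * chi q {#k#} \<gamma>) * (mono [k] * \<Omega> \<gamma> z)
        = (\<Sum>\<nu> | \<nu> \<subset># \<gamma>. scal (chi q \<gamma> {#k#} * chi q {#k#} \<gamma> * K \<nu> \<gamma>) * (mono [k] * \<Theta> \<nu> z))"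
      by (simp add: \<Omega>_def sum_distrib_left mult_scal_gen scal_scal)
    ultimately show ?thesis
      by (simp add: scal_minus right_diff_distrib sum_subtractf sum_negf)
  qed
  also have "\<dots> \<in> S"
  proof (intro S_add S_sum S_scal)
    fix \<nu> assume "\<nu> \<in> {\<nu>. \<nu> \<subset># \<gamma>}"
    hence nu: "add_mset k \<nu> \<subset># \<beta>"
      using subset_mset.less_le_trans[OF _ sub, of "add_mset k \<nu>"] by simp
    show "X2 (add_mset k \<nu>) - X1 \<nu> \<in> S" unfolding X1_def X2_def by (rule contract_right[OF nu])
    show "X3 (add_mset k \<nu>) - mono [k] * \<Theta> \<nu> z \<in> S" unfolding X3_def by (rule contract_left[OF nu])
  qed
  finally show ?thesis .
qed

lemma casimir_eigenvalue_add_mset: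
  "casimir_eigenvalue (add_mset k \<gamma>) = chi q \<gamma> {#k#} * chi q {#k#} \<gamma> * casimir_eigenvalue \<gamma>"
  using q_nz[of k k]
  by (simp add: casimir_eigenvalue_def chi_add_mset_right[of q _ k \<gamma>] chi_add_mset_left[of q k \<gamma>])

lemma b_Nil:
  assumes "\<beta> \<noteq> {#}"
  shows "1 - b [] \<in> S"
  using b_dual[of "{#}" 1] assms by (simp add: subset_mset.zero_less_iff_neq_zero)

lemma casimir_mono:
  "l \<noteq> [] \<Longrightarrow> mset l \<subseteq># \<beta> \<Longrightarrow> \<Omega> (mset l) (mono l) - scal (casimir_eigenvalue (mset l)) * mono l \<in> S"
proof (induction l)
  case (Cons k l)
  show ?case
  proof (cases "l = []")
    case True
    \<comment> \<open>The induction starts at one letter, as the strict sum is empty in degree 0.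
      Below a simple root only the degree 0 remains, and \<open>b []\<close> is 1 modulo
      \<open>S\<close>.\<close>
    have e: "{\<nu>. \<nu> \<subset># {#k#}} = {{#}}"
      using mset_subset_size[of _ "{#k#}"] by (auto simp: subset_mset.zero_less_iff_neq_zero)
    have "\<Omega> {#k#} (mono [k]) = b [] * mono [k]"
      by (simp add: \<Omega>_def e K_def \<Theta>_def)
    moreover have "casimir_eigenvalue {#k#} = 1" using q_nz[of k k] by (simp add: casimir_eigenvalue_def)
    moreover have "- ((1 - b []) * mono [k]) \<in> S"
      using Cons.prems by (intro fideal_uminus[OF fideal_S] S_right b_Nil) auto
    ultimately show ?thesis using True by (simp add: left_diff_distrib)
  next
    case False
    let ?\<gamma> = "mset l"
    have sub: "add_mset k ?\<gamma> \<subseteq># \<beta>" using Cons.prems by simp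
    hence "?\<gamma> \<subseteq># \<beta>" using subset_mset.order_trans[of ?\<gamma> "add_mset k ?\<gamma>" \<beta>] by simp
    with Cons.IH False have IH: "\<Omega> ?\<gamma> (mono l) - scal (casimir_eigenvalue ?\<gamma>) * mono l \<in> S" by blast
    let ?c = "chi q ?\<gamma> {#k#} * chi q {#k#} ?\<gamma>"
    have 1: "\<Omega> (add_mset k ?\<gamma>) (mono [k] * mono l) - scal ?c * (mono [k] * \<Omega> ?\<gamma> (mono l)) \<in> S"
      by (rule casimir_step[OF _ _ sub]) (use False in \<open>auto simp: homog_mono\<close>)
    have 2: "scal ?c * (mono [k] * (\<Omega> ?\<gamma> (mono l) - scal (casimir_eigenvalue ?\<gamma>) * mono l)) \<in> S"
      by (intro S_scal S_left IH)
    from S_add[OF 1 2] show ?thesis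
      by (simp add: mono_Cons[of k l] right_diff_distrib mult_scal_gen scal_scal casimir_eigenvalue_add_mset)
  qed
qed simp

lemma klin_\<Omega>: "klin (\<Omega> \<gamma>)"
  unfolding \<Omega>_def[abs_def] \<Theta>_def
  by (intro klin_setsum klin_mult_left klin_foldr klin_Phi)

lemma casimir_homog:
  assumes "homog \<beta> x" "\<beta> \<noteq> {#}"
  shows "\<Omega> \<beta> x - scal (casimir_eigenvalue \<beta>) * x \<in> S"
  using assms(1)
proof (induction rule: homog_induct)
  case (add x y)
  have "\<Omega> \<beta> (x + y) - scal (casimir_eigenvalue \<beta>) * (x + y)
      = (\<Omega> \<beta> x - scal (casimir_eigenvalue \<beta>) * x) + (\<Omega> \<beta> y - scal (casimir_eigenvalue \<beta>) * y)"
    by (simp add: klin_add[OF klin_\<Omega>] distrib_left)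
  with S_add[OF add(3,4)] show ?case by simp
next
  case (mono c l)
  have "l \<noteq> []" using mono assms(2) by auto
  hence "scal c * (\<Omega> \<beta> (mono l) - scal (casimir_eigenvalue \<beta>) * mono l) \<in> S"
    using casimir_mono[of l, unfolded mono] by (intro S_scal) simp
  thus ?case by (simp add: klin_scal[OF klin_\<Omega>] right_diff_distrib scal_scal mult.commute)
qed (simp add: klin_zero[OF klin_\<Omega>] S.zero)

text \<open>Every nonempty word applies some \<open>Phi q k\<close> to \<open>x\<close> first and so
  lands in \<open>S\<close>; the term of degree 0 is \<open>b [] * x\<close>.\<close>

lemma casimir_singular:
  assumes "\<beta> \<noteq> {#}" "\<And>k. Phi q k x \<in> S"
  shows "\<Omega> \<beta> x - x \<in> S"
proof -
  have "\<Theta> \<nu> x \<in> S" if "\<nu> \<noteq> {#}" for \<nu>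
    unfolding \<Theta>_def
  proof (intro S_sum S_left)
    fix w assume "w \<in> {w. mset w = \<nu>}"
    with that obtain v k where w: "w = v @ [k]" by (cases w rule: rev_cases) auto
    have "foldr (Phi q) v (Phi q k x) \<in> S"
      by (induction v) (simp_all add: assms(2) S_Phi)
    thus "foldr (Phi q) w x \<in> S" by (simp add: w)
  qed
  hence "(\<Sum>\<nu>\<in>{\<nu>. \<nu> \<subset># \<beta>} - {{#}}. scal (K \<nu> \<beta>) * \<Theta> \<nu> x) \<in> S"
    by (intro S_sum S_scal) auto
  moreover have "\<Omega> \<beta> x = scal (K {#} \<beta>) * \<Theta> {#} x + (\<Sum>\<nu>\<in>{\<nu>. \<nu> \<subset># \<beta>} - {{#}}. scal (K \<nu> \<beta>) * \<Theta> \<nu> x)"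
    unfolding \<Omega>_def using assms(1)
    by (intro sum.remove) (simp_all add: subset_mset.zero_less_iff_neq_zero)
  moreover have "scal (K {#} \<beta>) * \<Theta> {#} x = b [] * x" by (simp add: K_def \<Theta>_def)
  ultimately have "\<Omega> \<beta> x - b [] * x \<in> S" by simp
  from S_diff[OF this S_right[OF b_Nil[OF assms(1)], of x]] show ?thesis by (simp add: left_diff_distrib)
qed

end

text \<open>The hypothesis \<open>H\<close> is the induction hypothesis of
  \<open>radical_homog\<close>; it supplies the dual family in every degree strictly below \<beta>.
  The two evaluations of \<open>\<Omega>\<close> on \<open>x\<close> then force the eigenvalue to be
  1.\<close>

lemma casimir_radical:
  assumes H: "\<And>\<nu> y. \<nu> \<subset># \<beta> \<Longrightarrow> homog \<nu> y \<Longrightarrow> (\<And>w. pair q w y = 0) \<Longrightarrow> y \<in> S"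
    and x: "homog \<beta> x" "x \<notin> S" "\<beta> \<noteq> {#}" "\<And>k. Phi q k x \<in> S"
  shows "casimir_eigenvalue \<beta> = 1"
proof -
  have ex: "\<exists>b. (\<forall>w. homog \<nu> (b w)) \<and>
    (\<forall>y. homog \<nu> y \<longrightarrow> y - (\<Sum>w | mset w = \<nu>. scal (pair q w y) * b w) \<in> S)" if "\<nu> \<subset># \<beta>" for \<nu>
  proof (rule section_exists)
    fix y assume y: "homog \<nu> y" "\<And>w. mset w = \<nu> \<Longrightarrow> pair q w y = 0"
    show "y \<in> S"
    proof (rule H[OF that y(1)])
      show "pair q w y = 0" for w using y(2) pair_degree[OF y(1), of w q] by blast
    qed
  qed
  have "\<forall>\<nu>\<in>{\<nu>. \<nu> \<subset># \<beta>}. \<exists>b. (\<forall>w. homog \<nu> (b w)) \<and>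
    (\<forall>y. homog \<nu> y \<longrightarrow> y - (\<Sum>w | mset w = \<nu>. scal (pair q w y) * b w) \<in> S)"
    using ex by blast
  from bchoice[OF this] obtain B where B: "\<And>\<nu> w. \<nu> \<subset># \<beta> \<Longrightarrow> homog \<nu> (B \<nu> w)"
    "\<And>\<nu> y. \<nu> \<subset># \<beta> \<Longrightarrow> homog \<nu> y \<Longrightarrow> y - (\<Sum>w | mset w = \<nu>. scal (pair q w y) * B \<nu> w) \<in> S"
    by auto
  define b where "b w = B (mset w) w" for w
  have b1: "homog (mset w) (b w)" if "mset w \<subset># \<beta>" for w using B(1) that by (simp add: b_def)
  have b2: "y - (\<Sum>w | mset w = \<nu>. scal (pair q w y) * b w) \<in> S" if "\<nu> \<subset># \<beta>" "homog \<nu> y" for \<nu> y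
    using B(2)[OF that] by (simp add: b_def)
  have "\<Omega> b \<beta> x - scal (casimir_eigenvalue \<beta>) * x \<in> S"
    by (rule casimir_homog[of \<beta> b]) (use b1 b2 x in auto)
  moreover have "\<Omega> b \<beta> x - x \<in> S"
    by (rule casimir_singular[of \<beta> b]) (use b1 b2 x in auto)
  ultimately have "(\<Omega> b \<beta> x - scal (casimir_eigenvalue \<beta>) * x) - (\<Omega> b \<beta> x - x) \<in> S" by (rule S_diff)
  hence "scal (1 - casimir_eigenvalue \<beta>) * x \<in> S" by (simp add: scal_diff left_diff_distrib)
  hence "1 - casimir_eigenvalue \<beta> = 0"
    using x(2) fideal_scal_iff[OF fideal_S, of "1 - casimir_eigenvalue \<beta>" x] by blast
  thus ?thesis by simp
qed

end

section \<open>The radical of the pairing\<close>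

lemma prod_mset_UNIV: "(\<Prod>i\<in>#\<mu>. f i) = (\<Prod>i\<in>(UNIV::'i::finite set). (f i :: 'k::comm_monoid_mult) ^ count \<mu> i)"
proof (induction \<mu>)
  case (add x \<mu>)
  have "(\<Prod>i\<in>(UNIV::'i set). f i ^ count (add_mset x \<mu>) i) = (\<Prod>i\<in>(UNIV::'i set). (if i = x then f x else 1) * f i ^ count \<mu> i)"
    by (rule prod.cong) auto
  thus ?case using add by (simp add: prod.distrib)
qed simp

lemma chi_UNIV: "chi p \<mu> \<nu> = (\<Prod>i\<in>(UNIV::'i::finite set). \<Prod>j\<in>UNIV. p i j ^ (count \<mu> i * count \<nu> j))"
  by (simp add: chi_def prod_mset_UNIV prod_power_distrib power_mult[symmetric] mult.commute)

lemma sum_mset_pos: "(\<And>i. 0 \<le> c i) \<Longrightarrow> (\<Sum>i\<in>(UNIV::'i::finite set). (c i :: int)) = 0 \<Longrightarrow> c j = 0"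
  by (simp add: sum_nonneg_eq_0_iff)

locale quantum_group =
  fixes A :: "'i::finite \<Rightarrow> 'i \<Rightarrow> int" and q :: "'i \<Rightarrow> 'i \<Rightarrow> 'k::field_char_0"
  assumes gcm: "gen_cartan_matrix A" and sym: "symmetrizable A"
    and ind: "indeterminate_parameters A q" and root: "\<And>i m. m > 0 \<Longrightarrow> q i i ^ m \<noteq> 1"

sublocale quantum_group \<subseteq> qserre
  using gcm ind root by unfold_locales (auto simp: gen_cartan_matrix_def indeterminate_parameters_def)

context quantum_group
begin

lemma A_diag: "A i i = 2" using gcm by (simp add: gen_cartan_matrix_def)

text \<open>On a relation the form takes the value \<open>d_i a_ij + d_j a_ji - 2 d_i a_ij\<close>,
  which is 0 by symmetry. The form is integer valued and \<open>n > 0\<close> can be cancelled, so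
  it vanishes on the saturation too.\<close>

lemma dependent_form:
  assumes d: "\<And>i j. d i * A i j = d j * A j i" and x: "x \<in> dependent_exponents A"
  shows "(\<Sum>k\<in>UNIV. \<Sum>l\<in>UNIV. d k * A k l * x k l) = (0::int)"
proof -
  let ?\<phi> = "\<lambda>x. \<Sum>k\<in>UNIV. \<Sum>l\<in>UNIV. d k * A k l * x k l"
  have rel: "?\<phi> (relation_exponents A i j) = 0" for i j
  proof -
    have b: "(\<Sum>k\<in>UNIV. \<Sum>l\<in>UNIV. d k * A k l * of_bool (k = a \<and> l = b)) = d a * A a b" for a b
    proof -
      have "(\<Sum>l\<in>UNIV. d k * A k l * of_bool (k = a \<and> l = b)) = (if k = a then d a * A a b else 0)" for k
      proof -
        have "(\<Sum>l\<in>UNIV. d k * A k l * of_bool (k = a \<and> l = b)) = (\<Sum>l\<in>UNIV. if l = b then (if k = a then d a * A a b else 0) else 0)"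
          by (rule sum.cong) auto
        thus ?thesis by simp
      qed
      thus ?thesis by simp
    qed
    have "?\<phi> (relation_exponents A i j) = (\<Sum>k\<in>UNIV. \<Sum>l\<in>UNIV. d k * A k l * of_bool (k = i \<and> l = j))
        + (\<Sum>k\<in>UNIV. \<Sum>l\<in>UNIV. d k * A k l * of_bool (k = j \<and> l = i))
        - A i j * (\<Sum>k\<in>UNIV. \<Sum>l\<in>UNIV. d k * A k l * of_bool (k = i \<and> l = i))"
      unfolding relation_exponents_def sum_distrib_left sum.distrib[symmetric] sum_subtractf[symmetric]
      by (intro sum.cong refl) (simp add: algebra_simps)
    thus ?thesis unfolding b using d[of i j] by (simp add: A_diag algebra_simps)
  qed
  from x obtain n c where n: "n > 0" and c: "\<And>k l. n * x k l = (\<Sum>i\<in>UNIV. \<Sum>j\<in>UNIV. c i j * relation_exponents A i j k l)"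
    unfolding dependent_exponents_def by blast
  have "n * ?\<phi> x = (\<Sum>k\<in>UNIV. \<Sum>l\<in>UNIV. d k * A k l * (n * x k l))"
    by (simp add: sum_distrib_left algebra_simps)
  also have "\<dots> = (\<Sum>k\<in>UNIV. \<Sum>l\<in>UNIV. \<Sum>i\<in>UNIV. \<Sum>j\<in>UNIV. c i j * (d k * A k l * relation_exponents A i j k l))"
    unfolding c by (simp add: sum_distrib_left algebra_simps)
  also have "\<dots> = (\<Sum>k\<in>UNIV. \<Sum>i\<in>UNIV. \<Sum>l\<in>UNIV. \<Sum>j\<in>UNIV. c i j * (d k * A k l * relation_exponents A i j k l))"
    by (intro sum.cong refl sum.swap)
  also have "\<dots> = (\<Sum>i\<in>UNIV. \<Sum>k\<in>UNIV. \<Sum>l\<in>UNIV. \<Sum>j\<in>UNIV. c i j * (d k * A k l * relation_exponents A i j k l))"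
    by (rule sum.swap)
  also have "\<dots> = (\<Sum>i\<in>UNIV. \<Sum>k\<in>UNIV. \<Sum>j\<in>UNIV. \<Sum>l\<in>UNIV. c i j * (d k * A k l * relation_exponents A i j k l))"
    by (intro sum.cong refl sum.swap)
  also have "\<dots> = (\<Sum>i\<in>UNIV. \<Sum>j\<in>UNIV. \<Sum>k\<in>UNIV. \<Sum>l\<in>UNIV. c i j * (d k * A k l * relation_exponents A i j k l))"
    by (intro sum.cong refl sum.swap)
  also have "\<dots> = (\<Sum>i\<in>UNIV. \<Sum>j\<in>UNIV. c i j * ?\<phi> (relation_exponents A i j))"
    by (simp add: sum_distrib_left)
  also have "\<dots> = 0" by (simp add: rel)
  finally show ?thesis using n by simp
qed

text \<open>If the form did not vanish on \<open>m\<close>, then \<open>m\<close> and the zero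
  matrix would be incongruent modulo the dependent lattice, and their monomials, both equal to 1,
  would have to be linearly independent.\<close>

lemma laurent_eq_1_form:
  assumes d: "\<And>i j. d i * A i j = d j * A j i" and m: "laurent_monomial q m = 1"
  shows "(\<Sum>k\<in>UNIV. \<Sum>l\<in>UNIV. d k * A k l * m k l) = (0::int)"
proof (rule ccontr)
  assume nz: "\<not> ?thesis"
  have 1: "m \<notin> dependent_exponents A" using dependent_form[OF d] nz by blast
  have 2: "(\<lambda>k l. - m k l) \<notin> dependent_exponents A"
    using dependent_form[OF d, of "\<lambda>k l. - m k l"] nz by (auto simp: sum_negf)
  have m0: "m \<noteq> (\<lambda>k l. 0)" using nz by auto
  have l0: "laurent_monomial q (\<lambda>k l. 0) = 1" by (simp add: laurent_monomial_def)
  have H: "\<forall>m\<in>T. c m = 0" if "finite T"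
      "\<forall>m\<in>T. \<forall>m'\<in>T. m \<noteq> m' \<longrightarrow> (\<lambda>k l. m k l - m' k l) \<notin> dependent_exponents A"
      "(\<Sum>m\<in>T. of_rat (c m) * laurent_monomial q m) = 0"
    for T and c :: "('i \<Rightarrow> 'i \<Rightarrow> int) \<Rightarrow> rat"
    using ind that unfolding indeterminate_parameters_def by blast
  have "\<forall>a\<in>{m, \<lambda>k l. 0}. (if a = m then 1 else - 1 :: rat) = 0"
  proof (rule H)
    show "\<forall>a\<in>{m, \<lambda>k l. 0}. \<forall>a'\<in>{m, \<lambda>k l. 0}. a \<noteq> a' \<longrightarrow> (\<lambda>k l. a k l - a' k l) \<notin> dependent_exponents A"
      using 1 2 by simp
    show "(\<Sum>a\<in>{m, \<lambda>k l. 0}. of_rat (if a = m then 1 else - 1) * laurent_monomial q a) = 0"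
      using m m0 l0 by simp
  qed simp
  thus False by simp
qed

lemma powi_eq_1: "q i i powi n = 1 \<Longrightarrow> n = 0"
  using root[of "nat n" i] root[of "nat (- n)" i] q_nz[of i i]
  by (cases "n > 0"; cases "n < 0") (auto simp: power_int_def power_inverse)

text \<open>The exponent is the value of \<beta> on the simple coroot of \<open>i\<close>; through
  it \<open>lowest_weight\<close> becomes an inequality between integers.\<close>

lemma chi_symmetric: "chi q {#i#} \<beta> * chi q \<beta> {#i#} = q i i powi (\<Sum>j\<in>UNIV. A i j * int (count \<beta> j))"
proof -
  have "chi q {#i#} \<beta> * chi q \<beta> {#i#} = (\<Prod>j\<in>#\<beta>. q i i powi A i j)"
    by (simp add: chi_def prod_mset.distrib[symmetric] q_rel)
  also have "\<dots> = q i i powi (\<Sum>j\<in>#\<beta>. A i j)"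
    by (induction \<beta>) (simp_all add: power_int_add q_nz)
  also have "(\<Sum>j\<in>#\<beta>. A i j) = (\<Sum>j\<in>UNIV. A i j * int (count \<beta> j))"
  proof (induction \<beta>)
    case (add x \<beta>)
    have "(\<Sum>j\<in>UNIV. A i j * int (count (add_mset x \<beta>) j)) = (\<Sum>j\<in>UNIV. (if j = x then A i x else 0) + A i j * int (count \<beta> j))"
      by (rule sum.cong) (auto simp: algebra_simps)
    thus ?case using add by (simp add: sum.distrib)
  qed simp
  finally show ?thesis .
qed

lemma casimir_eigenvalue_laurent:
  "casimir_eigenvalue \<beta> = laurent_monomial q (\<lambda>k l. int (count \<beta> k * count \<beta> l) - (if k = l then int (count \<beta> k) else 0))"
proof -
  have "laurent_monomial q (\<lambda>k l. int (count \<beta> k * count \<beta> l) - (if k = l then int (count \<beta> k) else 0))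
    = (\<Prod>k\<in>UNIV. \<Prod>l\<in>UNIV. q k l ^ (count \<beta> k * count \<beta> l) / (if k = l then q k k ^ count \<beta> k else 1))"
    unfolding laurent_monomial_def
    by (intro prod.cong refl) (auto simp: power_int_diff q_nz simp del: of_nat_mult)
  also have "\<dots> = chi q \<beta> \<beta> / (\<Prod>k\<in>UNIV. q k k ^ count \<beta> k)"
    by (simp add: prod_dividef chi_UNIV)
  finally show ?thesis by (simp add: casimir_eigenvalue_def prod_mset_UNIV)
qed

text \<open>With \<open>(\<alpha>\<^sub>i, \<alpha>\<^sub>j) = d\<^sub>i a\<^sub>i\<^sub>j\<close>, the first assumption becomes \<open>(\<beta>, \<beta>) = 2 (\<rho>, \<beta>)\<close> and the last one
  gives \<open>(\<beta>, \<beta>) \<le> 0\<close>.\<close>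

lemma weight_contradiction:
  assumes eig: "casimir_eigenvalue \<beta> = 1" and b: "\<beta> \<noteq> {#}"
    and low: "\<And>i. \<exists>m. chi q {#i#} \<beta> * chi q \<beta> {#i#} * q i i ^ m = 1"
  shows False
proof -
  obtain d :: "'i \<Rightarrow> int" where dpos: "\<And>i. d i > 0" and d: "\<And>i j. d i * A i j = d j * A j i"
    using sym unfolding symmetrizable_def by blast
  let ?c = "\<lambda>i. int (count \<beta> i)"
  have neg: "(\<Sum>j\<in>UNIV. A i j * ?c j) \<le> 0" for i
  proof -
    obtain m where "chi q {#i#} \<beta> * chi q \<beta> {#i#} * q i i ^ m = 1" using low by blast
    hence "q i i powi ((\<Sum>j\<in>UNIV. A i j * ?c j) + int m) = 1"
      by (simp add: chi_symmetric power_int_add q_nz)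
    thus ?thesis using powi_eq_1 by fastforce
  qed
  have "(\<Sum>k\<in>UNIV. \<Sum>l\<in>UNIV. d k * A k l * (int (count \<beta> k * count \<beta> l) - (if k = l then ?c k else 0))) = 0"
    using eig by (intro laurent_eq_1_form d) (simp only: casimir_eigenvalue_laurent)
  also have "(\<Sum>k\<in>UNIV. \<Sum>l\<in>UNIV. d k * A k l * (int (count \<beta> k * count \<beta> l) - (if k = l then ?c k else 0)))
    = (\<Sum>k\<in>UNIV. (d k * ?c k * (\<Sum>l\<in>UNIV. A k l * ?c l) - 2 * d k * ?c k))"
  proof (rule sum.cong[OF refl])
    fix k
    have "(\<Sum>l\<in>UNIV. d k * A k l * (int (count \<beta> k * count \<beta> l) - (if k = l then ?c k else 0)))
      = (\<Sum>l\<in>UNIV. d k * ?c k * (A k l * ?c l) - (if k = l then 2 * d k * ?c k else 0))"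
      by (rule sum.cong) (auto simp: algebra_simps A_diag)
    thus "(\<Sum>l\<in>UNIV. d k * A k l * (int (count \<beta> k * count \<beta> l) - (if k = l then ?c k else 0)))
      = d k * ?c k * (\<Sum>l\<in>UNIV. A k l * ?c l) - 2 * d k * ?c k"
      by (simp add: sum_subtractf sum_distrib_left)
  qed
  finally have z: "(\<Sum>k\<in>UNIV. 2 * d k * ?c k - d k * ?c k * (\<Sum>l\<in>UNIV. A k l * ?c l)) = 0"
    by (simp add: sum_subtractf)
  have s: "d k * ?c k * (\<Sum>l\<in>UNIV. A k l * ?c l) \<le> 0" for k
    using neg[of k] dpos[of k] by (simp add: mult_nonneg_nonpos)
  have p: "0 \<le> 2 * d k * ?c k" for k using dpos[of k] by simp
  obtain i where i: "i \<in># \<beta>" using b by blast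
  \<comment> \<open>In \<open>z\<close> every summand is nonnegative, hence each of them is 0,
    whereas the summand of a letter that occurs in \<beta> has a strictly positive part.\<close>
  have "2 * d i * ?c i - d i * ?c i * (\<Sum>l\<in>UNIV. A i l * ?c l) = 0"
    by (rule sum_mset_pos[OF _ z]) (use s p in \<open>smt (verit)\<close>)
  moreover have "0 < 2 * d i * ?c i" using dpos[of i] i by simp
  ultimately show False using s[of i] by linarith
qed

lemma radical_homog: "homog \<beta> x \<Longrightarrow> (\<And>w. pair q w x = 0) \<Longrightarrow> x \<in> S"
proof (induction "size \<beta>" arbitrary: \<beta> x rule: less_induct)
  case less
  show ?case
  proof (cases "\<beta> = {#}")
    case True
    have "lk x w = 0" for w
    proof (cases "w = 0")
      case True thus ?thesis using less(3)[of "[]"] by simp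
    next
      case False
      hence "letters w \<noteq> []" by (cases w) auto
      thus ?thesis using less(2) \<open>\<beta> = {#}\<close> by (auto simp: homog_def in_keys_iff)
    qed
    hence "x = 0" by (intro poly_mapping_eqI) simp
    thus ?thesis by (simp add: S.zero)
  next
    case False
    have IH: "y \<in> S" if "\<nu> \<subset># \<beta>" "homog \<nu> y" "\<And>w. pair q w y = 0" for \<nu> y
      using less(1)[OF mset_subset_size[OF that(1)] that(2,3)] .
    have sub: "\<beta> - {#k#} \<subset># \<beta>" if "k \<in># \<beta>" for k
      unfolding subset_mset_def using that
      by (metis diff_subset_eq_self insert_DiffM multi_self_add_other_not_self)
    \<comment> \<open>Pairings of the two derivatives of \<open>x\<close> with \<open>w\<close> are
      pairings of \<open>x\<close> with \<open>w @ [k]\<close> and \<open>k # w\<close>, so both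
      derivatives lie in the radical in a smaller degree.\<close>
    have R: "dR q k x \<in> S" for k
    proof (cases "k \<in># \<beta>")
      case True thus ?thesis
        by (intro IH[OF sub homog_dR[OF less(2)]]) (simp_all add: pair_snoc[symmetric] less(3))
    qed (simp add: dR_0[OF less(2)] S.zero)
    have L: "dL q k x \<in> S" for k
    proof (cases "k \<in># \<beta>")
      case True thus ?thesis
        by (intro IH[OF sub homog_dL[OF less(2)]]) (simp_all add: pair_Cons[symmetric] less(3))
    qed (simp add: dL_0[OF less(2)] S.zero)
    have P: "Phi q k x \<in> S" for k
      unfolding Phi_def dR_inv_param[OF q_nz less(2)] by (intro S_diff S_scal L R)
    show ?thesis
    proof (rule ccontr)
      assume x: "x \<notin> S"
      have "casimir_eigenvalue \<beta> = 1"
        by (rule casimir_radical[OF _ less(2) x False P]) (rule IH)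
      thus False
        by (rule weight_contradiction[OF _ False]) (rule lowest_weight[OF less(2) x R L])
    qed
  qed
qed

theorem radical_eq_S: "x \<in> S \<longleftrightarrow> (\<forall>w. pair q w x = 0)"
proof
  assume h: "\<forall>w. pair q w x = 0"
  have "hcomp \<gamma> x \<in> S" for \<gamma>
  proof (rule radical_homog[of \<gamma>])
    show "pair q w (hcomp \<gamma> x) = 0" for w
      using h pair_hcomp[of q w x] pair_degree[of \<gamma> "hcomp \<gamma> x" w q] by (cases "mset w = \<gamma>") auto
  qed simp
  hence "(\<Sum>\<gamma>\<in>mdegs x. hcomp \<gamma> x) \<in> S" by (rule S_sum)
  thus "x \<in> S" by (simp add: sum_cmp)
qed (simp add: S_pair)

end

section \<open>Quotients of type-class rings\<close>

abbreviation (input) "RT \<equiv> ring_of_type_algebra"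

lemma RT_simps [simp]:
  "carrier RT = UNIV" "x \<otimes>\<^bsub>RT\<^esub> y = x * y" "x \<oplus>\<^bsub>RT\<^esub> y = x + y" "\<one>\<^bsub>RT\<^esub> = 1" "\<zero>\<^bsub>RT\<^esub> = 0"
  by (simp_all add: ring_of_type_algebra_def)

lemma ring_RT: "ring (RT :: 'r::ring_1 ring)"
proof (intro ringI abelian_groupI monoidI)
  fix x :: 'r assume "x \<in> carrier RT"
  show "\<exists>y\<in>carrier RT. y \<oplus>\<^bsub>RT\<^esub> x = \<zero>\<^bsub>RT\<^esub>"
    by (auto intro: exI[of _ "- x"])
qed (simp_all add: algebra_simps)

lemma a_inv_RT [simp]: "\<ominus>\<^bsub>RT\<^esub> x = - (x :: 'r::ring_1)"
proof -
  interpret ring "RT :: 'r ring" by (rule ring_RT)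
  show ?thesis using minus_equality[of "- x" x] by simp
qed

lemma ideal_iff_fideal: "ideal I (RT :: 'r::ring_1 ring) \<longleftrightarrow> fideal I"
proof
  assume "ideal I RT"
  then interpret ideal I "RT :: 'r ring" .
  show "fideal I"
    unfolding fideal_def
    using zero_closed a_closed I_l_closed I_r_closed additive_subgroup.zero_closed[OF is_additive_subgroup]
      additive_subgroup.a_closed[OF is_additive_subgroup] by auto
next
  assume I: "fideal I"
  show "ideal I RT"
  proof (rule idealI[OF ring_RT])
    show "subgroup I (add_monoid RT)"
    proof (rule group.subgroupI)
      show "group (add_monoid (RT :: 'r ring))"
        using abelian_group.a_group[OF ring.is_abelian_group[OF ring_RT]] .
      show "I \<noteq> {}" using fideal_0[OF I] by auto
      fix a assume "a \<in> I"
      moreover have "inv\<^bsub>add_monoid RT\<^esub> a = - a" using a_inv_RT[of a] unfolding a_inv_def .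
      ultimately show "inv\<^bsub>add_monoid RT\<^esub> a \<in> I" using fideal_uminus[OF I] by metis
    qed (use fideal_add[OF I] in auto)
  qed (use fideal_left[OF I] fideal_right[OF I] in auto)
qed

lemma fideal_Idl: "fideal (Idl\<^bsub>RT\<^esub> (G :: 'r::ring_1 set))"
  using ring.genideal_ideal[OF ring_RT, of G] by (simp add: ideal_iff_fideal)
lemma Idl_self: "x \<in> G \<Longrightarrow> x \<in> Idl\<^bsub>RT\<^esub> (G :: 'r::ring_1 set)"
  using ring.genideal_self[OF ring_RT, of G] by auto
lemma Idl_minimal: "fideal I \<Longrightarrow> (G :: 'r::ring_1 set) \<subseteq> I \<Longrightarrow> Idl\<^bsub>RT\<^esub> G \<subseteq> I"
  using ring.genideal_minimal[OF ring_RT, of I G] by (simp add: ideal_iff_fideal)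

text \<open>Calculus of cosets in the quotient ring, used both for \<open>U\<close> and for its
  tensor square.\<close>

locale fideal_quot =
  fixes I :: "'r::ring_1 set"
  assumes fid: "fideal I"
begin

abbreviation "Q \<equiv> RT Quot I"
abbreviation cl :: "'r \<Rightarrow> 'r set" where "cl a \<equiv> I +>\<^bsub>RT\<^esub> a"

lemma cl_mem: "x \<in> cl a \<longleftrightarrow> x - a \<in> I"
proof -
  have "x \<in> cl a \<longleftrightarrow> (\<exists>h\<in>I. x = h + a)"
    by (simp add: a_r_coset_def r_coset_def)
  also have "\<dots> \<longleftrightarrow> x - a \<in> I" by (auto intro!: bexI[of _ "x - a"])
  finally show ?thesis .
qed

lemma cl_eq_iff: "cl a = cl b \<longleftrightarrow> a - b \<in> I"
proof
  assume "cl a = cl b"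
  moreover have "a \<in> cl a" by (simp add: cl_mem fideal_0[OF fid])
  ultimately show "a - b \<in> I" by (metis cl_mem)
next
  assume ab: "a - b \<in> I"
  have "x - a \<in> I \<longleftrightarrow> x - b \<in> I" for x
    using fideal_add[OF fid _ ab, of "x - a"] fideal_diff[OF fid _ ab, of "x - b"] by auto
  thus "cl a = cl b" by (auto simp: cl_mem)
qed

interpretation id: ideal I RT using fid by (simp add: ideal_iff_fideal)

lemma ring_Q: "ring Q" by (rule id.quotient_is_ring)

lemma carrier_Q: "x \<in> carrier Q \<longleftrightarrow> (\<exists>a. x = cl a)"
  by (auto simp: FactRing_def A_RCOSETS_def' )
lemma cl_carrier [simp]: "cl a \<in> carrier Q" by (auto simp: carrier_Q)
lemma cl_add: "cl a \<oplus>\<^bsub>Q\<^esub> cl b = cl (a + b)"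
  using ring_hom_add[OF id.rcos_ring_hom, of a b] by simp
lemma cl_mult: "cl a \<otimes>\<^bsub>Q\<^esub> cl b = cl (a * b)"
  using ring_hom_mult[OF id.rcos_ring_hom, of a b] by simp
lemma cl_one: "\<one>\<^bsub>Q\<^esub> = cl 1"
  using ring_hom_one[OF id.rcos_ring_hom] by simp
lemma cl_zero: "\<zero>\<^bsub>Q\<^esub> = cl 0"
proof -
  have "cl 0 = I" using cl_mem[of _ 0] by auto
  thus ?thesis by (simp add: FactRing_def)
qed

lemma cl_finsum: "finite K \<Longrightarrow> (\<Oplus>\<^bsub>Q\<^esub>k\<in>K. cl (f k)) = cl (sum f K)"
proof (induction K rule: finite_induct)
  case empty show ?case
    using abelian_monoid.finsum_empty[OF ring.is_abelian_group[OF ring_Q, THEN abelian_group.axioms(1)]]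
    by (simp add: cl_zero)
next
  case (insert k K)
  have "(\<Oplus>\<^bsub>Q\<^esub>k\<in>insert k K. cl (f k)) = cl (f k) \<oplus>\<^bsub>Q\<^esub> (\<Oplus>\<^bsub>Q\<^esub>k\<in>K. cl (f k))"
    by (rule abelian_monoid.finsum_insert[OF ring.is_abelian_group[OF ring_Q, THEN abelian_group.axioms(1)]])
      (use insert in auto)
  thus ?case using insert by (simp add: cl_add)
qed

lemma cl_minus: "inv\<^bsub>add_monoid Q\<^esub> cl a = cl (- a)"
proof -
  have "\<ominus>\<^bsub>Q\<^esub> cl a = cl (- a)"
    by (rule abelian_group.minus_equality[OF ring.is_abelian_group[OF ring_Q]]) (simp_all add: cl_add cl_zero)
  thus ?thesis by (simp add: a_inv_def)
qed

lemma generate_add_cl: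
  assumes "V = cl ` W" "0 \<in> W'" "W \<subseteq> W'" "\<And>x y. x \<in> W' \<Longrightarrow> y \<in> W' \<Longrightarrow> x + y \<in> W'" "\<And>x. x \<in> W' \<Longrightarrow> - x \<in> W'"
  shows "generate (add_monoid Q) V \<subseteq> cl ` W'"
proof
  fix x assume "x \<in> generate (add_monoid Q) V"
  thus "x \<in> cl ` W'"
  proof (induction rule: generate.induct)
    case one show ?case using assms(2) by (auto simp: cl_zero)
  next
    case (incl h) thus ?case using assms(1,3) by auto
  next
    case (inv h)
    then obtain a where a: "a \<in> W'" "h = cl a" using assms(1,3) by auto
    show ?case unfolding a(2) cl_minus by (rule imageI[OF assms(5)[OF a(1)]])
  next
    case (eng h1 h2) thus ?case using assms(4) by (auto simp: cl_add)
  qed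
qed

lemma generate_add_closed:
  assumes "x \<in> generate (add_monoid Q) V" "y \<in> generate (add_monoid Q) V"
  shows "x \<oplus>\<^bsub>Q\<^esub> y \<in> generate (add_monoid Q) V"
  using generate.eng[OF assms] by simp

end

section \<open>Gaussian binomial expansions\<close>

definition qb :: "'k::field \<Rightarrow> nat \<Rightarrow> nat \<Rightarrow> 'k" where "qb = quantum_binomial"

context
  fixes v :: "'k::field"
  assumes nroot: "\<And>m. m > 0 \<Longrightarrow> v ^ m \<noteq> 1"
begin

lemma quantum_int_nz: "m > 0 \<Longrightarrow> quantum_int v m \<noteq> 0"
  using nroot[of m] nroot[of 1] by (simp add: quantum_int_def)
lemma quantum_fact_nz: "quantum_fact v m \<noteq> 0"
  by (simp add: quantum_fact_def quantum_int_nz)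
lemma quantum_fact_Suc: "quantum_fact v (Suc n) = quantum_fact v n * quantum_int v (Suc n)"
  by (simp add: quantum_fact_def)
lemma quantum_fact_0 [simp]: "quantum_fact v 0 = 1" by (simp add: quantum_fact_def)

lemma qb_0 [simp]: "qb v n 0 = 1" and qb_n [simp]: "qb v n n = 1"
  using quantum_fact_nz[of n] by (simp_all add: qb_def quantum_binomial_def)

text \<open>With \<open>n = k + d + 1\<close>, the two rules correspond to the two ways of splitting
  \<open>v^(n+1) - 1\<close> along the exponents \<open>d + 1\<close> and
  \<open>k + 1\<close>.\<close>

lemma qb_pascal:
  assumes "k < n"
  shows "qb v (Suc n) (Suc k) = qb v n (Suc k) + v ^ (n - k) * qb v n k"
    and "qb v (Suc n) (Suc k) = v ^ Suc k * qb v n (Suc k) + qb v n k"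
proof -
  obtain d where n: "n = Suc (k + d)" using assms less_iff_Suc_add by auto
  note nz = quantum_fact_nz[of k] quantum_fact_nz[of d] quantum_int_nz[of "Suc k"] quantum_int_nz[of "Suc d"] quantum_fact_nz[of n]
  have s: "n - Suc k = d" "n - k = Suc d" "Suc n - Suc k = Suc d" by (simp_all add: n)
  have a: "qb v (Suc n) (Suc k) = quantum_int v (Suc n) * (quantum_fact v n / (quantum_fact v k * quantum_fact v d * quantum_int v (Suc k) * quantum_int v (Suc d)))"
    by (simp add: qb_def quantum_binomial_def s quantum_fact_Suc mult_ac)
  have b: "qb v n (Suc k) = quantum_int v (Suc d) * (quantum_fact v n / (quantum_fact v k * quantum_fact v d * quantum_int v (Suc k) * quantum_int v (Suc d)))"
    using nz by (simp add: qb_def quantum_binomial_def s quantum_fact_Suc)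
  have c: "qb v n k = quantum_int v (Suc k) * (quantum_fact v n / (quantum_fact v k * quantum_fact v d * quantum_int v (Suc k) * quantum_int v (Suc d)))"
    using nz by (simp add: qb_def quantum_binomial_def s quantum_fact_Suc)
  have "v ^ Suc n - 1 = (v ^ Suc d - 1) + v ^ Suc d * (v ^ Suc k - 1)"
    by (simp add: n power_add algebra_simps)
  hence "quantum_int v (Suc n) = quantum_int v (Suc d) + v ^ Suc d * quantum_int v (Suc k)"
    unfolding quantum_int_def times_divide_eq_right add_divide_distrib[symmetric] by simp
  thus "qb v (Suc n) (Suc k) = qb v n (Suc k) + v ^ (n - k) * qb v n k"
    unfolding a b c s by (simp only: distrib_right mult.assoc)
  have "v ^ Suc n - 1 = v ^ Suc k * (v ^ Suc d - 1) + (v ^ Suc k - 1)"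
    by (simp add: n power_add algebra_simps)
  hence "quantum_int v (Suc n) = v ^ Suc k * quantum_int v (Suc d) + quantum_int v (Suc k)"
    unfolding quantum_int_def times_divide_eq_right add_divide_distrib[symmetric] by simp
  thus "qb v (Suc n) (Suc k) = v ^ Suc k * qb v n (Suc k) + qb v n k"
    unfolding a b c by (simp only: distrib_right mult.assoc)
qed

end

text \<open>With \<open>L\<close> and \<open>R\<close> the left and right multiplication by a letter, this is an iterated
  \<open>v\<close>-commutator; \<open>chain_expand\<close> brings it into the form of the quantum Serre relations.\<close>

primrec chain :: "'k::field \<Rightarrow> 'k \<Rightarrow> (('m::monoid_add \<Rightarrow>\<^sub>0 'k) \<Rightarrow> ('m \<Rightarrow>\<^sub>0 'k)) \<Rightarrow> (('m \<Rightarrow>\<^sub>0 'k) \<Rightarrow> ('m \<Rightarrow>\<^sub>0 'k)) \<Rightarrow> ('m \<Rightarrow>\<^sub>0 'k) \<Rightarrow> nat \<Rightarrow> ('m \<Rightarrow>\<^sub>0 'k)" where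
  "chain v t L R z 0 = z"
| "chain v t L R z (Suc m) = L (chain v t L R z m) - scal (v ^ m * t) * R (chain v t L R z m)"

lemma klin_power: "klin f \<Longrightarrow> klin (f ^^ n)"
  for f :: "('m::monoid_add \<Rightarrow>\<^sub>0 'k::comm_ring_1) \<Rightarrow> ('m \<Rightarrow>\<^sub>0 'k)"
  by (induction n) (auto simp: klin_def)

lemma triangle_Suc: "Suc k * (Suc k - 1) div 2 = k * (k - 1) div 2 + k"
proof -
  have "Suc k * (Suc k - 1) = k * (k - 1) + 2 * k" by (cases k) (simp_all add: algebra_simps)
  thus ?thesis by simp
qed

definition gauss_coeff :: "'k::field \<Rightarrow> 'k \<Rightarrow> nat \<Rightarrow> nat \<Rightarrow> 'k" where
  "gauss_coeff v t n k = (- 1) ^ k * qb v n k * v ^ (k * (k - 1) div 2) * t ^ k"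

text \<open>The q-binomial theorem for the product of the commuting operators
  \<open>L - v^m t R\<close> with \<open>m < n\<close>.\<close>

lemma chain_expand:
  fixes L R :: "('m::monoid_add \<Rightarrow>\<^sub>0 'k::field) \<Rightarrow> ('m \<Rightarrow>\<^sub>0 'k)"
  assumes nroot: "\<And>m. m > 0 \<Longrightarrow> v ^ m \<noteq> 1" and L: "klin L" and R: "klin R" and LR: "\<And>x. R (L x) = L (R x)"
  shows "chain v t L R z n = (\<Sum>k\<le>n. scal (gauss_coeff v t n k) * (L ^^ (n - k)) ((R ^^ k) z))"
proof (induction n)
  case 0 show ?case by (simp add: gauss_coeff_def qb_0[OF nroot])
next
  case (Suc n)
  let ?T = "\<lambda>n k. (L ^^ (n - k)) ((R ^^ k) z)"
  have RL: "R ((L ^^ m) x) = (L ^^ m) (R x)" for m x by (induction m) (simp_all add: LR)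
  have c0: "gauss_coeff v t m 0 = 1" for m by (simp add: gauss_coeff_def qb_0[OF nroot])
  have cS: "gauss_coeff v t (Suc n) (Suc k) = gauss_coeff v t n (Suc k) - v ^ n * t * gauss_coeff v t n k" if "k < n" for k
  proof -
    have e: "v ^ n = v ^ (n - k) * v ^ k" using that by (simp add: power_add[symmetric])
    have P: "qb v (Suc n) (Suc k) = qb v n (Suc k) + v ^ (n - k) * qb v n k"
      by (rule qb_pascal(1)[OF nroot that])
    show ?thesis
      unfolding gauss_coeff_def triangle_Suc P unfolding e
      by (simp add: power_add algebra_simps)
  qed
  have cn: "gauss_coeff v t (Suc n) (Suc n) = - (v ^ n * t * gauss_coeff v t n n)"
    unfolding gauss_coeff_def triangle_Suc by (simp add: qb_n[OF nroot] power_add algebra_simps)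
  have "L (\<Sum>k\<le>n. scal (gauss_coeff v t n k) * ?T n k) = (\<Sum>k\<le>n. scal (gauss_coeff v t n k) * ?T (Suc n) k)"
    by (simp add: klin_sum[OF L] klin_scal[OF L] Suc_diff_le)
  also have "\<dots> = ?T (Suc n) 0 + (\<Sum>k<n. scal (gauss_coeff v t n (Suc k)) * ?T (Suc n) (Suc k))"
    by (simp only: lessThan_Suc_atMost[symmetric] sum.lessThan_Suc_shift c0 scal_1 mult_1)
  finally have 1: "L (\<Sum>k\<le>n. scal (gauss_coeff v t n k) * ?T n k) = \<dots>" .
  have "scal (v ^ n * t) * R (\<Sum>k\<le>n. scal (gauss_coeff v t n k) * ?T n k)
      = (\<Sum>k\<le>n. scal (v ^ n * t * gauss_coeff v t n k) * ?T (Suc n) (Suc k))"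
    by (simp add: klin_sum[OF R] klin_scal[OF R] RL sum_distrib_left scal_scal)
  also have "\<dots> = (\<Sum>k<n. scal (v ^ n * t * gauss_coeff v t n k) * ?T (Suc n) (Suc k)) + scal (v ^ n * t * gauss_coeff v t n n) * ?T (Suc n) (Suc n)"
    by (simp only: lessThan_Suc_atMost[symmetric] sum.lessThan_Suc)
  finally have 2: "scal (v ^ n * t) * R (\<Sum>k\<le>n. scal (gauss_coeff v t n k) * ?T n k) = \<dots>" .
  have "(\<Sum>k\<le>Suc n. scal (gauss_coeff v t (Suc n) k) * ?T (Suc n) k)
      = ?T (Suc n) 0 + ((\<Sum>k<n. scal (gauss_coeff v t (Suc n) (Suc k)) * ?T (Suc n) (Suc k)) + scal (gauss_coeff v t (Suc n) (Suc n)) * ?T (Suc n) (Suc n))"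
    by (subst lessThan_Suc_atMost[symmetric], subst sum.lessThan_Suc_shift, simp only: sum.lessThan_Suc c0 scal_1 mult_1)
  also have "(\<Sum>k<n. scal (gauss_coeff v t (Suc n) (Suc k)) * ?T (Suc n) (Suc k))
      = (\<Sum>k<n. scal (gauss_coeff v t n (Suc k)) * ?T (Suc n) (Suc k)) - (\<Sum>k<n. scal (v ^ n * t * gauss_coeff v t n k) * ?T (Suc n) (Suc k))"
    unfolding sum_subtractf[symmetric]
    by (rule sum.cong[OF refl]) (simp add: cS scal_diff left_diff_distrib)
  finally show ?case
    unfolding chain.simps Suc 1 2 cn by (simp add: scal_minus)
qed

lemma chain_hom:
  assumes "klin f" "\<And>x. f (L x) = L' (f x)" "\<And>x. f (R x) = R' (f x)"
  shows "f (chain v t L R z n) = chain v t L' R' (f z) n"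
  by (induction n) (simp_all add: klin_diff[OF assms(1)] klin_scal[OF assms(1)] assms(2,3))

lemma funpow_mult_left: "((\<lambda>x. a * x) ^^ n) x = a ^ n * (x :: 'r::monoid_mult)"
  by (induction n) (simp_all add: mult.assoc)
lemma funpow_mult_right: "((\<lambda>x. x * a) ^^ n) x = (x :: 'r::monoid_mult) * a ^ n"
  by (induction n) (simp_all add: mult.assoc power_commutes)

section \<open>The action on the free algebra\<close>

lemma opx_mult: assumes "\<And>k. klin (f k)" shows "opx f (u * v) y = opx f u (opx f v y)"
proof (induction u rule: free_algebra_induct)
  case (mono c l)
  have "opx f (mono l * v) y = opx f (mono l) (opx f v y)"
  proof (induction l)
    case (Cons j l)
    thus ?case by (simp add: mono_Cons[of j l] mult.assoc opx_Cons[OF assms])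
  qed (use opx_mono[of f "[]"] in simp)
  thus ?case by (simp add: mult.assoc opx_simps)
qed (simp add: distrib_right opx_simps)

lemma opx_one: "opx f 1 y = y" using opx_mono[of f "[]"] by simp
lemma opx_scal: "opx f (scal c) y = scal c * y"
proof -
  have "opx f (scal c * 1) y = scal c * opx f 1 y" by (simp only: opx_simps)
  thus ?thesis by (simp add: opx_one)
qed
lemma opx_var: "opx f (var i) y = f i y" by (simp add: var_eq_mono)

definition twist :: "('i multiset \<Rightarrow> 'k) \<Rightarrow> ('i, 'k::comm_ring_1) free_algebra \<Rightarrow> ('i, 'k) free_algebra" where
  "twist g = lext (\<lambda>w. scal (g (mset w)) * mono w)"

lemma klin_twist [intro!]: "klin (twist g)" by (auto simp: twist_def)
lemma twist_homog: "homog \<gamma> x \<Longrightarrow> twist g x = scal (g \<gamma>) * x"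
  by (rule klin_eq_homog[where f = "twist g" and g = "\<lambda>x. scal (g \<gamma>) * x"])
    (auto intro!: klin_mult_left klin_id simp: twist_def)

text \<open>The Serre relations between the \<open>f\<^sub>i\<close> are those between the \<open>e\<^sub>i\<close> read backwards.\<close>

definition rv :: "('i, 'k::comm_ring_1) free_algebra \<Rightarrow> ('i, 'k) free_algebra" where
  "rv = lext (\<lambda>w. mono (rev w))"

lemma klin_rv [intro!]: "klin rv" by (auto simp: rv_def)
lemma rv_mono: "rv (mono w) = mono (rev w)" by (simp add: rv_def)
lemma rv_one [simp]: "rv 1 = 1" using rv_mono[of "[]"] by simp
lemma rv_gen_left: "rv (mono [i] * x) = rv x * mono [i]"
  by (rule klin_eq[where f = "\<lambda>x. rv (mono [i] * x)" and g = "\<lambda>x. rv x * mono [i]"])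
    (auto intro!: klin_comp[OF klin_rv] klin_mult_left klin_mult_right klin_id simp: mono_append[symmetric] rv_mono)
lemma rv_gen_right: "rv (x * mono [i]) = mono [i] * rv x"
  by (rule klin_eq[where f = "\<lambda>x. rv (x * mono [i])" and g = "\<lambda>x. mono [i] * rv x"])
    (auto intro!: klin_comp[OF klin_rv] klin_mult_left klin_mult_right klin_id simp: mono_append[symmetric] rv_mono)

text \<open>Reversal exchanges the two ends of a word, and the letters that the removed one has to
  pass now stand on its other side, which transposes the parameters.\<close>

lemma rv_dR: "rv (dR p k x) = dL (swap_param p) k (rv x)"
proof (rule klin_eq[where f = "\<lambda>x. rv (dR p k x)" and g = "\<lambda>x. dL (swap_param p) k (rv x)"])
  show "klin (\<lambda>x. rv (dR p k x))" by (rule klin_comp[OF klin_rv klin_dR])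
  show "klin (\<lambda>x. dL (swap_param p) k (rv x))" by (rule klin_comp[OF klin_dL klin_rv])
  fix l show "rv (dR p k (mono l)) = dL (swap_param p) k (rv (mono l))"
  proof (induction l)
    case (Cons j l)
    thus ?case
      by (simp add: mono_Cons[of j l] dR_Cons[of "mset l"] homog_mono klin_simps[OF klin_rv] rv_gen_left
          dL_snoc[of "mset l"] chi_swap_param rv_mono)
  qed (simp add: klin_zero[OF klin_rv])
qed

definition embE :: "('i, 'k::comm_ring_1) free_algebra \<Rightarrow> ('i gen, 'k) free_algebra" where
  "embE = free_extend (\<lambda>i. fE i)"
definition embF :: "('i, 'k::comm_ring_1) free_algebra \<Rightarrow> ('i gen, 'k) free_algebra" where
  "embF = free_extend (\<lambda>i. fF i)"

lemma prod_list_var: "prod_list (map (\<lambda>i. var (f i)) l) = mono (map f l)"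
  by (induction l) (auto simp: var_eq_mono mono_append[symmetric])
lemma embE_mono: "embE (mono l) = mono (map GenE l)"
  by (simp add: embE_def free_extend_mono prod_list_var)
lemma embF_mono: "embF (mono l) = mono (map GenF l)"
  by (simp add: embF_def free_extend_mono prod_list_var)
lemma klin_embE [intro!]: "klin embE" by (simp add: embE_def klin_free_extend)
lemma klin_embF [intro!]: "klin embF" by (simp add: embF_def klin_free_extend)
lemmas embE_simps = klin_simps[OF klin_embE]
lemma embE_mult: "embE (x * y) = embE x * embE y" by (simp add: embE_def free_extend_mult)
lemma embF_mult: "embF (x * y) = embF x * embF y" by (simp add: embF_def free_extend_mult)
lemma embE_one [simp]: "embE 1 = 1" using embE_mono[of "[]"] by simp
lemma embE_gen: "embE (mono [i]) = fE i" by (simp add: embE_mono var_eq_mono)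
lemma embF_gen: "embF (mono [i]) = fF i" by (simp add: embF_mono var_eq_mono)
lemma embE_scal: "embE (scal c) = scal c" using klin_scal[OF klin_embE, of c 1] by simp

context quantum_group
begin

lemma serre_chain: "serre i j = chain (q i i) (q i j) (\<lambda>x. mono [i] * x) (\<lambda>x. x * mono [i]) (mono [j]) (nat (1 - A i j))"
proof -
  have "(ad q i ^^ n) (mono [j]) = chain (q i i) (q i j) (\<lambda>x. mono [i] * x) (\<lambda>x. x * mono [i]) (mono [j]) n" for n
  proof (induction n)
    case (Suc n)
    have "homog ({#j#} + replicate_mset n i) ((ad q i ^^ n) (mono [j]))" by (rule homog_ad_power) simp
    from ad_homog[OF this, of q i] show ?case
      by (simp add: Suc chi_add_mset_right[of q _ j "replicate_mset n i"] chi_replicate mult.commute)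
  qed simp
  thus ?thesis by (simp add: serre_def)
qed

lemma klin_left: "klin (\<lambda>x. a * x)" and klin_right: "klin (\<lambda>x. x * a)"
  by (rule klin_mult_left[OF klin_id], rule klin_mult_right[OF klin_id])

lemma serre_e_chain: "serre_e A q i j = chain (q i i) (q i j) (\<lambda>x. fE i * x) (\<lambda>x. x * fE i) (fE j) (nat (1 - A i j))"
  by (subst chain_expand[OF root klin_left klin_right])
    (simp_all add: serre_e_def Let_def atMost_atLeast0 gauss_coeff_def qb_def funpow_mult_left funpow_mult_right mult.assoc)

lemma serre_f_chain: "serre_f A q i j = chain (q i i) (q i j) (\<lambda>x. x * fF i) (\<lambda>x. fF i * x) (fF j) (nat (1 - A i j))"
  by (subst chain_expand[OF root klin_right klin_left])
    (simp_all add: serre_f_def Let_def atMost_atLeast0 gauss_coeff_def qb_def funpow_mult_left funpow_mult_right mult.assoc)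

lemma embE_serre: "embE (serre i j) = serre_e A q i j"
  unfolding serre_chain serre_e_chain
  by (subst chain_hom[OF klin_embE]) (simp_all add: embE_mult embE_gen)

lemma embF_serre: "embF (rv (serre i j)) = serre_f A q i j"
  unfolding serre_chain serre_f_chain
  by (subst chain_hom[OF klin_comp[OF klin_embF klin_rv]])
    (simp_all add: embF_mult embF_gen rv_gen_left rv_gen_right rv_mono)

abbreviation "J \<equiv> Uq_ideal A q"

lemma fideal_J: "fideal J" unfolding Uq_ideal_def by (rule fideal_Idl)
lemma relator_J: "r \<in> Uq_relators A q \<Longrightarrow> r \<in> J" unfolding Uq_ideal_def by (rule Idl_self)

text \<open>The Verma module of weight zero on the free algebra: each toral generator acts on degree
  \<gamma> by a value of the bicharacter, and \<open>Phi\<close> is rescaled by the constant of the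
  relation between e_i and f_i.\<close>

fun gact :: "'i gen \<Rightarrow> ('i, 'k) free_algebra \<Rightarrow> ('i, 'k) free_algebra" where
  "gact (GenE i) = (\<lambda>x. mono [i] * x)"
| "gact (GenF i) = (\<lambda>x. scal (q i i / (q i i - 1)) * Phi q i x)"
| "gact (GenOmega i) = twist (\<lambda>\<gamma>. chi q {#i#} \<gamma>)"
| "gact (GenOmegaInv i) = twist (\<lambda>\<gamma>. inverse (chi q {#i#} \<gamma>))"
| "gact (GenOmega' i) = twist (\<lambda>\<gamma>. inverse (chi q \<gamma> {#i#}))"
| "gact (GenOmegaInv' i) = twist (\<lambda>\<gamma>. chi q \<gamma> {#i#})"

lemma klin_gact: "klin (gact g)"
  by (cases g) (auto intro!: klin_mult_left klin_id klin_Phi klin_twist)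

abbreviation "U \<equiv> opx gact"
lemmas U_mult = opx_mult[OF klin_gact]
lemmas U_right = klin_simps[OF klin_opx2[OF klin_gact]]
lemmas U_left = opx_simps[where f = gact]

lemma S_gact: "x \<in> S \<Longrightarrow> gact g x \<in> S"
proof -
  have tw: "twist g x \<in> S" if "x \<in> S" for g x
  proof (rule S_klin[OF klin_twist _ that])
    show "i \<noteq> j \<Longrightarrow> twist g (mono u * serre i j * mono v) \<in> S" for i j u v
      unfolding twist_homog[OF homog_usv] by (intro S_scal S_right S_left serre_S)
  qed
  show "x \<in> S \<Longrightarrow> gact g x \<in> S"
    by (cases g) (auto intro: tw S_left S_scal S_Phi)
qed

lemma S_U: "x \<in> S \<Longrightarrow> U a x \<in> S"
proof (induction a rule: free_algebra_induct)
  case (add a b) thus ?case by (simp add: U_left S_add)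
next
  case (mono c l)
  have "foldr gact l x \<in> S" using mono by (induction l) (simp_all add: S_gact)
  thus ?case by (simp add: U_left S_scal)
qed

lemma U_embE: "U (embE a) x = a * x"
proof (induction a rule: free_algebra_induct)
  case (mono c l)
  have "foldr gact (map GenE l) x = mono l * x"
  proof (induction l)
    case (Cons j l) thus ?case by (simp add: mono_Cons[of j l] mult.assoc)
  qed simp
  thus ?case by (simp add: embE_simps U_left embE_mono mult.assoc)
qed (simp add: embE_simps U_left distrib_right)

lemma U_embF: "homog \<nu> u \<Longrightarrow> U (embF u) x = scal (\<Prod>j\<in>#\<nu>. q j j / (q j j - 1)) * opx (Phi q) u x"
proof (induction rule: homog_induct)
  case zero show ?case by (simp add: klin_simps[OF klin_embF] U_left opx_simps)
next
  case (add u v) thus ?case by (simp add: klin_simps[OF klin_embF] U_left opx_simps distrib_left)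
next
  case (mono c l)
  have "foldr gact (map GenF l) x = scal (\<Prod>j\<in>#mset l. q j j / (q j j - 1)) * foldr (Phi q) l x"
    by (induction l) (simp_all add: Phi_simps scal_scal mult.commute)
  thus ?case by (simp add: klin_simps[OF klin_embF] U_left opx_simps embF_mono mono scal_scal mult.commute)
qed

text \<open>Peeling the first letter off \<open>y\<close> applies \<open>dL\<close> with transposed
  parameters to the reversed Serre element. This is the reversal of \<open>dR\<close> applied to the
  Serre element itself, which is 0.\<close>

lemma bil_rv_serre: assumes "i \<noteq> j" shows "bil q (rv (serre i j)) y = 0"
proof -
  let ?u = "rv (serre i j)"
  have hu: "homog (add_mset j (replicate_mset (nat (1 - A i j)) i)) ?u"
    by (rule homog_klin[OF klin_rv homog_serre]) (simp add: rv_mono homog_mono)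
  have d: "dL (swap_param q) k ?u = 0" for k
    by (simp add: rv_dR[symmetric] dR_serre[OF assms] klin_zero[OF klin_rv])
  have "bil q ?u (mono l) = 0" for l
  proof (cases l)
    case Nil
    have "bil q u 1 = 0" if "homog \<nu> u" "\<nu> \<noteq> {#}" for u \<nu>
      using that(1)
    proof (induction rule: homog_induct)
      case (mono c w)
      have "pair q w 1 = 0" by (rule pair_degree[of "{#}"]) (use mono that(2) in auto)
      thus ?case by (simp add: bil_left bil_mono)
    qed (simp_all add: bil_left)
    from this[OF hu] show ?thesis by (simp add: Nil)
  next
    case (Cons k l') thus ?thesis
      by (simp add: mono_Cons[of k l'] bil_gen_mult d bil_left)
  qed
  thus ?thesis by (induction y rule: free_algebra_induct) (simp_all add: bil_right)
qed

text \<open>Elements in the left radical of the pairing act by zero because of the coaction. The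
  relation therefore holds on the free algebra itself and not only modulo \<open>S\<close>.\<close>

lemma U_serre_f: assumes "i \<noteq> j" shows "U (serre_f A q i j) x = 0"
proof -
  have hu: "homog (add_mset j (replicate_mset (nat (1 - A i j)) i)) (rv (serre i j))"
    by (rule homog_klin[OF klin_rv homog_serre]) (simp add: rv_mono homog_mono)
  obtain ps where "coact q (add_mset j (replicate_mset (nat (1 - A i j)) i)) x ps"
    using coact_exists[of q _ x, OF q_nz] by blast
  from this[unfolded coact_def, rule_format, OF hu]
  have "opx (Phi q) (rv (serre i j)) x = 0" by (simp add: bil_rv_serre[OF assms] split_def)
  thus ?thesis by (simp add: embF_serre[symmetric] U_embF[OF hu])
qed

lemma U_monoI: "(\<And>l. U r (mono l) \<in> S) \<Longrightarrow> U r x \<in> S"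
  by (induction x rule: free_algebra_induct) (simp_all add: U_right S_add S_scal)

text \<open>All relators except \<open>serre_e\<close> act by zero on the free algebra; the passage
  to the quotient by \<open>S\<close> is made for those alone.\<close>

lemma U_relator: assumes "r \<in> Uq_relators A q" shows "U r x \<in> S"
proof (rule U_monoI)
  fix l :: "'i list"
  let ?x = "mono l :: ('i, 'k) free_algebra"
  have h: "homog (mset l) ?x" by (simp add: homog_mono)
  have hE: "homog (add_mset i (mset l)) (mono [i] * ?x)" for i
    using homog_mult[of "{#i#}" "mono [i]", OF _ h] by simp
  have hF: "homog (mset l - {#i#}) (Phi q i ?x)" for i by (rule homog_Phi[OF h])
  \<comment> \<open>If \<open>Phi q j\<close> does not kill the word, then \<open>j\<close> occurs
    in it, and the difference \<open>mset l - {#j#}\<close> is not truncated.\<close>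
  have chiF: "chi q {#i#} (mset l) = q i j * chi q {#i#} (mset l - {#j#})
      \<and> chi q (mset l) {#i#} = q j i * chi q (mset l - {#j#}) {#i#}" if "Phi q j ?x \<noteq> 0" for i j
  proof -
    have "j \<in># mset l" using Phi_0[OF h] that by blast
    thus ?thesis using chi_add_mset_right[of q "{#i#}" j "mset l - {#j#}"] chi_add_mset_left[of q j "mset l - {#j#}" "{#i#}"]
      by simp
  qed
  have eq0: "a = b \<Longrightarrow> scal a * y - scal b * y = 0" for a b and y :: "('i, 'k) free_algebra" by simp
  have tor: "\<exists>c. \<forall>y. homog (mset l) y \<longrightarrow> U s y = scal c * y" if "s \<in> toral" for s
    using that by (auto simp: toral_def opx_var twist_homog)
  note sm = U_left U_mult opx_var opx_one opx_scal U_right twist_homog[OF h] twist_homog[OF hE] twist_homog[OF hF]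
  from assms consider
      (tor) s t where "s \<in> toral" "t \<in> toral" "r = s * t - t * s"
    | (inv) i where "r = fOm i * fOmInv i - 1 \<or> r = fOm' i * fOmInv' i - 1"
    | (oe) i j where "r = fOm i * fE j * fOmInv i - scal (q i j) * fE j"
    | (o'e) i j where "r = fOm' i * fE j * fOmInv' i - scal (inverse (q j i)) * fE j"
    | (of) i j where "r = fOm i * fF j * fOmInv i - scal (inverse (q i j)) * fF j"
    | (o'f) i j where "r = fOm' i * fF j * fOmInv' i - scal (q j i) * fF j"
    | (ef) i j where "r = fE i * fF j - fF j * fE i
               - (if i = j then scal (q i i / (q i i - 1)) * (fOm i - fOm' i) else 0)"
    | (se) i j where "i \<noteq> j" "r = serre_e A q i j"
    | (sf) i j where "i \<noteq> j" "r = serre_f A q i j"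
    unfolding Uq_relators_def by blast
  thus "U r ?x \<in> S"
  proof cases
    case tor
    obtain c d where "\<And>y. homog (mset l) y \<Longrightarrow> U s y = scal c * y" "\<And>y. homog (mset l) y \<Longrightarrow> U t y = scal d * y"
      using tor(1,2)[THEN \<open>\<And>s. s \<in> toral \<Longrightarrow> \<exists>c. \<forall>y. homog (mset l) y \<longrightarrow> U s y = scal c * y\<close>] by blast
    hence "U r ?x = 0" by (simp add: tor(3) U_left U_mult h homog_scal scal_scal mult.commute)
    thus ?thesis by (simp add: S.zero)
  next
    case inv
    hence "U r ?x = 0" using chi_nz by (auto simp: sm scal_scal)
    thus ?thesis by (simp add: S.zero)
  next
    case oe
    have "U r ?x = scal (chi q {#i#} (add_mset j (mset l)) * inverse (chi q {#i#} (mset l))) * (mono [j] * ?x)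
        - scal (q i j) * (mono [j] * ?x)"
      by (simp add: oe sm scal_scal mult_scal_gen mult.commute)
    also have "\<dots> = 0"
      by (rule eq0) (simp add: chi_add_mset_right[of q _ j "mset l"] chi_nz)
    finally show ?thesis by (simp add: S.zero)
  next
    case o'e
    have "U r ?x = scal (inverse (chi q (add_mset j (mset l)) {#i#}) * chi q (mset l) {#i#}) * (mono [j] * ?x)
        - scal (inverse (q j i)) * (mono [j] * ?x)"
      by (simp add: o'e sm scal_scal mult_scal_gen mult.commute)
    also have "\<dots> = 0"
      by (rule eq0) (simp add: chi_add_mset_left[of q j "mset l"] chi_nz)
    finally show ?thesis by (simp add: S.zero)
  next
    case of
    let ?c = "q j j / (q j j - 1)"
    have "U r ?x = scal (chi q {#i#} (mset l - {#j#}) * inverse (chi q {#i#} (mset l)) * ?c) * Phi q j ?x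
        - scal (inverse (q i j) * ?c) * Phi q j ?x"
      by (simp add: of sm scal_scal Phi_simps mult_ac)
    also have "\<dots> = 0"
    proof (cases "Phi q j ?x = 0")
      case False
      show ?thesis using chiF[OF False, of i] by (intro eq0) (simp add: chi_nz)
    qed simp
    finally show ?thesis by (simp add: S.zero)
  next
    case o'f
    let ?c = "q j j / (q j j - 1)"
    have "U r ?x = scal (inverse (chi q (mset l - {#j#}) {#i#}) * chi q (mset l) {#i#} * ?c) * Phi q j ?x
        - scal (q j i * ?c) * Phi q j ?x"
      by (simp add: o'f sm scal_scal Phi_simps mult_ac)
    also have "\<dots> = 0"
    proof (cases "Phi q j ?x = 0")
      case False
      show ?thesis using chiF[OF False, of i] by (intro eq0) (simp add: chi_nz)
    qed simp
    finally show ?thesis by (simp add: S.zero)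
  next
    case ef
    have "U r ?x = 0"
      by (cases "i = j") (simp_all add: ef sm mult_scal_gen Phi_Cons[OF h] scal_scal algebra_simps scal_diff)
    thus ?thesis by (simp add: S.zero)
  next
    case se
    thus ?thesis by (simp add: embE_serre[symmetric] U_embE S_right serre_S)
  next
    case sf
    thus ?thesis by (simp add: U_serre_f S.zero)
  qed
qed

lemma U_J: "a \<in> J \<Longrightarrow> U a x \<in> S"
proof -
  have "fideal {a. \<forall>x. U a x \<in> S}"
    by (auto simp: fideal_def U_left U_mult S.zero intro: S_add S_U)
  hence "J \<subseteq> {a. \<forall>x. U a x \<in> S}"
    unfolding Uq_ideal_def by (rule Idl_minimal) (use U_relator in auto)
  thus "a \<in> J \<Longrightarrow> U a x \<in> S" by blast
qed

lemma embE_J_iff: "embE a \<in> J \<longleftrightarrow> a \<in> S"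
proof
  assume "embE a \<in> J"
  from U_J[OF this, of 1] show "a \<in> S" by (simp add: U_embE)
next
  assume "a \<in> S"
  thus "embE a \<in> J"
  proof (induction rule: S.induct)
    case (gen i j c u v)
    have "serre_e A q i j \<in> J" by (rule relator_J) (use gen in \<open>auto simp: Uq_relators_def\<close>)
    thus ?case by (simp add: embE_simps embE_mult embE_serre fideal_left[OF fideal_J] fideal_right[OF fideal_J])
  qed (simp_all add: embE_simps fideal_0[OF fideal_J] fideal_add[OF fideal_J])
qed

end

section \<open>Congruences\<close>

definition cg :: "'r::ring_1 set \<Rightarrow> 'r \<Rightarrow> 'r \<Rightarrow> bool" where
  "cg T a b \<longleftrightarrow> a - b \<in> T"

lemma cg_refl: "fideal T \<Longrightarrow> cg T a a" by (simp add: cg_def fideal_0)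
lemma cg_sym: "fideal T \<Longrightarrow> cg T a b \<Longrightarrow> cg T b a"
  using fideal_uminus[of T "a - b"] by (simp add: cg_def)
lemma cg_trans: "fideal T \<Longrightarrow> cg T a b \<Longrightarrow> cg T b c \<Longrightarrow> cg T a c"
  using fideal_add[of T "a - b" "b - c"] by (simp add: cg_def)
lemma cg_add: "fideal T \<Longrightarrow> cg T a b \<Longrightarrow> cg T c d \<Longrightarrow> cg T (a + c) (b + d)"
  using fideal_add[of T "a - b" "c - d"] by (simp add: cg_def algebra_simps)
lemma cg_diff: "fideal T \<Longrightarrow> cg T a b \<Longrightarrow> cg T c d \<Longrightarrow> cg T (a - c) (b - d)"
  using fideal_diff[of T "a - b" "c - d"] by (simp add: cg_def algebra_simps)
lemma cg_left: "fideal T \<Longrightarrow> cg T a b \<Longrightarrow> cg T (c * a) (c * b)"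
  using fideal_left[of T "a - b" c] by (simp add: cg_def right_diff_distrib)
lemma cg_right: "fideal T \<Longrightarrow> cg T a b \<Longrightarrow> cg T (a * c) (b * c)"
  using fideal_right[of T "a - b" c] by (simp add: cg_def left_diff_distrib)
lemma cg_sum: "fideal T \<Longrightarrow> (\<And>k. k \<in> K \<Longrightarrow> cg T (f k) (g k)) \<Longrightarrow> cg T (sum f K) (sum g K)"
  by (simp add: cg_def sum_subtractf[symmetric] fideal_sum)
lemma cg_mem: "fideal T \<Longrightarrow> cg T a b \<Longrightarrow> b \<in> T \<Longrightarrow> a \<in> T"
  using fideal_add[of T "a - b" b] by (simp add: cg_def)

section \<open>Coproducts of quantum Serre elements\<close>

lemma klin_chain:
  assumes "klin L" "klin R"
  shows "klin (\<lambda>z. chain v t L R z n)"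
proof (induction n)
  case (Suc n)
  show ?case using klin_minus[OF klin_comp[OF assms(1) Suc] klin_mult_left[OF klin_comp[OF assms(2) Suc], of "scal (v ^ n * t)"]]
    by simp
qed (simp add: klin_id)

lemma sum_shift_combine:
  assumes "\<gamma> 0 = \<alpha> 0" "\<And>k. k < m \<Longrightarrow> \<gamma> (Suc k) = \<alpha> (Suc k) + \<beta> k" "\<gamma> (Suc m) = \<beta> m"
  shows "(\<Sum>k\<le>m. scal (\<alpha> k) * Z k) + (\<Sum>k\<le>m. scal (\<beta> k) * Z (Suc k))
    = (\<Sum>k\<le>Suc m. scal (\<gamma> k) * (Z k :: 'm::monoid_add \<Rightarrow>\<^sub>0 'k::comm_ring_1))"
proof -
  have "(\<Sum>k\<le>m. scal (\<alpha> k) * Z k) = scal (\<gamma> 0) * Z 0 + (\<Sum>k<m. scal (\<alpha> (Suc k)) * Z (Suc k))"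
    by (simp only: lessThan_Suc_atMost[symmetric] sum.lessThan_Suc_shift assms(1))
  moreover have "(\<Sum>k\<le>m. scal (\<beta> k) * Z (Suc k)) = (\<Sum>k<m. scal (\<beta> k) * Z (Suc k)) + scal (\<gamma> (Suc m)) * Z (Suc m)"
    by (simp only: lessThan_Suc_atMost[symmetric] sum.lessThan_Suc assms(3))
  moreover have "(\<Sum>k\<le>Suc m. scal (\<gamma> k) * Z k) = scal (\<gamma> 0) * Z 0 + ((\<Sum>k<m. scal (\<gamma> (Suc k)) * Z (Suc k)) + scal (\<gamma> (Suc m)) * Z (Suc m))"
    by (subst lessThan_Suc_atMost[symmetric], subst sum.lessThan_Suc_shift, simp only: sum.lessThan_Suc)
  moreover have "(\<Sum>k<m. scal (\<gamma> (Suc k)) * Z (Suc k)) = (\<Sum>k<m. scal (\<alpha> (Suc k)) * Z (Suc k)) + (\<Sum>k<m. scal (\<beta> k) * Z (Suc k))"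
    by (simp add: assms(2) scal_add distrib_right sum.distrib)
  ultimately show ?thesis by (simp add: add_ac)
qed

text \<open>The coefficients that arise in \<open>chain_coproduct\<close> when the chain starts at
  \<open>h\<close>. For \<open>v^r s = 1\<close> and \<open>m = r + 1\<close>, all of them with
  \<open>k < m\<close> contain a zero factor.\<close>

definition coprod_coeff :: "'k::field \<Rightarrow> 'k \<Rightarrow> nat \<Rightarrow> nat \<Rightarrow> 'k" where
  "coprod_coeff v s m k = qb v m k * (\<Prod>r\<in>{k..<m}. 1 - v ^ r * s)"

lemma coprod_coeff_Suc:
  assumes nroot: "\<And>m. m > 0 \<Longrightarrow> v ^ m \<noteq> (1::'k::field)"
  shows "coprod_coeff v s (Suc m) 0 = (1 - v ^ m * s) * coprod_coeff v s m 0"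
    and "k < m \<Longrightarrow> coprod_coeff v s (Suc m) (Suc k)
      = (1 - v ^ (m + Suc k) * s) * coprod_coeff v s m (Suc k) + v ^ (m - k) * coprod_coeff v s m k"
    and "coprod_coeff v s m m = 1"
proof -
  show "coprod_coeff v s (Suc m) 0 = (1 - v ^ m * s) * coprod_coeff v s m 0"
    by (simp add: coprod_coeff_def qb_0[OF nroot])
  show "coprod_coeff v s m m = 1" by (simp add: coprod_coeff_def qb_n[OF nroot])
  assume k: "k < m"
  let ?P = "\<Prod>r\<in>{Suc k..<m}. 1 - v ^ r * s"
  have P1: "(\<Prod>r\<in>{Suc k..<Suc m}. 1 - v ^ r * s) = ?P * (1 - v ^ m * s)"
    using k by simp
  have P2: "(\<Prod>r\<in>{k..<m}. 1 - v ^ r * s) = (1 - v ^ k * s) * ?P"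
    by (rule prod.atLeast_Suc_lessThan[OF k])
  have p1: "qb v (Suc m) (Suc k) = qb v m (Suc k) + v ^ (m - k) * qb v m k" by (rule qb_pascal(1)[OF nroot k])
  have p2: "qb v (Suc m) (Suc k) = v ^ Suc k * qb v m (Suc k) + qb v m k" by (rule qb_pascal(2)[OF nroot k])
  have e: "v ^ (m - k) * v ^ k = v ^ m" using k by (simp add: power_add[symmetric])
  \<comment> \<open>The part without \<open>s\<close> is expanded by the first Pascal rule and the
    part with \<open>s\<close> by the second; the product \<open>?P\<close> can be split off only
    with this mixture.\<close>
  have "qb v (Suc m) (Suc k) * (1 - v ^ m * s) = qb v (Suc m) (Suc k) - v ^ m * s * qb v (Suc m) (Suc k)"
    by (simp add: algebra_simps)
  also have "\<dots> = (qb v m (Suc k) + v ^ (m - k) * qb v m k) - v ^ m * s * (v ^ Suc k * qb v m (Suc k) + qb v m k)"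
    using p1 p2 by metis
  also have "\<dots> = (1 - v ^ (m + Suc k) * s) * qb v m (Suc k) + (v ^ (m - k) - (v ^ (m - k) * v ^ k) * s) * qb v m k"
    unfolding e by (simp add: power_add algebra_simps)
  also have "\<dots> = (1 - v ^ (m + Suc k) * s) * qb v m (Suc k) + v ^ (m - k) * (1 - v ^ k * s) * qb v m k"
    by (simp only: right_diff_distrib mult_1_right mult.assoc)
  finally have q: "qb v (Suc m) (Suc k) * (1 - v ^ m * s) = \<dots>" .
  have "coprod_coeff v s (Suc m) (Suc k) = (qb v (Suc m) (Suc k) * (1 - v ^ m * s)) * ?P"
    unfolding coprod_coeff_def P1 by (simp only: mult_ac)
  also have "\<dots> = (1 - v ^ (m + Suc k) * s) * (qb v m (Suc k) * ?P) + v ^ (m - k) * (qb v m k * ((1 - v ^ k * s) * ?P))"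
    unfolding q by (simp only: distrib_left distrib_right mult_ac)
  finally show "coprod_coeff v s (Suc m) (Suc k)
      = (1 - v ^ (m + Suc k) * s) * coprod_coeff v s m (Suc k) + v ^ (m - k) * coprod_coeff v s m k"
    unfolding coprod_coeff_def P2 .
qed

text \<open>The multiplication operators are kept abstract because the Serre elements in the \<open>f\<^sub>i\<close> arise
  with left and right exchanged.\<close>

lemma chain_coproduct:
  fixes la lb ra rb :: "('m::monoid_add \<Rightarrow>\<^sub>0 'k::field) \<Rightarrow> ('m \<Rightarrow>\<^sub>0 'k)"
  assumes T: "fideal T"
    and k: "klin la" "klin lb" "klin ra" "klin rb"
    and c: "\<And>x y. cg T x y \<Longrightarrow> cg T (la x) (la y)" "\<And>x y. cg T x y \<Longrightarrow> cg T (lb x) (lb y)"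
      "\<And>x y. cg T x y \<Longrightarrow> cg T (ra x) (ra y)" "\<And>x y. cg T x y \<Longrightarrow> cg T (rb x) (rb y)"
    and com: "\<And>x. la (ra x) = ra (la x)" "\<And>x. la (rb x) = rb (la x)" "\<And>x. lb (ra x) = ra (lb x)" "\<And>x. lb (rb x) = rb (lb x)"
    and R1: "\<And>x. cg T (lb (la x)) (scal v * la (lb x))" and R2: "\<And>x. cg T (ra (rb x)) (scal v * rb (ra x))"
    and R3: "cg T (lb g) (scal t * rb g)" and R4: "cg T (ra h) (scal t' * la h)"
    and nroot: "\<And>m. m > 0 \<Longrightarrow> v ^ m \<noteq> 1" and vr: "v ^ r * (t * t') = 1"
  shows "cg T (chain v t (\<lambda>x. la x + lb x) (\<lambda>x. ra x + rb x) (g + h) (Suc r))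
    (chain v t la ra g (Suc r) + chain v t lb rb h (Suc r))"
proof -
  note tr [trans] = cg_trans[OF T]
  note ks = klin_scal[OF k(1)] klin_scal[OF k(2)] klin_scal[OF k(3)] klin_scal[OF k(4)]
    klin_diff[OF k(1)] klin_diff[OF k(2)] klin_diff[OF k(3)] klin_diff[OF k(4)]
  have cs: "cg T x y \<Longrightarrow> cg T (scal a * x) (scal a * y)" for a x y by (rule cg_left[OF T])
  \<comment> \<open>In the model case \<open>la\<close>, \<open>ra\<close> and \<open>lb\<close>,
    \<open>rb\<close> are left and right multiplication by elements a and b with b a = v a b, b g =
    t g b and h a = t' a h.\<close>
  let ?L = "\<lambda>x. la x + lb x" and ?R = "\<lambda>x. ra x + rb x"
  define G where "G m = chain v t la ra g m" for m
  define H where "H m = chain v t lb rb h m" for m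
  have GS: "G (Suc m) = la (G m) - scal (v ^ m * t) * ra (G m)" for m by (simp add: G_def)
  have HS: "H (Suc m) = lb (H m) - scal (v ^ m * t) * rb (H m)" for m by (simp add: H_def)
  have Gq: "cg T (lb (G m)) (scal (v ^ m * t) * rb (G m))" for m
  proof (induction m)
    case (Suc m)
    let ?s = "v ^ m * t"
    have "cg T (lb (la (G m))) (scal v * la (lb (G m)))" by (rule R1)
    also have "cg T (scal v * la (lb (G m))) (scal v * la (scal ?s * rb (G m)))" by (intro cs c Suc)
    finally have 1: "cg T (lb (la (G m))) (scal (v ^ Suc m * t) * rb (la (G m)))"
      by (simp add: ks scal_scal com mult.assoc)
    have "cg T (ra (lb (G m))) (ra (scal ?s * rb (G m)))" by (intro c Suc)
    also have "ra (scal ?s * rb (G m)) = scal ?s * ra (rb (G m))" by (simp add: ks)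
    also have "cg T (scal ?s * ra (rb (G m))) (scal ?s * (scal v * rb (ra (G m))))" by (intro cs R2)
    finally have 2: "cg T (lb (ra (G m))) (scal (v ^ Suc m * t) * rb (ra (G m)))"
      by (simp add: com scal_scal mult_ac)
    from cg_diff[OF T 1 cs[OF 2, of ?s]] show ?case
      by (simp add: GS ks right_diff_distrib scal_scal mult_ac)
  qed (simp add: G_def R3)
  \<comment> \<open>Started at \<open>g\<close>, the contributions of \<open>lb\<close> and
    \<open>rb\<close> cancel at every stage by \<open>Gq\<close>.\<close>
  have gG: "cg T (chain v t ?L ?R g m) (G m)" for m
  proof (induction m)
    case (Suc m)
    let ?s = "v ^ m * t"
    have "cg T (chain v t ?L ?R g (Suc m)) ((la (G m) + lb (G m)) - scal ?s * (ra (G m) + rb (G m)))"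
      unfolding chain.simps by (intro cg_diff[OF T] cs cg_add[OF T] c Suc)
    also have "cg T \<dots> ((la (G m) + scal ?s * rb (G m)) - scal ?s * (ra (G m) + rb (G m)))"
      by (intro cg_diff[OF T] cg_add[OF T] cg_refl[OF T] Gq)
    also have "\<dots> = G (Suc m)" by (simp add: GS distrib_left)
    finally show ?case .
  qed (simp add: G_def cg_refl[OF T])
  have Hq: "cg T (ra (H m)) (scal (v ^ m * t') * la (H m))" for m
  proof (induction m)
    case (Suc m)
    let ?s = "v ^ m * t'"
    have "cg T (lb (ra (H m))) (lb (scal ?s * la (H m)))" by (intro c Suc)
    also have "lb (scal ?s * la (H m)) = scal ?s * lb (la (H m))" by (simp add: ks)
    also have "cg T \<dots> (scal ?s * (scal v * la (lb (H m))))" by (intro cs R1)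
    finally have 1: "cg T (ra (lb (H m))) (scal (v ^ Suc m * t') * la (lb (H m)))"
      by (simp add: com scal_scal mult_ac)
    have "cg T (ra (rb (H m))) (scal v * rb (ra (H m)))" by (rule R2)
    also have "cg T \<dots> (scal v * rb (scal ?s * la (H m)))" by (intro cs c Suc)
    finally have 2: "cg T (ra (rb (H m))) (scal (v ^ Suc m * t') * la (rb (H m)))"
      by (simp add: ks scal_scal com mult_ac)
    from cg_diff[OF T 1 cs[OF 2, of "v ^ m * t"]] show ?case
      by (simp add: HS ks right_diff_distrib scal_scal mult_ac)
  qed (simp add: H_def R4)
  let ?C = "coprod_coeff v (t * t')"
  have pw: "lb ((la ^^ p) x) = lb ((la ^^ p) x)" "rb ((la ^^ p) x) = (la ^^ p) (rb x)" "ra ((la ^^ p) x) = (la ^^ p) (ra x)" for p x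
    by (induction p) (simp_all add: com[symmetric])
  have cp: "cg T x y \<Longrightarrow> cg T ((la ^^ p) x) ((la ^^ p) y)" for p x y
    by (induction p) (auto intro: c)
  have kp: "klin (la ^^ p)" for p by (rule klin_power[OF k(1)])
  have lbp: "cg T (lb ((la ^^ p) x)) (scal (v ^ p) * (la ^^ p) (lb x))" for p x
  proof (induction p)
    case (Suc p)
    have "cg T (lb (la ((la ^^ p) x))) (scal v * la (lb ((la ^^ p) x)))" by (rule R1)
    also have "cg T \<dots> (scal v * la (scal (v ^ p) * (la ^^ p) (lb x)))" by (intro cs c Suc)
    finally show ?case by (simp add: ks scal_scal)
  qed (simp add: cg_refl[OF T])
  \<comment> \<open>Started at \<open>h\<close>, the powers of \<open>la\<close> do not cancel at
    each stage; they accumulate with the coefficients \<open>?C\<close>, which disappear only at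
    length \<open>r + 1\<close>.\<close>
  have hH: "cg T (chain v t ?L ?R h m) (\<Sum>k\<le>m. scal (?C m k) * (la ^^ (m - k)) (H k))" for m
  proof (induction m)
    case 0 show ?case by (simp add: H_def coprod_coeff_Suc(3)[OF nroot] cg_refl[OF T])
  next
    case (Suc m)
    let ?X = "\<lambda>k. (la ^^ (m - k)) (H k)"
    let ?Z = "\<lambda>k. (la ^^ (Suc m - k)) (H k)"
    let ?a = "\<lambda>k. 1 - v ^ (m + k) * (t * t')"
    have kL: "klin ?L" "klin ?R" by (intro klin_plus k)+
    have step: "cg T (?L (?X k) - scal (v ^ m * t) * ?R (?X k)) (scal (?a k) * ?Z k + scal (v ^ (m - k)) * ?Z (Suc k))"
      if "k \<le> m" for k
    proof -
      have m: "v ^ m = v ^ (m - k) * v ^ k" using that by (simp add: power_add[symmetric])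
      have Z: "la (?X k) = ?Z k" using that by (simp add: Suc_diff_le)
      have "cg T (ra (?X k)) ((la ^^ (m - k)) (scal (v ^ k * t') * la (H k)))"
        unfolding pw(3) by (intro cp Hq)
      also have "(la ^^ (m - k)) (scal (v ^ k * t') * la (H k)) = scal (v ^ k * t') * ?Z k"
        using that by (simp add: klin_scal[OF kp] Suc_diff_le funpow_swap1)
      finally have 1: "cg T (ra (?X k)) (scal (v ^ k * t') * ?Z k)" .
      have "cg T (?L (?X k) - scal (v ^ m * t) * ?R (?X k))
         ((?Z k + scal (v ^ (m - k)) * (la ^^ (m - k)) (lb (H k)))
           - scal (v ^ m * t) * (scal (v ^ k * t') * ?Z k + (la ^^ (m - k)) (rb (H k))))"
        unfolding Z pw(2) by (intro cg_diff[OF T] cg_add[OF T] cs 1 lbp cg_refl[OF T])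
      also have "\<dots> = scal (?a k) * ?Z k + scal (v ^ (m - k)) * ((la ^^ (m - k)) (lb (H k)) - scal (v ^ k * t) * (la ^^ (m - k)) (rb (H k)))"
        by (simp add: scal_diff left_diff_distrib right_diff_distrib distrib_left scal_scal power_add m mult_ac)
      also have "(la ^^ (m - k)) (lb (H k)) - scal (v ^ k * t) * (la ^^ (m - k)) (rb (H k)) = ?Z (Suc k)"
        by (simp add: HS klin_diff[OF kp] klin_scal[OF kp])
      finally show ?thesis .
    qed
    have "cg T (chain v t ?L ?R h (Suc m))
      (?L (\<Sum>k\<le>m. scal (?C m k) * ?X k) - scal (v ^ m * t) * ?R (\<Sum>k\<le>m. scal (?C m k) * ?X k))"
      unfolding chain.simps by (intro cg_diff[OF T] cs cg_add[OF T] c Suc)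
    also have "?L (\<Sum>k\<le>m. scal (?C m k) * ?X k) - scal (v ^ m * t) * ?R (\<Sum>k\<le>m. scal (?C m k) * ?X k)
      = (\<Sum>k\<le>m. scal (?C m k) * (?L (?X k) - scal (v ^ m * t) * ?R (?X k)))"
      unfolding klin_sum[OF kL(1)] klin_sum[OF kL(2)] klin_scal[OF kL(1)] klin_scal[OF kL(2)]
      by (simp add: sum_distrib_left sum_subtractf right_diff_distrib scal_scal mult.commute)
    also have "cg T \<dots> (\<Sum>k\<le>m. scal (?C m k) * (scal (?a k) * ?Z k + scal (v ^ (m - k)) * ?Z (Suc k)))"
      by (intro cg_sum[OF T] cs step) simp
    also have "\<dots> = (\<Sum>k\<le>m. scal (?a k * ?C m k) * ?Z k) + (\<Sum>k\<le>m. scal (v ^ (m - k) * ?C m k) * ?Z (Suc k))"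
      by (simp only: distrib_left scal_scal sum.distrib mult.commute)
    also have "\<dots> = (\<Sum>k\<le>Suc m. scal (?C (Suc m) k) * ?Z k)"
      by (rule sum_shift_combine) (simp_all add: coprod_coeff_Suc[OF nroot])
    finally show ?case .
  qed
  have "(\<Sum>k\<le>Suc r. scal (?C (Suc r) k) * (la ^^ (Suc r - k)) (H k)) = H (Suc r)"
  proof -
    \<comment> \<open>The zero factor is the one with index \<open>r\<close>, by
      \<open>vr\<close>.\<close>
    have "?C (Suc r) k = 0" if "k \<le> r" for k
      using that vr unfolding coprod_coeff_def by (auto simp: prod_zero_iff intro!: bexI[of _ r])
    thus ?thesis by (simp add: coprod_coeff_Suc(3)[OF nroot])
  qed
  with hH[of "Suc r"] have 2: "cg T (chain v t ?L ?R h (Suc r)) (H (Suc r))" by metis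
  have kL: "klin ?L" "klin ?R" by (intro klin_plus k)+
  have "chain v t ?L ?R (g + h) (Suc r) = chain v t ?L ?R g (Suc r) + chain v t ?L ?R h (Suc r)"
    by (rule klin_add[OF klin_chain[OF kL]])
  also have "cg T \<dots> (G (Suc r) + H (Suc r))" by (intro cg_add[OF T] gG 2)
  finally show ?thesis unfolding G_def H_def .
qed

section \<open>Tensor products of free algebras\<close>

lemma tensor_lin: "tensor a b = lin (\<lambda>u. lin (\<lambda>v. sg (u, v) 1) b) (a :: ('x, 'k::comm_ring_1) free_algebra)"
  by (simp add: tensor_def lin_def sum_distrib_left scal_scal scal_single)

lemma klin_tensor_left: "klin (\<lambda>a. tensor a (b :: ('x, 'k::comm_ring_1) free_algebra))"
  unfolding tensor_lin by (rule klin_lin)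
lemma klin_tensor_right: "klin (tensor (a :: ('x, 'k::comm_ring_1) free_algebra))"
proof -
  have "klin (\<lambda>b. tensor a b)"
    unfolding tensor_lin lin_def[of _ a]
    by (intro klin_setsum klin_mult_left klin_lin)
  thus ?thesis .
qed
lemmas tensor_left = klin_simps[OF klin_tensor_left]
lemmas tensor_right = klin_simps[OF klin_tensor_right]

lemma tensor_mono: "tensor (mono u) (mono v) = (sg (Word u, Word v) 1 :: ('x, 'k::comm_ring_1) free_algebra2)"
  by (simp add: tensor_lin mono_def)

lemma tensor_mult: "tensor a b * tensor c d = tensor (a * c) (b * d :: ('x, 'k::comm_ring_1) free_algebra)"
proof (induction a rule: free_algebra_induct)
  case (mono x u)
  have "tensor (mono u) b * tensor c d = tensor (mono u * c) (b * d)"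
  proof (induction b rule: free_algebra_induct)
    case (mono y v)
    have "tensor (mono u) (mono v) * tensor c d = tensor (mono u * c) (mono v * d)"
    proof (induction c rule: free_algebra_induct)
      case (mono z u')
      have "tensor (mono u) (mono v) * tensor (mono u') d = tensor (mono u * mono u') (mono v * d)"
      proof (induction d rule: free_algebra_induct)
        case (mono w v')
        have "tensor (mono u) (mono v) * tensor (mono u') (mono v') = tensor (mono u * mono u') (mono v * mono v' :: ('x, 'k) free_algebra)"
          by (simp add: mono_append[symmetric] tensor_mono mult_single Word_plus)
        thus ?case by (simp add: tensor_right mult_scal_left[of "mono l" for l] mult_scal_left[of "tensor (mono u) (mono v)"])
      qed (simp add: tensor_right distrib_left)
      thus ?case by (simp add: tensor_left mult_scal_left[of "mono l" for l] mult_scal_left[of "tensor (mono u) (mono v)"])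
    qed (simp add: tensor_left distrib_left)
    thus ?case by (simp add: tensor_right mult.assoc)
  qed (simp add: tensor_right distrib_right)
  thus ?case by (simp add: tensor_left mult.assoc)
qed (simp add: tensor_left distrib_right)

lemma tensor_one: "tensor 1 1 = (1 :: ('x, 'k::comm_ring_1) free_algebra2)"
  using tensor_mono[of "[]" "[]"] by (simp add: zero_prod_def[symmetric])

context quantum_group
begin

abbreviation "J2 \<equiv> Uq2_ideal A q"

lemma fideal_J2: "fideal J2" unfolding Uq2_ideal_def by (rule fideal_Idl)
lemma tensor_J2: "a \<in> J \<or> b \<in> J \<Longrightarrow> tensor a b \<in> J2"
  unfolding Uq2_ideal_def by (rule Idl_self) blast

lemma tensor_cong: "cg J a a' \<Longrightarrow> cg J b b' \<Longrightarrow> cg J2 (tensor a b) (tensor a' b')"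
proof -
  assume "cg J a a'" "cg J b b'"
  hence "tensor (a - a') b + tensor a' (b - b') \<in> J2"
    unfolding cg_def by (intro fideal_add[OF fideal_J2] tensor_J2) auto
  thus ?thesis by (simp add: cg_def tensor_left tensor_right)
qed

lemma tensor_cong_left: "cg J a a' \<Longrightarrow> cg J2 (tensor a b) (tensor a' b)"
  by (intro tensor_cong cg_refl[OF fideal_J])
lemma tensor_cong_right: "cg J b b' \<Longrightarrow> cg J2 (tensor a b) (tensor a b')"
  by (intro tensor_cong cg_refl[OF fideal_J])

lemmas cg1_trans [trans] = cg_trans[OF fideal_J]
lemmas cg2_trans [trans] = cg_trans[OF fideal_J2]
lemmas cg1 = cg_refl[OF fideal_J] cg_left[OF fideal_J] cg_right[OF fideal_J]
lemmas cg2 = cg_refl[OF fideal_J2] cg_left[OF fideal_J2] cg_right[OF fideal_J2]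

lemma cg_relator: "a - b \<in> Uq_relators A q \<Longrightarrow> cg J a b"
  unfolding cg_def by (rule relator_J)

lemma toral_commute: "s \<in> toral \<Longrightarrow> t \<in> toral \<Longrightarrow> cg J (s * t) (t * s)"
  by (rule cg_relator) (auto simp: Uq_relators_def)
lemma toral_mem [simp]: "fOm i \<in> toral" "fOmInv i \<in> toral" "fOm' i \<in> toral" "fOmInv' i \<in> toral"
  by (auto simp: toral_def)
lemma om_inv: "cg J (fOm i * fOmInv i) 1" "cg J (fOm' i * fOmInv' i) 1"
  by (rule cg_relator, auto simp: Uq_relators_def)+
lemma inv_om: "cg J (fOmInv i * fOm i) 1" "cg J (fOmInv' i * fOm' i) 1"
  by (rule cg1_trans[OF toral_commute om_inv(1)]; simp) (rule cg1_trans[OF toral_commute om_inv(2)]; simp)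

lemma commute_from_conj:
  assumes "cg J (g * x * g') (c * x)" "cg J (g' * g) 1"
  shows "cg J (g * x) (c * (x * g))"
proof -
  have "cg J (g * x * (g' * g)) (g * x * 1)" by (intro cg1 assms(2))
  hence "cg J (g * x) (g * x * (g' * g))" using cg_sym[OF fideal_J] by simp
  also have "g * x * (g' * g) = (g * x * g') * g" by (simp add: mult.assoc)
  also have "cg J \<dots> (c * x * g)" by (intro cg1 assms(1))
  finally show ?thesis by (simp add: mult.assoc)
qed

lemma conj_relators:
  "cg J (fOm i * fE j * fOmInv i) (scal (q i j) * fE j)"
  "cg J (fOm' i * fE j * fOmInv' i) (scal (inverse (q j i)) * fE j)"
  "cg J (fOm i * fF j * fOmInv i) (scal (inverse (q i j)) * fF j)"
  "cg J (fOm' i * fF j * fOmInv' i) (scal (q j i) * fF j)"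
  by (rule cg_relator, unfold Uq_relators_def, blast)+

lemma om_E: "cg J (fOm i * fE j) (scal (q i j) * (fE j * fOm i))"
  and om'_E: "cg J (fOm' i * fE j) (scal (inverse (q j i)) * (fE j * fOm' i))"
  and om_F: "cg J (fOm i * fF j) (scal (inverse (q i j)) * (fF j * fOm i))"
  and om'_F: "cg J (fOm' i * fF j) (scal (q j i) * (fF j * fOm' i))"
  by (rule commute_from_conj[OF conj_relators(1) inv_om(1)], rule commute_from_conj[OF conj_relators(2) inv_om(2)],
      rule commute_from_conj[OF conj_relators(3) inv_om(1)], rule commute_from_conj[OF conj_relators(4) inv_om(2)])

lemma ef_commutator: "cg J (fE i * fF j - fF j * fE i) (if i = j then scal (q i i / (q i i - 1)) * (fOm i - fOm' i) else 0)"
  by (rule cg_relator, unfold Uq_relators_def, blast)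

lemma serre_J: "i \<noteq> j \<Longrightarrow> serre_e A q i j \<in> J" "i \<noteq> j \<Longrightarrow> serre_f A q i j \<in> J"
  by (rule relator_J, unfold Uq_relators_def, blast)+

abbreviation D :: "('i gen, 'k) free_algebra \<Rightarrow> ('i gen, 'k) free_algebra2" where
  "D \<equiv> free_extend comult_gen"

lemmas klin_D = klin_free_extend[of comult_gen]
lemmas D_simps = klin_simps[OF klin_D] free_extend_mult
lemma D_var: "D (var g) = comult_gen g" by (simp add: var_eq_mono free_extend_mono)
lemma D_one: "D 1 = 1" using free_extend_mono[of comult_gen "[]"] by simp
lemma scal_cong1: "cg J x y \<Longrightarrow> cg J (scal c * x) (scal c * y)" by (rule cg1(2))
lemma scal_cong2: "cg J2 x y \<Longrightarrow> cg J2 (scal c * x) (scal c * y)" by (rule cg2(2))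

lemma q_rel_pow': "i \<noteq> j \<Longrightarrow> q i i ^ nat (- A i j) * (q i j * q j i) = 1"
  using q_rel_pow[of i j] by (simp add: mult_ac)

text \<open>\<open>chain_coproduct\<close> with a = e_i \<otimes> 1 and b = \<omega>_i \<otimes> e_i
  splits the coproduct into one chain in each kind of element. The first is the Serre element
  tensored with 1, the second a product of \<omega>'s tensored with the Serre element.\<close>

lemma D_serre_e: assumes ij: "i \<noteq> j" shows "D (serre_e A q i j) \<in> J2"
proof -
  let ?a = "tensor (fE i) 1 :: ('i gen, 'k) free_algebra2" and ?b = "tensor (fOm i) (fE i) :: ('i gen, 'k) free_algebra2"
  let ?g = "tensor (fE j) 1 :: ('i gen, 'k) free_algebra2" and ?h = "tensor (fOm j) (fE j) :: ('i gen, 'k) free_algebra2"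
  let ?v = "q i i" and ?t = "q i j" and ?t' = "q j i" and ?r = "nat (- A i j)"
  have tt: "cg J2 (tensor x y * tensor x' y') (scal c * (tensor x' y' * tensor x y))"
    if "cg J (x * x') (scal c * (x' * x))" "y * y' = y' * y" for x y x' y' c
    using tensor_cong_left[OF that(1), of "y * y'"] by (simp add: tensor_mult tensor_left that(2))
  have 1: "cg J2 (?b * ?a) (scal ?v * (?a * ?b))" by (rule tt[OF om_E]) simp
  have 2: "cg J2 (?b * ?g) (scal ?t * (?g * ?b))" by (rule tt[OF om_E]) simp
  have 3: "cg J2 (?h * ?a) (scal ?t' * (?a * ?h))" by (rule tt[OF om_E]) simp
  have eq: "D (serre_e A q i j) = chain ?v ?t (\<lambda>x. (?a + ?b) * x) (\<lambda>x. x * (?a + ?b)) (?g + ?h) (Suc ?r)"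
    unfolding serre_e_chain nat_1_A[OF ij]
    by (subst chain_hom[OF klin_D]) (simp_all add: free_extend_mult D_var)
  have eq2: "chain ?v ?t (\<lambda>x. (?a + ?b) * x) (\<lambda>x. x * (?a + ?b)) (?g + ?h) (Suc ?r) = chain ?v ?t (\<lambda>x. ?a * x + ?b * x) (\<lambda>x. x * ?a + x * ?b) (?g + ?h) (Suc ?r)"
    by (simp only: distrib_left distrib_right)
  have main: "cg J2 (D (serre_e A q i j)) (chain ?v ?t (\<lambda>x. ?a * x) (\<lambda>x. x * ?a) ?g (Suc ?r) + chain ?v ?t (\<lambda>x. ?b * x) (\<lambda>x. x * ?b) ?h (Suc ?r))"
    unfolding eq eq2
  proof (rule chain_coproduct[OF fideal_J2, where t' = ?t'])
    show "cg J2 (?b * (?a * x)) (scal ?v * (?a * (?b * x)))" for x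
      using cg2(3)[OF 1, of x] by (simp add: mult.assoc)
    show "cg J2 (x * ?b * ?a) (scal ?v * (x * ?a * ?b))" for x
      using cg2(2)[OF 1, of x] by (simp add: mult.assoc mult_scal_left[of x])
    show "?v ^ ?r * (?t * ?t') = 1" by (rule q_rel_pow'[OF ij])
  qed (simp_all add: klin_left klin_right cg2 mult.assoc 2 3 root)
  have A: "chain ?v ?t (\<lambda>x. ?a * x) (\<lambda>x. x * ?a) ?g n = tensor (chain ?v ?t (\<lambda>x. fE i * x) (\<lambda>x. x * fE i) (fE j) n) 1" for n
    by (induction n) (simp_all add: tensor_mult tensor_left)
  have B: "cg J2 (chain ?v ?t (\<lambda>x. ?b * x) (\<lambda>x. x * ?b) ?h n)
      (tensor (fOm i ^ n * fOm j) (chain ?v ?t (\<lambda>x. fE i * x) (\<lambda>x. x * fE i) (fE j) n))" for n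
  proof (induction n)
    case (Suc n)
    let ?c = "chain ?v ?t (\<lambda>x. fE i * x) (\<lambda>x. x * fE i) (fE j) n"
    have "cg J2 (chain ?v ?t (\<lambda>x. ?b * x) (\<lambda>x. x * ?b) ?h (Suc n))
      (?b * tensor (fOm i ^ n * fOm j) ?c - scal (?v ^ n * ?t) * (tensor (fOm i ^ n * fOm j) ?c * ?b))"
      unfolding chain.simps by (intro cg_diff[OF fideal_J2] scal_cong2 cg2(2,3) Suc)
    also have "\<dots> = tensor (fOm i ^ Suc n * fOm j) (fE i * ?c) - scal (?v ^ n * ?t) * tensor (fOm i ^ n * (fOm j * fOm i)) (?c * fE i)"
      by (simp add: tensor_mult mult.assoc)
    also have "cg J2 \<dots> (tensor (fOm i ^ Suc n * fOm j) (fE i * ?c) - scal (?v ^ n * ?t) * tensor (fOm i ^ n * (fOm i * fOm j)) (?c * fE i))"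
      by (intro cg_diff[OF fideal_J2] cg2(1) scal_cong2 tensor_cong_left cg1(2) toral_commute) simp_all
    also have "fOm i ^ n * (fOm i * fOm j) = fOm i ^ Suc n * (fOm j :: ('i gen, 'k) free_algebra)"
      by (simp add: mult.assoc power_commutes[symmetric])
    finally show ?case by (simp add: tensor_right)
  qed (simp add: cg2)
  have s: "chain ?v ?t (\<lambda>x. fE i * x) (\<lambda>x. x * fE i) (fE j) (Suc ?r) \<in> J"
    unfolding nat_1_A[OF ij, symmetric] serre_e_chain[symmetric] by (rule serre_J[OF ij])
  have "chain ?v ?t (\<lambda>x. ?a * x) (\<lambda>x. x * ?a) ?g (Suc ?r) \<in> J2" unfolding A using s by (intro tensor_J2) simp
  moreover have "chain ?v ?t (\<lambda>x. ?b * x) (\<lambda>x. x * ?b) ?h (Suc ?r) \<in> J2"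
    by (rule cg_mem[OF fideal_J2 B]) (use s in \<open>intro tensor_J2, simp\<close>)
  ultimately show ?thesis using cg_mem[OF fideal_J2 main] fideal_add[OF fideal_J2] by blast
qed

text \<open>In \<open>serre_f\<close> the operator \<open>L\<close> is right multiplication. With a
  = f_i \<otimes> \<omega>'_i and b = 1 \<otimes> f_i the commutation rules required by
  \<open>chain_coproduct\<close> then hold in reversed order.\<close>

lemma D_serre_f: assumes ij: "i \<noteq> j" shows "D (serre_f A q i j) \<in> J2"
proof -
  let ?a = "tensor (fF i) (fOm' i) :: ('i gen, 'k) free_algebra2" and ?b = "tensor 1 (fF i) :: ('i gen, 'k) free_algebra2"
  let ?g = "tensor (fF j) (fOm' j) :: ('i gen, 'k) free_algebra2" and ?h = "tensor 1 (fF j) :: ('i gen, 'k) free_algebra2"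
  let ?v = "q i i" and ?t = "q i j" and ?t' = "q j i" and ?r = "nat (- A i j)"
  have tt: "cg J2 (tensor x y * tensor x' y') (scal c * (tensor x' y' * tensor x y))"
    if "cg J (y * y') (scal c * (y' * y))" "x * x' = x' * x" for x y x' y' c
    using tensor_cong_right[OF that(1), of "x * x'"] by (simp add: tensor_mult tensor_right that(2))
  have 1: "cg J2 (?a * ?b) (scal ?v * (?b * ?a))" by (rule tt[OF om'_F]) simp
  have 2: "cg J2 (?g * ?b) (scal ?t * (?b * ?g))" by (rule tt[OF om'_F]) simp
  have 3: "cg J2 (?a * ?h) (scal ?t' * (?h * ?a))" by (rule tt[OF om'_F]) simp
  have eq: "D (serre_f A q i j) = chain ?v ?t (\<lambda>x. x * (?b + ?a)) (\<lambda>x. (?b + ?a) * x) (?h + ?g) (Suc ?r)"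
    unfolding serre_f_chain nat_1_A[OF ij]
    by (subst chain_hom[OF klin_D]) (simp_all add: free_extend_mult D_var)
  have eq2: "chain ?v ?t (\<lambda>x. x * (?b + ?a)) (\<lambda>x. (?b + ?a) * x) (?h + ?g) (Suc ?r) = chain ?v ?t (\<lambda>x. x * ?a + x * ?b) (\<lambda>x. ?a * x + ?b * x) (?g + ?h) (Suc ?r)"
    by (simp only: distrib_left distrib_right add.commute)
  have main: "cg J2 (D (serre_f A q i j)) (chain ?v ?t (\<lambda>x. x * ?a) (\<lambda>x. ?a * x) ?g (Suc ?r) + chain ?v ?t (\<lambda>x. x * ?b) (\<lambda>x. ?b * x) ?h (Suc ?r))"
    unfolding eq eq2
  proof (rule chain_coproduct[OF fideal_J2, where t' = ?t'])
    show "cg J2 (x * ?a * ?b) (scal ?v * (x * ?b * ?a))" for x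
      using cg2(2)[OF 1, of x] by (simp add: mult.assoc mult_scal_left[of x])
    show "cg J2 (?a * (?b * x)) (scal ?v * (?b * (?a * x)))" for x
      using cg2(3)[OF 1, of x] by (simp add: mult.assoc)
    show "?v ^ ?r * (?t * ?t') = 1" by (rule q_rel_pow'[OF ij])
  qed (simp_all add: klin_left klin_right cg2 mult.assoc 2 3 root)
  have B: "chain ?v ?t (\<lambda>x. x * ?b) (\<lambda>x. ?b * x) ?h n = tensor 1 (chain ?v ?t (\<lambda>x. x * fF i) (\<lambda>x. fF i * x) (fF j) n)" for n
    by (induction n) (simp_all add: tensor_mult tensor_right)
  have A: "cg J2 (chain ?v ?t (\<lambda>x. x * ?a) (\<lambda>x. ?a * x) ?g n)
      (tensor (chain ?v ?t (\<lambda>x. x * fF i) (\<lambda>x. fF i * x) (fF j) n) (fOm' j * fOm' i ^ n))" for n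
  proof (induction n)
    case (Suc n)
    let ?c = "chain ?v ?t (\<lambda>x. x * fF i) (\<lambda>x. fF i * x) (fF j) n"
    have "cg J2 (chain ?v ?t (\<lambda>x. x * ?a) (\<lambda>x. ?a * x) ?g (Suc n))
      (tensor ?c (fOm' j * fOm' i ^ n) * ?a - scal (?v ^ n * ?t) * (?a * tensor ?c (fOm' j * fOm' i ^ n)))"
      unfolding chain.simps by (intro cg_diff[OF fideal_J2] scal_cong2 cg2(2,3) Suc)
    also have "\<dots> = tensor (?c * fF i) (fOm' j * fOm' i ^ Suc n) - scal (?v ^ n * ?t) * tensor (fF i * ?c) (fOm' i * fOm' j * fOm' i ^ n)"
      by (simp add: tensor_mult mult.assoc power_commutes)
    also have "cg J2 \<dots> (tensor (?c * fF i) (fOm' j * fOm' i ^ Suc n) - scal (?v ^ n * ?t) * tensor (fF i * ?c) (fOm' j * fOm' i * fOm' i ^ n))"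
      by (intro cg_diff[OF fideal_J2] cg2(1) scal_cong2 tensor_cong_right cg1(3) toral_commute) simp_all
    finally show ?case by (simp add: tensor_left mult.assoc)
  qed (simp add: cg2)
  have s: "chain ?v ?t (\<lambda>x. x * fF i) (\<lambda>x. fF i * x) (fF j) (Suc ?r) \<in> J"
    unfolding nat_1_A[OF ij, symmetric] serre_f_chain[symmetric] by (rule serre_J[OF ij])
  have "chain ?v ?t (\<lambda>x. x * ?b) (\<lambda>x. ?b * x) ?h (Suc ?r) \<in> J2" unfolding B using s by (intro tensor_J2) simp
  moreover have "chain ?v ?t (\<lambda>x. x * ?a) (\<lambda>x. ?a * x) ?g (Suc ?r) \<in> J2"
    by (rule cg_mem[OF fideal_J2 A]) (use s in \<open>intro tensor_J2, simp\<close>)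
  ultimately show ?thesis using cg_mem[OF fideal_J2 main] fideal_add[OF fideal_J2] by blast
qed

lemma D_toral: "s \<in> toral \<Longrightarrow> D s = tensor s s"
  by (auto simp: toral_def D_var)

text \<open>Treats the four conjugation relations together: \<open>x\<close> is some e_j or f_j, one
  of \<open>y\<close> and \<open>z\<close> is 1 and the other is the toral element in its
  coproduct.\<close>

lemma D_conj:
  assumes g: "D g = tensor g g" "D g' = tensor g' g'" "cg J (g * g') 1"
    and x: "D x = tensor x y + tensor z x" "cg J (g * y * g') y" "cg J (g * z * g') z"
    and c: "cg J (g * x * g') (scal c * x)"
  shows "cg J2 (D (g * x * g')) (D (scal c * x))"
proof -
  have "D (g * x * g') = tensor (g * x * g') (g * y * g') + tensor (g * z * g') (g * x * g')"
    by (simp add: D_simps g x(1) distrib_left distrib_right tensor_mult)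
  also have "cg J2 \<dots> (tensor (scal c * x) y + tensor z (scal c * x))"
    by (intro cg_add[OF fideal_J2] tensor_cong x c)
  also have "\<dots> = D (scal c * x)"
    by (simp add: klin_scal[OF klin_D] x(1) tensor_left tensor_right distrib_left)
  finally show ?thesis .
qed

lemma conj_toral: "s \<in> toral \<Longrightarrow> g \<in> toral \<Longrightarrow> cg J (g * g') 1 \<Longrightarrow> cg J (g * s * g') s"
proof -
  assume s: "s \<in> toral" "g \<in> toral" and g: "cg J (g * g') 1"
  have "cg J (g * s * g') (s * g * g')" by (intro cg1(3) toral_commute s)
  also have "s * g * g' = s * (g * g')" by (simp add: mult.assoc)
  also have "cg J \<dots> (s * 1)" by (intro cg1(2) g)
  finally show ?thesis by simp
qed

lemma conj_one: "cg J (g * g') 1 \<Longrightarrow> cg J (g * 1 * g') 1" by simp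

lemma D_ef: "cg J2 (D (fE i * fF j - fF j * fE i)) (D (if i = j then scal (q i i / (q i i - 1)) * (fOm i - fOm' i) else 0))"
proof -
  let ?c = "\<lambda>x y. if i = j then scal (q i i / (q i i - 1)) * (x - y) else 0"
  define w :: "('i gen, 'k) free_algebra" where "w = (if i = j then scal (q i i / (q i i - 1)) * (fOm i - fOm' i) else 0)"
  have 1: "D (fE i * fF j - fF j * fE i)
      = tensor (fE i * fF j - fF j * fE i) (fOm' j) + tensor (fOm i) (fE i * fF j - fF j * fE i)
        + (tensor (fOm i * fF j) (fE i * fOm' j) - tensor (fF j * fOm i) (fOm' j * fE i))"
    by (simp add: D_simps D_var distrib_left distrib_right tensor_mult tensor_left tensor_right algebra_simps)
  \<comment> \<open>The two terms subtracted from each other are equal. They are inserted to match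
    the cross terms in \<open>1\<close>, where exchanging \<omega>_i with f_j and \<omega>'_j with
    e_i costs the same factor \<open>inverse (q i j)\<close>.\<close>
  have 2: "D w = tensor w (fOm' j) + tensor (fOm i) w
      + (tensor (scal (inverse (q i j)) * (fF j * fOm i)) (fE i * fOm' j) - tensor (fF j * fOm i) (scal (inverse (q i j)) * (fE i * fOm' j)))"
  proof (cases "i = j")
    case True
    have "D (scal c * (fOm i - fOm' i)) = scal c * (tensor (fOm i) (fOm i) - tensor (fOm' i) (fOm' i))" for c
      by (simp only: klin_scal[OF klin_D] klin_diff[OF klin_D] D_var comult_gen.simps)
    thus ?thesis using True by (simp add: w_def tensor_left tensor_right right_diff_distrib)
  next
    case False
    thus ?thesis by (simp add: w_def tensor_left tensor_right klin_zero[OF klin_D])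
  qed
  have "cg J2 (D (fE i * fF j - fF j * fE i)) (D w)"
    unfolding 1 2
    by (intro cg_add[OF fideal_J2] cg_diff[OF fideal_J2] tensor_cong_left tensor_cong_right
        ef_commutator[of i j, folded w_def] om_F om'_E)
  thus ?thesis unfolding w_def .
qed

lemma D_relator: assumes "r \<in> Uq_relators A q" shows "D r \<in> J2"
proof -
  have diff: "cg J2 (D a) (D b) \<Longrightarrow> D (a - b) \<in> J2" for a b by (simp add: cg_def klin_diff[OF klin_D])
  note tor = D_toral toral_mem
  from assms consider
      (tor) s t where "s \<in> toral" "t \<in> toral" "r = s * t - t * s"
    | (inv) i where "r = fOm i * fOmInv i - 1" | (inv') i where "r = fOm' i * fOmInv' i - 1"
    | (oe) i j where "r = fOm i * fE j * fOmInv i - scal (q i j) * fE j"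
    | (o'e) i j where "r = fOm' i * fE j * fOmInv' i - scal (inverse (q j i)) * fE j"
    | (of) i j where "r = fOm i * fF j * fOmInv i - scal (inverse (q i j)) * fF j"
    | (o'f) i j where "r = fOm' i * fF j * fOmInv' i - scal (q j i) * fF j"
    | (ef) i j where "r = fE i * fF j - fF j * fE i
               - (if i = j then scal (q i i / (q i i - 1)) * (fOm i - fOm' i) else 0)"
    | (se) i j where "i \<noteq> j" "r = serre_e A q i j"
    | (sf) i j where "i \<noteq> j" "r = serre_f A q i j"
    unfolding Uq_relators_def by blast
  thus "D r \<in> J2"
  proof cases
    case tor
    show ?thesis unfolding tor(3)
      by (rule diff) (simp add: D_simps D_toral tor(1,2) tensor_mult tensor_cong toral_commute)
  next
    case inv
    have "cg J2 (tensor (fOm i * fOmInv i) (fOm i * fOmInv i)) (tensor 1 1)" by (intro tensor_cong om_inv)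
    thus ?thesis unfolding inv by (intro diff) (simp add: D_simps D_one D_var tensor_mult tensor_one)
  next
    case inv'
    have "cg J2 (tensor (fOm' i * fOmInv' i) (fOm' i * fOmInv' i)) (tensor 1 1)" by (intro tensor_cong om_inv)
    thus ?thesis unfolding inv' by (intro diff) (simp add: D_simps D_one D_var tensor_mult tensor_one)
  next
    case oe
    show ?thesis unfolding oe
      by (intro diff D_conj[of _ _ _ 1 "fOm j"] conj_relators conj_toral conj_one om_inv toral_mem tor) (simp_all add: D_var)
  next
    case o'e
    show ?thesis unfolding o'e
      by (intro diff D_conj[of _ _ _ 1 "fOm j"] conj_relators conj_toral conj_one om_inv toral_mem tor) (simp_all add: D_var)
  next
    case of
    show ?thesis unfolding of
      by (intro diff D_conj[of _ _ _ "fOm' j" 1] conj_relators conj_toral conj_one om_inv toral_mem tor) (simp_all add: D_var)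
  next
    case o'f
    show ?thesis unfolding o'f
      by (intro diff D_conj[of _ _ _ "fOm' j" 1] conj_relators conj_toral conj_one om_inv toral_mem tor) (simp_all add: D_var)
  next
    case ef
    show ?thesis unfolding ef by (rule diff) (rule D_ef)
  qed (simp_all add: D_serre_e D_serre_f)
qed

lemma D_J: "a \<in> J \<Longrightarrow> D a \<in> J2"
proof -
  have "fideal {a. D a \<in> J2}"
    by (auto simp: fideal_def D_simps fideal_0[OF fideal_J2] fideal_add[OF fideal_J2]
        fideal_left[OF fideal_J2] fideal_right[OF fideal_J2])
  hence "J \<subseteq> {a. D a \<in> J2}"
    unfolding Uq_ideal_def by (rule Idl_minimal) (use D_relator in auto)
  thus "a \<in> J \<Longrightarrow> D a \<in> J2" by blast
qed

end

section \<open>Words in the positive part and their coproducts\<close>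

definition omw :: "'i list \<Rightarrow> ('i gen, 'k::comm_ring_1) free_algebra" where
  "omw l = mono (map GenOmega l)"

lemma omw_Nil [simp]: "omw [] = 1" by (simp add: omw_def)
lemma omw_Cons: "omw (k # l) = fOm k * omw l" by (simp add: omw_def var_eq_mono mono_append[symmetric])
text \<open>Uses the same choice of ordering as \<open>Uq_omega_mset\<close>, so that the two
  correspond exactly; see \<open>Uq_omega_mset_cl\<close>.\<close>

definition om :: "'i multiset \<Rightarrow> ('i gen, 'k::comm_ring_1) free_algebra" where
  "om \<nu> = omw (SOME l. mset l = \<nu>)"

lemma sum_submset_add_mset:
  assumes "\<And>\<nu>. \<not> \<nu> \<subseteq># \<gamma> \<Longrightarrow> f \<nu> = (0 :: 'r::comm_monoid_add)"
  shows "(\<Sum>\<nu> | \<nu> \<subseteq># add_mset k \<gamma>. f \<nu>) = (\<Sum>\<nu> | \<nu> \<subseteq># \<gamma>. f \<nu>)"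
    and "(\<Sum>\<nu> | \<nu> \<subseteq># add_mset k \<gamma>. if k \<in># \<nu> then f (\<nu> - {#k#}) else 0) = (\<Sum>\<nu> | \<nu> \<subseteq># \<gamma>. f \<nu>)"
proof -
  have sub: "\<nu> \<subseteq># add_mset k \<gamma>" if "\<nu> \<subseteq># \<gamma>" for \<nu>
    using subset_mset.order_trans[OF that, of "add_mset k \<gamma>"] by simp
  show "(\<Sum>\<nu> | \<nu> \<subseteq># add_mset k \<gamma>. f \<nu>) = (\<Sum>\<nu> | \<nu> \<subseteq># \<gamma>. f \<nu>)"
    by (rule sum.mono_neutral_right) (use assms sub in auto)
  have "(\<Sum>\<nu> | \<nu> \<subseteq># add_mset k \<gamma>. if k \<in># \<nu> then f (\<nu> - {#k#}) else 0)
     = (\<Sum>\<nu>\<in>add_mset k ` {\<nu>. \<nu> \<subseteq># \<gamma>}. if k \<in># \<nu> then f (\<nu> - {#k#}) else 0)"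
  proof (rule sum.mono_neutral_right)
    show "\<forall>\<nu>\<in>{\<nu>. \<nu> \<subseteq># add_mset k \<gamma>} - add_mset k ` {\<nu>. \<nu> \<subseteq># \<gamma>}. (if k \<in># \<nu> then f (\<nu> - {#k#}) else 0) = 0"
    proof
      fix \<nu> assume \<nu>: "\<nu> \<in> {\<nu>. \<nu> \<subseteq># add_mset k \<gamma>} - add_mset k ` {\<nu>. \<nu> \<subseteq># \<gamma>}"
      have "k \<notin># \<nu>"
      proof
        assume "k \<in># \<nu>"
        hence e: "\<nu> = add_mset k (\<nu> - {#k#})" by simp
        hence "\<nu> - {#k#} \<subseteq># \<gamma>" using \<nu> mset_subset_eq_add_mset_cancel[of k "\<nu> - {#k#}" \<gamma>] by simp
        with e show False using \<nu> by blast
      qed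
      thus "(if k \<in># \<nu> then f (\<nu> - {#k#}) else 0) = 0" by simp
    qed
  qed auto
  also have "\<dots> = (\<Sum>\<nu> | \<nu> \<subseteq># \<gamma>. f \<nu>)" by (simp add: sum.reindex inj_on_def)
  finally show "(\<Sum>\<nu> | \<nu> \<subseteq># add_mset k \<gamma>. if k \<in># \<nu> then f (\<nu> - {#k#}) else 0) = (\<Sum>\<nu> | \<nu> \<subseteq># \<gamma>. f \<nu>)" .
qed

text \<open>The part of the coproduct of a word whose second factor has degree \<nu>, computed in
  the free algebra before the \<omega>'s are moved to the right.\<close>

fun T :: "'i list \<Rightarrow> 'i multiset \<Rightarrow> ('i gen, 'k::comm_ring_1) free_algebra2" where
  "T [] \<nu> = (if \<nu> = {#} then 1 else 0)"
| "T (k # l) \<nu> = tensor (fE k) 1 * T l \<nu> + (if k \<in># \<nu> then tensor (fOm k) (fE k) * T l (\<nu> - {#k#}) else 0)"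

lemma T_0: "\<not> \<nu> \<subseteq># mset l \<Longrightarrow> T l \<nu> = 0"
proof (induction l arbitrary: \<nu>)
  case (Cons k l)
  have "\<not> \<nu> \<subseteq># mset l" using Cons.prems subset_mset.order_trans[of \<nu> "mset l" "mset (k # l)"] by auto
  moreover have "\<not> \<nu> - {#k#} \<subseteq># mset l" if "k \<in># \<nu>"
    using Cons.prems that mset_subset_eq_add_mset_cancel[of k "\<nu> - {#k#}" "mset l"] by simp
  ultimately show ?case using Cons.IH by simp
qed auto

lemma T_empty: "T l {#} = tensor (mono (map GenE l)) 1"
  by (induction l) (simp_all add: tensor_one tensor_mult var_eq_mono mono_append[symmetric])

definition TT :: "'i multiset \<Rightarrow> ('i, 'k::comm_ring_1) free_algebra \<Rightarrow> ('i gen, 'k) free_algebra2" where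
  "TT \<nu> = lext (\<lambda>l. T l \<nu>)"
lemma klin_TT [intro!]: "klin (TT \<nu>)" by (auto simp: TT_def)
lemma TT_mono: "TT \<nu> (mono l) = T l \<nu>" by (simp add: TT_def)

text \<open>The map id \<otimes> \<phi> on the tensor square.\<close>

definition coef2 :: "(('i gen, 'k) free_algebra \<Rightarrow> 'k) \<Rightarrow> ('i gen, 'k::comm_ring_1) free_algebra2 \<Rightarrow> ('i gen, 'k) free_algebra" where
  "coef2 \<phi> = lin (\<lambda>(u, v). scal (\<phi> (sg v 1)) * sg u 1)"

lemma klin_coef2 [intro!]: "klin (coef2 \<phi>)" unfolding coef2_def by (rule klin_lin)

lemma coef2_tensor:
  assumes "\<And>x y. \<phi> (x + y) = \<phi> x + \<phi> y" "\<And>c x. \<phi> (scal c * x) = c * \<phi> x"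
  shows "coef2 \<phi> (tensor a b) = scal (\<phi> b) * a"
proof (induction b rule: free_algebra_induct)
  case (add x y) thus ?case by (simp add: tensor_right klin_simps[OF klin_coef2] assms scal_add distrib_right)
next
  case (mono c v)
  have "coef2 \<phi> (tensor a (mono v)) = scal (\<phi> (mono v)) * a"
  proof (induction a rule: free_algebra_induct)
    case (add x y) thus ?case by (simp add: tensor_left klin_simps[OF klin_coef2] distrib_left)
  next
    case (mono d u)
    have "coef2 \<phi> (tensor (mono u) (mono v)) = scal (\<phi> (mono v)) * mono u"
      unfolding tensor_mono coef2_def by (simp add: mono_def)
    thus ?case by (simp add: tensor_left klin_simps[OF klin_coef2] scal_scal mult.commute)
  qed
  thus ?case by (simp add: tensor_right klin_simps[OF klin_coef2] assms(2) scal_scal)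
qed

context quantum_group
begin

lemma omw_perm: "mset l = mset l' \<Longrightarrow> cg J (omw l) (omw l')"
proof (induction l arbitrary: l')
  case (Cons k l)
  have "k \<in> set l'" using Cons.prems by (metis list.set_intros(1) mset_eq_setD)
  then obtain u v where l': "l' = u @ k # v" by (meson split_list)
  hence "cg J (omw l) (omw (u @ v))" using Cons.prems by (intro Cons.IH) simp
  hence "cg J (omw (k # l)) (fOm k * omw (u @ v))" unfolding omw_Cons by (rule cg1(2))
  also have "cg J (fOm k * omw (u @ v)) (omw (u @ k # v))"
  proof (induction u)
    case (Cons j u)
    have "cg J (fOm k * (fOm j * omw (u @ v))) (fOm j * (fOm k * omw (u @ v)))"
      unfolding mult.assoc[symmetric] by (intro cg1(3) toral_commute) simp_all
    also have "cg J (fOm j * (fOm k * omw (u @ v))) (fOm j * omw (u @ k # v))" by (intro cg1(2) Cons)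
    finally show ?case by (simp add: omw_Cons)
  qed (simp add: omw_Cons cg1(1))
  finally show ?case by (simp add: l')
qed (simp add: cg1(1))

lemma om_cg: "cg J (omw l) (om (mset l))"
  unfolding om_def by (rule omw_perm) (metis (mono_tags, lifting) someI)

lemma om_add_mset: "cg J (fOm k * om \<nu>) (om (add_mset k \<nu>))"
proof -
  obtain l where l: "mset l = \<nu>" using ex_mset by blast
  have "cg J (fOm k * om \<nu>) (fOm k * omw l)" unfolding l[symmetric] by (rule cg1(2), rule cg_sym[OF fideal_J om_cg])
  also have "cg J (fOm k * omw l) (om (add_mset k \<nu>))" using om_cg[of "k # l"] by (simp add: omw_Cons l)
  finally show ?thesis .
qed

lemma om_empty: "om {#} = 1" unfolding om_def by simp

lemma om_embE: "homog \<gamma> a \<Longrightarrow> cg J (fOm k * embE a) (scal (chi q {#k#} \<gamma>) * (embE a * fOm k))"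
proof (induction rule: homog_induct)
  case zero show ?case by (simp add: embE_simps cg1(1))
next
  case (add x y) thus ?case by (simp add: embE_simps distrib_left distrib_right cg_add[OF fideal_J])
next
  case (mono c l)
  have "cg J (fOm k * mono (map GenE l)) (scal (chi q {#k#} (mset l)) * (mono (map GenE l) * fOm k))"
  proof (induction l)
    case (Cons j l)
    let ?m = "mono (map GenE l) :: ('i gen, 'k) free_algebra"
    have "cg J ((fOm k * fE j) * ?m) (scal (q k j) * (fE j * fOm k) * ?m)" by (intro cg1(3) om_E)
    also have "scal (q k j) * (fE j * fOm k) * ?m = scal (q k j) * (fE j * (fOm k * ?m))" by (simp add: mult.assoc)
    also have "cg J \<dots> (scal (q k j) * (fE j * (scal (chi q {#k#} (mset l)) * (?m * fOm k))))" by (intro cg1(2) Cons)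
    finally show ?case
      by (simp add: mono_Cons[of _ "map GenE l"] var_eq_mono[symmetric] mult.assoc chi_add_mset_right[of q _ j "mset l"]
          mult_scal_left[of "fE j"] scal_scal)
  qed (simp add: cg1(1))
  from scal_cong1[OF this, of c] show ?case
    by (simp add: embE_simps embE_mono mono mult_scal_left[of "fOm k"] scal_scal mult.assoc mult.commute)
qed

lemma D_embE: "homog \<beta> a \<Longrightarrow> D (embE a) = (\<Sum>\<nu> | \<nu> \<subseteq># \<beta>. TT \<nu> a)"
proof (rule klin_eq_homog[where f = "\<lambda>a. D (embE a)" and g = "\<lambda>a. \<Sum>\<nu> | \<nu> \<subseteq># \<beta>. TT \<nu> a"])
  show "klin (\<lambda>a. D (embE a))" by (rule klin_comp[OF klin_D klin_embE])
  show "klin (\<lambda>a. \<Sum>\<nu> | \<nu> \<subseteq># \<beta>. TT \<nu> a)" by (intro klin_setsum klin_TT)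
  fix l assume l: "mset l = \<beta>"
  have "D (embE (mono l)) = (\<Sum>\<nu> | \<nu> \<subseteq># mset l. T l \<nu>)"
  proof (induction l)
    case Nil thus ?case by (simp add: D_one)
  next
    case (Cons k l)
    have "D (embE (mono (k # l))) = (tensor (fE k) 1 + tensor (fOm k) (fE k)) * D (embE (mono l))"
      by (simp add: mono_Cons[of k l] embE_mult embE_gen free_extend_mult D_var)
    also have "\<dots> = tensor (fE k) 1 * (\<Sum>\<nu> | \<nu> \<subseteq># mset l. T l \<nu>) + tensor (fOm k) (fE k) * (\<Sum>\<nu> | \<nu> \<subseteq># mset l. T l \<nu>)"
      by (simp add: Cons distrib_right)
    also have "\<dots> = tensor (fE k) 1 * (\<Sum>\<nu> | \<nu> \<subseteq># add_mset k (mset l). T l \<nu>)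
        + tensor (fOm k) (fE k) * (\<Sum>\<nu> | \<nu> \<subseteq># add_mset k (mset l). if k \<in># \<nu> then T l (\<nu> - {#k#}) else 0)"
    proof -
      have "(\<Sum>\<nu> | \<nu> \<subseteq># add_mset k (mset l). T l \<nu> :: ('i gen, 'k) free_algebra2) = (\<Sum>\<nu> | \<nu> \<subseteq># mset l. T l \<nu>)"
        by (rule sum_submset_add_mset(1)) (rule T_0)
      moreover have "(\<Sum>\<nu> | \<nu> \<subseteq># add_mset k (mset l). if k \<in># \<nu> then T l (\<nu> - {#k#}) else 0 :: ('i gen, 'k) free_algebra2) = (\<Sum>\<nu> | \<nu> \<subseteq># mset l. T l \<nu>)"
        by (rule sum_submset_add_mset(2)) (rule T_0)
      ultimately show ?thesis by simp
    qed
    also have "\<dots> = (\<Sum>\<nu> | \<nu> \<subseteq># mset (k # l). T (k # l) \<nu>)"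
      by (auto simp: sum_distrib_left sum.distrib[symmetric] intro!: sum.cong)
    finally show ?case .
  qed
  thus "D (embE (mono l)) = (\<Sum>\<nu> | \<nu> \<subseteq># \<beta>. TT \<nu> (mono l))" by (simp add: TT_mono l)
qed

text \<open>Moving \<omega>_i to the right past the rest of the word produces the scalar built into
  \<open>dRw\<close>; this links \<open>dR\<close> to the definition of
  \<open>hat_partial\<close>.\<close>

lemma T_single: "cg J2 (T l {#i#}) (tensor (embE (dR q i (mono l)) * fOm i) (fE i))"
proof (induction l)
  case Nil show ?case by (simp add: embE_simps tensor_left cg2(1))
next
  case (Cons k l)
  have 1: "cg J2 (tensor (fE k) 1 * T l {#i#}) (tensor (embE (mono [k] * dR q i (mono l)) * fOm i) (fE i))"
    using cg2(2)[OF Cons, of "tensor (fE k) 1"] by (simp add: tensor_mult embE_mult embE_gen mult.assoc)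
  show ?case
  proof (cases "k = i")
    case True
    have h: "homog (mset l) (mono l :: ('i, 'k) free_algebra)" by (simp add: homog_mono)
    have "cg J2 (tensor (fOm i) (fE i) * T l {#}) (tensor (scal (chi q {#i#} (mset l)) * (embE (mono l) * fOm i)) (fE i))"
      unfolding T_empty tensor_mult embE_mono[symmetric] mult_1_right
      by (rule tensor_cong_left, rule om_embE[OF h])
    from cg_add[OF fideal_J2 1 this] show ?thesis
      using True by (simp add: mono_Cons[of i l] dR_Cons[OF h] embE_simps tensor_left distrib_right mult.assoc)
  next
    case False
    thus ?thesis using 1
      by (simp add: mono_Cons[of k l] dR_Cons[of "mset l"] homog_mono)
  qed
qed

lemma TT_single: "cg J2 (TT {#i#} a) (tensor (embE (dR q i a) * fOm i) (fE i))"
proof (induction a rule: free_algebra_induct)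
  case (add x y)
  from cg_add[OF fideal_J2 add] show ?case
    by (simp add: klin_simps[OF klin_TT] dR_simps embE_simps distrib_right tensor_left)
next
  case (mono c l)
  from scal_cong2[OF T_single[of l i], of c] show ?case
    by (simp add: klin_simps[OF klin_TT] TT_mono dR_simps embE_simps tensor_left mult.assoc)
qed

text \<open>Representatives of the elements of \<open>comult_comp \<beta> \<nu>\<close>. Finite sums
  of tensors are encoded as lists, so that addition is concatenation.\<close>

definition tspan :: "'i multiset \<Rightarrow> 'i multiset \<Rightarrow> ('i gen, 'k) free_algebra2 set" where
  "tspan \<beta> \<nu> = {x. \<exists>ps :: (('i, 'k) free_algebra \<times> ('i, 'k) free_algebra) list. (\<forall>p\<in>set ps. homog (\<beta> - \<nu>) (fst p) \<and> homog \<nu> (snd p))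
     \<and> cg J2 x (\<Sum>p\<leftarrow>ps. tensor (embE (fst p) * om \<nu>) (embE (snd p)))}"

lemma tspan_gen:
  assumes "homog (\<beta> - \<nu>) a" "homog \<nu> b" "cg J2 x (tensor (embE a * om \<nu>) (embE b))"
  shows "x \<in> tspan \<beta> \<nu>"
  unfolding tspan_def mem_Collect_eq by (rule exI[of _ "[(a, b)]"]) (use assms in simp)
lemma tspan_add:
  assumes "x \<in> tspan \<beta> \<nu>" "y \<in> tspan \<beta> \<nu>"
  shows "x + y \<in> tspan \<beta> \<nu>"
proof -
  obtain ps rs where ps: "\<forall>p\<in>set ps. homog (\<beta> - \<nu>) (fst p) \<and> homog \<nu> (snd p)"
      "cg J2 x (\<Sum>p\<leftarrow>ps. tensor (embE (fst p) * om \<nu>) (embE (snd p)))"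
    and rs: "\<forall>p\<in>set rs. homog (\<beta> - \<nu>) (fst p) \<and> homog \<nu> (snd p)"
      "cg J2 y (\<Sum>p\<leftarrow>rs. tensor (embE (fst p) * om \<nu>) (embE (snd p)))"
    using assms unfolding tspan_def mem_Collect_eq by (elim exE conjE) (rule that)
  show ?thesis unfolding tspan_def mem_Collect_eq
    by (rule exI[of _ "ps @ rs"]) (use ps(1) rs(1) cg_add[OF fideal_J2 ps(2) rs(2)] in auto)
qed
lemma tspan_induct [consumes 1, case_names gen add]:
  assumes x: "x \<in> tspan \<beta> \<nu>"
    and g: "\<And>a b x. homog (\<beta> - \<nu>) a \<Longrightarrow> homog \<nu> b \<Longrightarrow> cg J2 x (tensor (embE a * om \<nu>) (embE b)) \<Longrightarrow> P x"
    and ad: "\<And>x y. P x \<Longrightarrow> P y \<Longrightarrow> P (x + y)"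
  shows "P x"
proof -
  have "P x" if "\<forall>p\<in>set ps. homog (\<beta> - \<nu>) (fst p) \<and> homog \<nu> (snd p)"
    "cg J2 x (\<Sum>p\<leftarrow>ps. tensor (embE (fst p) * om \<nu>) (embE (snd p)))" for ps x
    using that
  proof (induction ps arbitrary: x)
    case Nil
    show ?case by (rule g[of 0 0]) (use Nil in \<open>simp_all add: embE_simps tensor_left\<close>)
  next
    case (Cons p ps)
    let ?t = "tensor (embE (fst p) * om \<nu>) (embE (snd p))"
    have "P (x - ?t)" by (rule Cons.IH) (use Cons.prems in \<open>simp_all add: cg_def algebra_simps\<close>)
    moreover have "P ?t" by (rule g[OF _ _ cg2(1)]) (use Cons.prems in simp_all)
    ultimately show ?case using ad[of "x - ?t" ?t] by simp
  qed
  with x show ?thesis unfolding tspan_def mem_Collect_eq by (elim exE conjE)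
qed

lemma tspan_0: "0 \<in> tspan \<beta> \<nu>"
  by (rule tspan_gen[of _ _ 0 0]) (simp_all add: embE_simps tensor_left cg2(1))

lemma tspan_scal: "x \<in> tspan \<beta> \<nu> \<Longrightarrow> scal c * x \<in> tspan \<beta> \<nu>"
proof (induction rule: tspan_induct)
  case (gen a b x)
  show ?case
    by (rule tspan_gen[OF homog_scal[OF gen(1), of c] gen(2)])
      (use scal_cong2[OF gen(3), of c] in \<open>simp add: embE_simps tensor_left mult.assoc\<close>)
qed (simp add: distrib_left tspan_add)

lemma tspan_E: "x \<in> tspan \<beta> \<nu> \<Longrightarrow> \<nu> \<subseteq># \<beta> \<Longrightarrow> tensor (fE k) 1 * x \<in> tspan (add_mset k \<beta>) \<nu>"
proof (induction rule: tspan_induct)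
  case (gen a b x)
  have e: "add_mset k \<beta> - \<nu> = {#k#} + (\<beta> - \<nu>)"
    using multiset_diff_union_assoc[OF gen(4), of "{#k#}"] by simp
  have h: "homog (add_mset k \<beta> - \<nu>) (mono [k] * a)"
    unfolding e by (rule homog_mult) (simp_all add: gen)
  show ?case
    by (rule tspan_gen[OF h gen(2)])
      (use cg2(2)[OF gen(3), of "tensor (fE k) 1"] in \<open>simp add: tensor_mult embE_mult embE_gen mult.assoc\<close>)
qed (simp add: distrib_left tspan_add)

lemma tspan_Om: "x \<in> tspan \<beta> \<nu> \<Longrightarrow> tensor (fOm k) (fE k) * x \<in> tspan (add_mset k \<beta>) (add_mset k \<nu>)"
proof (induction rule: tspan_induct)
  case (gen a b x)
  let ?c = "chi q {#k#} (\<beta> - \<nu>)"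
  have h: "homog (add_mset k \<beta> - add_mset k \<nu>) (scal ?c * a)" using gen(1) by (simp add: homog_scal)
  have hb: "homog (add_mset k \<nu>) (mono [k] * b)" using homog_mult[OF _ gen(2), of "{#k#}" "mono [k]"] by simp
  have "cg J2 (tensor (fOm k) (fE k) * x) (tensor (fOm k * (embE a * om \<nu>)) (fE k * embE b))"
    using cg2(2)[OF gen(3), of "tensor (fOm k) (fE k)"] by (simp add: tensor_mult)
  also have "cg J2 \<dots> (tensor (embE (scal ?c * a) * om (add_mset k \<nu>)) (embE (mono [k] * b)))"
  proof -
    have "cg J (fOm k * embE a * om \<nu>) (scal ?c * (embE a * fOm k) * om \<nu>)" by (intro cg1(3) om_embE gen(1))
    also have "scal ?c * (embE a * fOm k) * om \<nu> = scal ?c * (embE a * (fOm k * om \<nu>))" by (simp add: mult.assoc)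
    also have "cg J \<dots> (scal ?c * (embE a * om (add_mset k \<nu>)))" by (intro cg1(2) om_add_mset)
    finally show ?thesis by (simp add: embE_mult embE_gen embE_scal mult.assoc tensor_cong_left)
  qed
  finally show ?case by (rule tspan_gen[OF h hb])
qed (simp add: distrib_left tspan_add)

lemma T_tspan: "\<nu> \<subseteq># mset l \<Longrightarrow> T l \<nu> \<in> tspan (mset l) \<nu>"
proof (induction l arbitrary: \<nu>)
  case Nil
  thus ?case by (auto intro!: tspan_gen[of _ _ 1 1] simp: om_empty tensor_one cg2(1))
next
  case (Cons k l)
  have 1: "tensor (fE k) 1 * T l \<nu> \<in> tspan (mset (k # l)) \<nu>"
  proof (cases "\<nu> \<subseteq># mset l")
    case True thus ?thesis using tspan_E[OF Cons.IH[OF True] True] by simp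
  qed (simp add: T_0 tspan_0)
  have 2: "(if k \<in># \<nu> then tensor (fOm k) (fE k) * T l (\<nu> - {#k#}) else 0) \<in> tspan (mset (k # l)) \<nu>"
  proof (cases "k \<in># \<nu>")
    case True
    hence "\<nu> - {#k#} \<subseteq># mset l" using Cons.prems mset_subset_eq_add_mset_cancel[of k "\<nu> - {#k#}" "mset l"] by simp
    from tspan_Om[OF Cons.IH[OF this], of k] show ?thesis using True by simp
  qed (simp add: tspan_0)
  from tspan_add[OF 1 2] show ?case by simp
qed

lemma TT_tspan: "homog \<beta> a \<Longrightarrow> \<nu> \<subseteq># \<beta> \<Longrightarrow> TT \<nu> a \<in> tspan \<beta> \<nu>"
proof (induction rule: homog_induct)
  case (mono c l) thus ?case using T_tspan[of \<nu> l] by (simp add: klin_simps[OF klin_TT] TT_mono tspan_scal)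
qed (simp_all add: klin_simps[OF klin_TT] tspan_0 tspan_add)

text \<open>The functional \<open>phi i\<close> annihilates \<open>J\<close>. On the positive part it extracts the coefficient of \<open>e\<^sub>i\<close>, so
  applied to the second tensor factor it isolates the component of the coproduct that defines
  \<open>hat_partial i\<close>.\<close>

definition phi :: "'i \<Rightarrow> ('i gen, 'k) free_algebra \<Rightarrow> 'k" where
  "phi i b = lk (U b 1) (Word [i])"

lemma phi_embE: "phi i (embE b) = lk b (Word [i])" by (simp add: phi_def U_embE)

lemma coef2_phi: "coef2 (phi i) (tensor a b) = scal (phi i b) * a"
  by (rule coef2_tensor) (simp_all add: phi_def U_left lookup_add scal_mult_lookup)

lemma S_lookup: assumes "y \<in> S" shows "lk y (Word [i]) = 0"
proof -
  have "lk (dR q i y) 0 = lk y (Word [i])" for y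
  proof (induction y rule: free_algebra_induct)
    case (mono c l)
    have "lk (dRw q i l) 0 = lk (mono l) (Word [i])"
      by (cases l) (auto simp: lookup_add lookup_Cons_0 scal_mult_lookup lookup_mono lookup_one zero_word_def[symmetric] Word_eq_0)
    thus ?case by (simp add: dR_simps scal_mult_lookup dR_mono)
  qed (simp add: lookup_add dR_simps)
  thus ?thesis using S_pair[OF assms, of "[i]"] by (simp add: pair_def)
qed

lemma phi_J: "b \<in> J \<Longrightarrow> phi i b = 0"
  unfolding phi_def by (rule S_lookup[OF U_J])

text \<open>Sums of such tensors already form an ideal, because pure tensors of words span the
  tensor square. As multiplication does not occur in this description, the merely linear map
  \<open>coef2\<close> can be tested on its generators.\<close>

inductive_set J2_span :: "('i gen, 'k) free_algebra2 set" where
  zero: "0 \<in> J2_span"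
| add: "x \<in> J2_span \<Longrightarrow> y \<in> J2_span \<Longrightarrow> x + y \<in> J2_span"
| gen: "a \<in> J \<or> b \<in> J \<Longrightarrow> tensor a b \<in> J2_span"

lemma fideal_J2_span: "fideal J2_span"
proof -
  have sc: "scal c * x \<in> J2_span" if "x \<in> J2_span" for c x
    using that
  proof (induction rule: J2_span.induct)
    case (gen a b)
    have e: "scal c * tensor a b = tensor (scal c * a) b" "scal c * tensor a b = tensor a (scal c * b)"
      by (simp_all add: tensor_left tensor_right)
    from gen show ?case
    proof
      assume "a \<in> J"
      show ?thesis unfolding e(1) by (rule J2_span.gen, rule disjI1, rule fideal_left[OF fideal_J], fact)
    next
      assume "b \<in> J"
      show ?thesis unfolding e(2) by (rule J2_span.gen, rule disjI2, rule fideal_left[OF fideal_J], fact)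
    qed
  qed (simp_all add: distrib_left J2_span.zero J2_span.add)
  have w: "sg p 1 = (tensor (mono (letters (fst p))) (mono (letters (snd p))) :: ('i gen, 'k) free_algebra2)" for p
    by (simp add: tensor_mono)
  have l: "y * x \<in> J2_span" if "x \<in> J2_span" for x y
  proof (rule poly_mapping_linear_induct[of "\<lambda>y. y * x \<in> J2_span"])
    fix c p
    have "sg p 1 * x \<in> J2_span" using that
      by (induction rule: J2_span.induct)
        (auto simp: w tensor_mult distrib_left intro: J2_span.zero J2_span.add J2_span.gen fideal_left[OF fideal_J])
    thus "scal c * sg p 1 * x \<in> J2_span" by (simp add: mult.assoc sc)
  qed (simp_all add: distrib_right J2_span.zero J2_span.add)
  have r: "x * y \<in> J2_span" if "x \<in> J2_span" for x y
  proof (rule poly_mapping_linear_induct[of "\<lambda>y. x * y \<in> J2_span"])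
    fix c p
    have "x * sg p 1 \<in> J2_span" using that
      by (induction rule: J2_span.induct)
        (auto simp: w tensor_mult distrib_right intro: J2_span.zero J2_span.add J2_span.gen fideal_right[OF fideal_J])
    thus "x * (scal c * sg p 1) \<in> J2_span" by (simp add: mult_scal_left[of x] sc)
  qed (simp_all add: distrib_left J2_span.zero J2_span.add)
  show ?thesis using l r by (simp add: fideal_def J2_span.zero J2_span.add)
qed

lemma coef2_J2: "x \<in> J2 \<Longrightarrow> coef2 (phi i) x \<in> J"
proof -
  assume "x \<in> J2"
  moreover have "J2 \<subseteq> J2_span"
    unfolding Uq2_ideal_def by (rule Idl_minimal[OF fideal_J2_span]) (auto intro: J2_span.gen)
  ultimately have "x \<in> J2_span" by blast
  thus ?thesis
  proof (induction rule: J2_span.induct)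
    case (gen a b)
    thus ?case by (auto simp: coef2_phi phi_J fideal_0[OF fideal_J] fideal_left[OF fideal_J])
  qed (simp_all add: klin_simps[OF klin_coef2] fideal_0[OF fideal_J] fideal_add[OF fideal_J])
qed

end

lemma (in fideal_quot) cl_finsum_cong:
  assumes "finite K" "\<And>k. k \<in> K \<Longrightarrow> g k = cl (f k)"
  shows "(\<Oplus>\<^bsub>Q\<^esub>k\<in>K. g k) = cl (sum f K)"
proof -
  have "(\<Oplus>\<^bsub>Q\<^esub>k\<in>K. g k) = (\<Oplus>\<^bsub>Q\<^esub>k\<in>K. cl (f k))"
    by (rule abelian_monoid.finsum_cong'[OF ring.is_abelian_group[OF ring_Q, THEN abelian_group.axioms(1)]])
      (use assms in auto)
  thus ?thesis using cl_finsum[OF assms(1), of f] by simp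
qed

section \<open>Evaluation of the quotient constructions on representatives\<close>

context quantum_group
begin

interpretation u: fideal_quot J by unfold_locales (rule fideal_J)
interpretation u2: fideal_quot J2 by unfold_locales (rule fideal_J2)

text \<open>The canonical map from the free algebra onto the positive part; its kernel is
  \<open>S\<close> by \<open>embE_J_iff\<close>.\<close>

definition pr :: "('i, 'k) free_algebra \<Rightarrow> ('i gen, 'k) free_algebra set" where
  "pr a = u.cl (embE a)"

lemma pr_eq: "pr a = pr b \<longleftrightarrow> a - b \<in> S"
  unfolding pr_def u.cl_eq_iff klin_diff[OF klin_embE, symmetric] embE_J_iff ..
lemma pr_add: "pr a \<oplus>\<^bsub>Uq A q\<^esub> pr b = pr (a + b)"
  unfolding pr_def Uq_def u.cl_add by (simp add: embE_simps)
lemma pr_mult: "pr a \<otimes>\<^bsub>Uq A q\<^esub> pr b = pr (a * b)"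
  unfolding pr_def Uq_def u.cl_mult by (simp add: embE_mult)
lemma pr_zero: "\<zero>\<^bsub>Uq A q\<^esub> = pr 0"
  unfolding pr_def Uq_def u.cl_zero by (simp add: embE_simps)
lemma pr_one: "\<one>\<^bsub>Uq A q\<^esub> = pr 1"
  unfolding pr_def Uq_def u.cl_one by simp
lemma Uq_scal_pr: "Uq_scal A q c = pr (scal c)"
  by (simp add: Uq_scal_def Uq_class_def pr_def embE_scal)
lemma Uq_e_pr: "Uq_e A q i = pr (mono [i])"
  by (simp add: Uq_e_def Uq_class_def pr_def embE_gen)
lemma pr_sum:
  "finite B \<Longrightarrow> (\<And>k. k \<in> B \<Longrightarrow> g k = pr (f k)) \<Longrightarrow> (\<Oplus>\<^bsub>Uq A q\<^esub>k\<in>B. g k) = pr (sum f B)"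
  unfolding Uq_def pr_def klin_sum[OF klin_embE] by (rule u.cl_finsum_cong)

lemma Uq_e_word_pr: "Uq_e_word A q l = pr (mono l)"
  by (induction l) (simp_all add: Uq_e_word_def pr_one Uq_e_pr pr_mult mono_append[symmetric])

lemma Uq_plus_pr: assumes "x \<in> Uq_plus A q" obtains a where "x = pr a"
proof -
  have "x \<in> range pr"
    using assms unfolding Uq_plus_def
  proof (induction rule: generate_ring.induct)
    case one show ?case unfolding pr_one by simp
  next
    case (incl h) thus ?case by (auto simp: Uq_scal_pr Uq_e_pr)
  next
    case (a_inv h)
    then obtain a where h: "h = pr a" by (auto simp: Uq_scal_pr Uq_e_pr)
    have "\<ominus>\<^bsub>Uq A q\<^esub> h = pr (- a)"
      unfolding h a_inv_def Uq_def pr_def u.cl_minus by (simp add: embE_simps)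
    thus ?case by simp
  next
    case (eng_add h1 h2) thus ?case by (auto simp: pr_add)
  next
    case (eng_mult h1 h2) thus ?case by (auto simp: pr_mult)
  qed
  with that show ?thesis by blast
qed

lemma Uq_plus_comp_pr: "Uq_plus_comp A q \<beta> = pr ` {a. homog \<beta> a}"
proof -
  let ?V = "{Uq_scal A q c \<otimes>\<^bsub>Uq A q\<^esub> Uq_e_word A q l | c l. mset l = \<beta>}"
  have V: "?V = u.cl ` embE ` {scal c * mono l | c l. mset l = \<beta>}"
    by (auto simp: Uq_scal_pr Uq_e_word_pr pr_mult) (auto simp: pr_def)
  show ?thesis
  proof
    have "generate (add_monoid (RT Quot J)) ?V \<subseteq> u.cl ` embE ` {a. homog \<beta> a}"
    proof (rule u.generate_add_cl[OF V])
      show "0 \<in> embE ` {a. homog \<beta> a}" by (rule image_eqI[of _ _ 0]) (simp_all add: embE_simps)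
      show "embE ` {scal c * mono l | c l. mset l = \<beta>} \<subseteq> embE ` {a. homog \<beta> a}"
        by (rule image_mono) (auto simp: homog_scal homog_mono)
      fix x y :: "('i gen, 'k) free_algebra" assume "x \<in> embE ` {a. homog \<beta> a}" "y \<in> embE ` {a. homog \<beta> a}"
      then obtain a b where a: "homog \<beta> a" "x = embE a" and b: "homog \<beta> b" "y = embE b" by auto
      show "x + y \<in> embE ` {a. homog \<beta> a}"
        by (rule image_eqI[of _ _ "a + b"]) (simp_all add: a b embE_simps homog_add)
      show "- x \<in> embE ` {a. homog \<beta> a}"
        by (rule image_eqI[of _ _ "- a"]) (simp_all add: a embE_simps homog_uminus)
    qed
    thus "Uq_plus_comp A q \<beta> \<subseteq> pr ` {a. homog \<beta> a}"
      unfolding Uq_plus_comp_def by (auto simp: Uq_def pr_def)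
  next
    have "pr a \<in> Uq_plus_comp A q \<beta>" if "homog \<beta> a" for a
      using that
    proof (induction rule: homog_induct)
      case zero
      show ?case unfolding pr_zero[symmetric] Uq_plus_comp_def
        using generate.one[of "add_monoid (Uq A q)" ?V] by simp
    next
      case (add x y)
      thus ?case unfolding pr_add[symmetric] Uq_plus_comp_def
        using generate.eng[of "pr x" "add_monoid (Uq A q)" ?V "pr y"] by simp
    next
      case (mono c l)
      show ?case unfolding Uq_plus_comp_def
        by (rule generate.incl) (use mono in \<open>auto simp: Uq_scal_pr Uq_e_word_pr pr_mult\<close>)
    qed
    thus "pr ` {a. homog \<beta> a} \<subseteq> Uq_plus_comp A q \<beta>" by auto
  qed
qed

text \<open>A word pairs only with the component of its own degree, so the radical is graded, and
  \<open>S\<close> is the radical.\<close>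

lemma S_hcomp: assumes "a \<in> S" shows "hcomp \<beta> a \<in> S"
proof -
  have "pair q w (hcomp \<beta> a) = 0" for w
  proof (cases "mset w = \<beta>")
    case True
    thus ?thesis using assms pair_hcomp[of q w a] by (simp add: radical_eq_S)
  qed (rule pair_degree[OF homog_cmp])
  thus ?thesis by (simp add: radical_eq_S)
qed

lemma nonzero_degrees_finite: "finite {\<beta>. hcomp \<beta> a \<notin> S}"
  by (rule finite_subset[OF _ finite_mdegs[of a]]) (use cmp_eq_0[of _ a] S.zero in force)

lemma nonzero_degrees_sum: "a - (\<Sum>\<beta> | hcomp \<beta> a \<notin> S. hcomp \<beta> a) \<in> S"
proof -
  let ?D = "{\<beta>. hcomp \<beta> a \<notin> S}"
  have sub: "?D \<subseteq> mdegs a" using cmp_eq_0[of _ a] S.zero by force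
  have "a = (\<Sum>\<beta>\<in>mdegs a. hcomp \<beta> a)" by (rule sum_cmp[symmetric]) simp_all
  also have "\<dots> = (\<Sum>\<beta>\<in>mdegs a - ?D. hcomp \<beta> a) + (\<Sum>\<beta>\<in>?D. hcomp \<beta> a)"
    by (rule sum.subset_diff[OF sub]) simp
  finally have "a - (\<Sum>\<beta>\<in>?D. hcomp \<beta> a) = (\<Sum>\<beta>\<in>mdegs a - ?D. hcomp \<beta> a)" by (simp add: algebra_simps)
  moreover have "\<dots> \<in> S" by (rule S_sum) simp
  ultimately show ?thesis by simp
qed

text \<open>Uniqueness of the components is the gradedness of \<open>S\<close>: two decompositions
  differ by an element of \<open>S\<close>, whose components again lie in \<open>S\<close>.\<close>

lemma homogeneous_parts_pr: "homogeneous_parts A q (pr a) = (\<lambda>\<beta>. pr (hcomp \<beta> a))"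
  unfolding homogeneous_parts_def
proof (rule the_equality)
  have D: "{\<beta>. pr (hcomp \<beta> a) \<noteq> \<zero>\<^bsub>Uq A q\<^esub>} = {\<beta>. hcomp \<beta> a \<notin> S}"
    by (simp add: pr_zero pr_eq)
  have "pr a = (\<Oplus>\<^bsub>Uq A q\<^esub>\<beta>\<in>{\<beta>. hcomp \<beta> a \<notin> S}. pr (hcomp \<beta> a))"
    unfolding pr_sum[OF nonzero_degrees_finite refl] pr_eq by (rule nonzero_degrees_sum)
  thus "(\<forall>\<beta>. pr (hcomp \<beta> a) \<in> Uq_plus_comp A q \<beta>) \<and>
     finite {\<beta>. pr (hcomp \<beta> a) \<noteq> \<zero>\<^bsub>Uq A q\<^esub>} \<and>
     pr a = (\<Oplus>\<^bsub>Uq A q\<^esub>\<beta>\<in>{\<beta>. pr (hcomp \<beta> a) \<noteq> \<zero>\<^bsub>Uq A q\<^esub>}. pr (hcomp \<beta> a))"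
    unfolding D by (simp add: nonzero_degrees_finite Uq_plus_comp_pr)
next
  fix c
  assume c: "(\<forall>\<beta>. c \<beta> \<in> Uq_plus_comp A q \<beta>) \<and> finite {\<beta>. c \<beta> \<noteq> \<zero>\<^bsub>Uq A q\<^esub>} \<and>
     pr a = (\<Oplus>\<^bsub>Uq A q\<^esub>\<beta>\<in>{\<beta>. c \<beta> \<noteq> \<zero>\<^bsub>Uq A q\<^esub>}. c \<beta>)"
  let ?D = "{\<beta>. c \<beta> \<noteq> \<zero>\<^bsub>Uq A q\<^esub>}"
  have "\<forall>\<beta>. \<exists>r. homog \<beta> r \<and> c \<beta> = pr r" using c by (auto simp: Uq_plus_comp_pr)
  then obtain r where r: "\<And>\<beta>. homog \<beta> (r \<beta>)" "\<And>\<beta>. c \<beta> = pr (r \<beta>)" by metis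
  have fin: "finite ?D" using c by simp
  have "pr a = pr (\<Sum>\<beta>\<in>?D. r \<beta>)" using c pr_sum[OF fin r(2)] by simp
  hence s: "a - (\<Sum>\<beta>\<in>?D. r \<beta>) \<in> S" by (simp only: pr_eq)
  show "c = (\<lambda>\<beta>. pr (hcomp \<beta> a))"
  proof
    fix \<beta>
    have "hcomp \<beta> (\<Sum>\<beta>\<in>?D. r \<beta>) = (\<Sum>\<gamma>\<in>?D. if \<beta> = \<gamma> then r \<gamma> else 0)"
      unfolding klin_sum[OF klin_cmp] by (rule sum.cong[OF refl]) (simp add: cmp_homog[OF r(1)])
    also have "\<dots> = (if \<beta> \<in> ?D then r \<beta> else 0)" using fin by simp
    finally have "hcomp \<beta> a - (if \<beta> \<in> ?D then r \<beta> else 0) \<in> S"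
      using S_hcomp[OF s, of \<beta>] by (simp only: klin_diff[OF klin_cmp])
    hence "pr (hcomp \<beta> a) = pr (if \<beta> \<in> ?D then r \<beta> else 0)" by (simp only: pr_eq)
    also have "\<dots> = c \<beta>" by (simp add: r(2) pr_zero)
    finally show "c \<beta> = pr (hcomp \<beta> a)" ..
  qed
qed

lemma degrees_pr: "degrees A q (pr a) = {\<beta>. hcomp \<beta> a \<notin> S}"
  by (simp add: degrees_def homogeneous_parts_pr pr_zero pr_eq)

lemma scalar_of_pr: "scalar_of A q (pr (scal c)) = c"
  unfolding scalar_of_def Uq_scal_pr
proof (rule the_equality)
  fix d assume "pr (scal c) = pr (scal d)"
  hence "scal (c - d) \<in> S" by (simp add: pr_eq scal_diff)
  from S_pair[OF this, of "[]"] show "d = c" by (simp add: scal_def)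
qed simp

lemma Uq_tensor_cl: "Uq_tensor A q (u.cl a) (u.cl b) = u2.cl (tensor a b)"
proof -
  have e: "u2.cl (tensor a' b') = u2.cl (tensor a b)" if "a' \<in> u.cl a" "b' \<in> u.cl b" for a' b'
    using that tensor_cong[of a' a b' b] by (simp add: u.cl_mem u2.cl_eq_iff cg_def)
  have m: "a \<in> u.cl a" "b \<in> u.cl b" by (simp_all add: u.cl_mem fideal_0[OF fideal_J])
  show ?thesis unfolding Uq_tensor_def using e m by blast
qed

text \<open>The union over all representatives is a single coset because \<open>D\<close> maps
  \<open>J\<close> into \<open>J2\<close>.\<close>

lemma comult_cl: "comult A q (u.cl a) = u2.cl (D a)"
proof -
  have e: "u2.cl (D a') = u2.cl (D a)" if "a' \<in> u.cl a" for a'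
    using that D_J[of "a' - a"] by (simp add: u.cl_mem u2.cl_eq_iff klin_diff[OF klin_D])
  have m: "a \<in> u.cl a" by (simp add: u.cl_mem fideal_0[OF fideal_J])
  show ?thesis unfolding comult_def using e m by blast
qed

lemma Uq_omega_mset_cl: "Uq_omega_mset A q \<nu> = u.cl (om \<nu>)"
proof -
  have "foldr (\<lambda>i x. Uq_omega A q i \<otimes>\<^bsub>Uq A q\<^esub> x) l \<one>\<^bsub>Uq A q\<^esub> = u.cl (omw l)" for l
    by (induction l) (simp_all add: Uq_def u.cl_one Uq_omega_def Uq_class_def u.cl_mult omw_Cons)
  thus ?thesis by (simp add: Uq_omega_mset_def om_def)
qed

lemma comult_comp_tspan: "x \<in> tspan \<beta> \<nu> \<Longrightarrow> u2.cl x \<in> comult_comp A q \<beta> \<nu>"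
proof (induction rule: tspan_induct)
  case (gen a b x)
  have "u2.cl x = Uq_tensor A q (pr a \<otimes>\<^bsub>Uq A q\<^esub> Uq_omega_mset A q \<nu>) (pr b)"
    using gen(3) by (simp add: pr_def Uq_omega_mset_cl Uq_def u.cl_mult Uq_tensor_cl u2.cl_eq_iff cg_def)
  thus ?case unfolding comult_comp_def Uq_plus_comp_pr
    by (intro generate.incl) (use gen(1,2) in blast)
next
  case (add x y)
  thus ?case unfolding comult_comp_def u2.cl_add[symmetric] Uq2_def by (rule u2.generate_add_closed)
qed

text \<open>A second factor of degree other than alpha_i does not involve the word
  \<open>[i]\<close>, so \<open>phi i\<close> vanishes on it.\<close>

lemma comult_comp_coef2:
  assumes "t \<in> comult_comp A q \<beta> \<nu>" "\<nu> \<noteq> {#i#}"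
  shows "\<exists>x. t = u2.cl x \<and> coef2 (phi i) x \<in> J"
proof -
  let ?W = "{tensor (embE a * om \<nu>) (embE b) | a b. homog (\<beta> - \<nu>) a \<and> homog \<nu> b}"
  let ?V = "{Uq_tensor A q (a \<otimes>\<^bsub>Uq A q\<^esub> Uq_omega_mset A q \<nu>) b | a b.
        a \<in> Uq_plus_comp A q (\<beta> - \<nu>) \<and> b \<in> Uq_plus_comp A q \<nu>}"
  have e: "Uq_tensor A q (pr a \<otimes>\<^bsub>Uq A q\<^esub> Uq_omega_mset A q \<nu>) (pr b) = u2.cl (tensor (embE a * om \<nu>) (embE b))" for a b
    by (simp add: pr_def Uq_omega_mset_cl Uq_def u.cl_mult Uq_tensor_cl)
  have V: "?V = u2.cl ` ?W"
  proof (intro equalityI subsetI)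
    fix x assume "x \<in> ?V"
    then obtain a b where "homog (\<beta> - \<nu>) a" "homog \<nu> b" "x = u2.cl (tensor (embE a * om \<nu>) (embE b))"
      unfolding Uq_plus_comp_pr using e by auto
    thus "x \<in> u2.cl ` ?W" by blast
  next
    fix x assume "x \<in> u2.cl ` ?W"
    then obtain a b where "homog (\<beta> - \<nu>) a" "homog \<nu> b" "x = u2.cl (tensor (embE a * om \<nu>) (embE b))" by blast
    thus "x \<in> ?V" unfolding e[symmetric] Uq_plus_comp_pr by blast
  qed
  have "generate (add_monoid (RT Quot J2)) ?V \<subseteq> u2.cl ` {x. coef2 (phi i) x \<in> J}"
  proof (rule u2.generate_add_cl[OF V])
    show "?W \<subseteq> {x. coef2 (phi i) x \<in> J}"
    proof
      fix x :: "('i gen, 'k) free_algebra2" assume "x \<in> ?W"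
      then obtain a b where x: "x = tensor (embE a * om \<nu>) (embE b)" and b: "homog \<nu> b" by blast
      have "lk b (Word [i]) = lk (hcomp \<nu> b) (Word [i])" by (simp add: cmp_homog[OF b])
      also have "\<dots> = 0" using assms(2) by (simp add: lookup_cmp)
      finally show "x \<in> {x. coef2 (phi i) x \<in> J}" by (simp add: x coef2_phi phi_embE fideal_0[OF fideal_J])
    qed
  qed (simp_all add: klin_simps[OF klin_coef2] fideal_0[OF fideal_J] fideal_add[OF fideal_J] fideal_uminus[OF fideal_J])
  thus ?thesis using assms(1) unfolding comult_comp_def Uq2_def by auto
qed

definition is_hat_partial :: "'i multiset \<Rightarrow> 'i \<Rightarrow> ('i gen, 'k) free_algebra set \<Rightarrow> ('i gen, 'k) free_algebra set \<Rightarrow> bool" where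
  "is_hat_partial \<beta> i x y \<longleftrightarrow> y \<in> Uq_plus_comp A q (\<beta> - {#i#}) \<and>
        (\<exists>t. (\<forall>\<nu>. \<nu> \<subseteq># \<beta> \<longrightarrow> t \<nu> \<in> comult_comp A q \<beta> \<nu>) \<and>
             comult A q x = (\<Oplus>\<^bsub>Uq2 A q\<^esub>\<nu>\<in>{\<nu>. \<nu> \<subseteq># \<beta>}. t \<nu>) \<and>
             t {#i#} = Uq_tensor A q (y \<otimes>\<^bsub>Uq A q\<^esub> Uq_omega A q i) (Uq_e A q i))"

lemma tensor_omega_e: "Uq_tensor A q (pr a \<otimes>\<^bsub>Uq A q\<^esub> Uq_omega A q i) (Uq_e A q i) = u2.cl (tensor (embE a * fOm i) (fE i))"
  by (simp add: pr_def Uq_omega_def Uq_e_def Uq_class_def Uq_def u.cl_mult Uq_tensor_cl)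

lemma is_hat_partial_dR:
  assumes "homog \<beta> a"
  shows "is_hat_partial \<beta> i (pr a) (pr (dR q i a))"
  unfolding is_hat_partial_def tensor_omega_e
proof (intro conjI exI[of _ "\<lambda>\<nu>. u2.cl (TT \<nu> a)"] allI impI)
  show "pr (dR q i a) \<in> Uq_plus_comp A q (\<beta> - {#i#})"
    unfolding Uq_plus_comp_pr using homog_dR[OF assms] by blast
  show "u2.cl (TT \<nu> a) \<in> comult_comp A q \<beta> \<nu>" if "\<nu> \<subseteq># \<beta>" for \<nu>
    by (rule comult_comp_tspan[OF TT_tspan[OF assms that]])
  show "comult A q (pr a) = (\<Oplus>\<^bsub>Uq2 A q\<^esub>\<nu>\<in>{\<nu>. \<nu> \<subseteq># \<beta>}. u2.cl (TT \<nu> a))"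
    unfolding pr_def comult_cl Uq2_def D_embE[OF assms] by (rule u2.cl_finsum[symmetric]) simp
  show "u2.cl (TT {#i#} a) = u2.cl (tensor (embE (dR q i a) * fOm i) (fE i))"
    using TT_single[of i a] by (simp add: u2.cl_eq_iff cg_def)
qed

text \<open>The left-hand side does not involve \<open>a'\<close>. Together with the invertibility
  of \<omega>_i this shows that the element selected by \<open>THE\<close> is unique.\<close>

lemma is_hat_partial_coef2:
  assumes "is_hat_partial \<beta> i (pr a) (pr a')" "i \<in># \<beta>"
  shows "cg J (coef2 (phi i) (D (embE a))) (embE a' * fOm i)"
proof -
  have "\<exists>t. (\<forall>\<nu>. \<nu> \<subseteq># \<beta> \<longrightarrow> t \<nu> \<in> comult_comp A q \<beta> \<nu>) \<and>
      u2.cl (D (embE a)) = (\<Oplus>\<^bsub>RT Quot J2\<^esub>\<nu>\<in>{\<nu>. \<nu> \<subseteq># \<beta>}. t \<nu>) \<and>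
      t {#i#} = u2.cl (tensor (embE a' * fOm i) (fE i))" (is "\<exists>t. ?t t")
    using assms(1)[unfolded is_hat_partial_def tensor_omega_e, THEN conjunct2]
    unfolding pr_def comult_cl Uq2_def .
  then obtain t where "?t t" ..
  hence t: "\<forall>\<nu>. \<nu> \<subseteq># \<beta> \<longrightarrow> t \<nu> \<in> comult_comp A q \<beta> \<nu>"
      "u2.cl (D (embE a)) = (\<Oplus>\<^bsub>RT Quot J2\<^esub>\<nu>\<in>{\<nu>. \<nu> \<subseteq># \<beta>}. t \<nu>)"
      "t {#i#} = u2.cl (tensor (embE a' * fOm i) (fE i))"
    by simp_all
  have "\<forall>\<nu>. \<exists>x. \<nu> \<subseteq># \<beta> \<longrightarrow> \<nu> \<noteq> {#i#} \<longrightarrow> t \<nu> = u2.cl x \<and> coef2 (phi i) x \<in> J"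
    using comult_comp_coef2 t(1) by meson
  then obtain x where x: "\<And>\<nu>. \<nu> \<subseteq># \<beta> \<Longrightarrow> \<nu> \<noteq> {#i#} \<Longrightarrow> t \<nu> = u2.cl (x \<nu>) \<and> coef2 (phi i) (x \<nu>) \<in> J"
    by metis
  define z where "z \<nu> = (if \<nu> = {#i#} then tensor (embE a' * fOm i) (fE i) else x \<nu>)" for \<nu>
  have "u2.cl (D (embE a)) = u2.cl (\<Sum>\<nu> | \<nu> \<subseteq># \<beta>. z \<nu>)"
    unfolding t(2)
  proof (rule u2.cl_finsum_cong)
    fix \<nu> assume "\<nu> \<in> {\<nu>. \<nu> \<subseteq># \<beta>}"
    thus "t \<nu> = u2.cl (z \<nu>)" using t(3) x[of \<nu>] unfolding z_def by (cases "\<nu> = {#i#}") simp_all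
  qed simp
  hence "coef2 (phi i) (D (embE a) - (\<Sum>\<nu> | \<nu> \<subseteq># \<beta>. z \<nu>)) \<in> J"
    by (intro coef2_J2) (simp only: u2.cl_eq_iff)
  hence 1: "cg J (coef2 (phi i) (D (embE a))) (\<Sum>\<nu> | \<nu> \<subseteq># \<beta>. coef2 (phi i) (z \<nu>))"
    by (simp only: cg_def klin_diff[OF klin_coef2] klin_sum[OF klin_coef2])
  have pE: "phi i (fE i) = 1"
    using phi_embE[of i "mono [i]"] by (simp add: embE_gen lookup_mono)
  have zi: "coef2 (phi i) (z {#i#}) = embE a' * fOm i" by (simp add: z_def coef2_phi pE)
  have "(\<Sum>\<nu> | \<nu> \<subseteq># \<beta>. coef2 (phi i) (z \<nu>))
      = coef2 (phi i) (z {#i#}) + (\<Sum>\<nu>\<in>{\<nu>. \<nu> \<subseteq># \<beta>} - {{#i#}}. coef2 (phi i) (z \<nu>))"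
    by (rule sum.remove) (use assms(2) in simp_all)
  moreover have "(\<Sum>\<nu>\<in>{\<nu>. \<nu> \<subseteq># \<beta>} - {{#i#}}. coef2 (phi i) (z \<nu>)) \<in> J"
    by (rule fideal_sum[OF fideal_J]) (simp add: z_def x)
  ultimately have "cg J (\<Sum>\<nu> | \<nu> \<subseteq># \<beta>. coef2 (phi i) (z \<nu>)) (embE a' * fOm i)"
    unfolding zi by (simp add: cg_def)
  from cg_trans[OF fideal_J 1 this] show ?thesis .
qed

lemma cancel_fOm: assumes "cg J (x * fOm i) (y * fOm i)" shows "cg J x y"
proof -
  have e: "cg J (z * fOm i * fOmInv i) z" for z :: "('i gen, 'k) free_algebra"
    using cg1(2)[OF om_inv(1)[of i], of z] by (simp add: mult.assoc)
  from cg_trans[OF fideal_J cg_trans[OF fideal_J cg_sym[OF fideal_J e] cg1(3)[OF assms]] e]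
  show ?thesis .
qed

lemma hat_partial_hom_pr:
  assumes a: "homog \<beta> a"
  shows "hat_partial_hom A q \<beta> i (pr a) = pr (dR q i a)"
proof (cases "i \<in># \<beta>")
  case True
  have "hat_partial_hom A q \<beta> i (pr a) = (THE y. is_hat_partial \<beta> i (pr a) y)"
    unfolding hat_partial_hom_def is_hat_partial_def using True by (simp only: if_True)
  also have "\<dots> = pr (dR q i a)"
  proof (rule the_equality, rule is_hat_partial_dR[OF a])
    fix y assume y: "is_hat_partial \<beta> i (pr a) y"
    then obtain a' where a': "y = pr a'" by (auto simp: is_hat_partial_def Uq_plus_comp_pr)
    have "cg J (embE a' * fOm i) (embE (dR q i a) * fOm i)"
      by (rule cg_trans[OF fideal_J cg_sym[OF fideal_J is_hat_partial_coef2[OF y[unfolded a'] True]]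
          is_hat_partial_coef2[OF is_hat_partial_dR[OF a] True]])
    from cancel_fOm[OF this] show "y = pr (dR q i a)"
      unfolding a' by (simp add: pr_def u.cl_eq_iff cg_def)
  qed
  finally show ?thesis .
qed (simp add: hat_partial_hom_def dR_0[OF a] pr_zero)

lemma hat_partial_pr: "hat_partial A q i (pr a) = pr (dR q i a)"
proof -
  let ?D = "{\<beta>. hcomp \<beta> a \<notin> S}"
  have "hat_partial A q i (pr a) = (\<Oplus>\<^bsub>Uq A q\<^esub>\<beta>\<in>?D. hat_partial_hom A q \<beta> i (pr (hcomp \<beta> a)))"
    unfolding hat_partial_def degrees_pr homogeneous_parts_pr ..
  also have "\<dots> = pr (\<Sum>\<beta>\<in>?D. dR q i (hcomp \<beta> a))"
    by (rule pr_sum[OF nonzero_degrees_finite]) (rule hat_partial_hom_pr[OF homog_cmp])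
  \<comment> \<open>Components lying in \<open>S\<close> are missing from the sum, but
    \<open>dR\<close> maps them into \<open>S\<close> as well.\<close>
  also have "\<dots> = pr (dR q i a)"
    using S_dR[OF nonzero_degrees_sum[of a], of i]
    unfolding pr_eq dR_simps by (rule fideal_uminus[OF fideal_S, of "_ - _", unfolded minus_diff_eq])
  finally show ?thesis .
qed

lemma skew_partial_pr: "skew_partial A q i (pr a) = pr (scal (q i i / (1 - q i i)) * dR q i a)"
  by (simp add: skew_partial_def hat_partial_pr Uq_scal_pr pr_mult)

definition skew_coeff :: "'i list \<Rightarrow> 'k" where
  "skew_coeff l = (\<Prod>i\<leftarrow>l. q i i / (1 - q i i))"

lemma skew_coeff_nz: "skew_coeff l \<noteq> 0"
  using root[of 1] q_nz by (auto simp: skew_coeff_def prod_list_zero_iff)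

lemma skew_partial_word_pr: "skew_partial_word A q l (pr a) = pr (scal (skew_coeff l) * foldr (dR q) l a)"
  by (induction l) (simp_all add: skew_partial_word_def skew_coeff_def skew_partial_pr dR_simps scal_scal)

lemma homog_empty: "homog {#} x \<Longrightarrow> x = scal (lk x 0)"
proof (induction rule: homog_induct)
  case (add x y)
  show ?case unfolding lookup_add scal_add by (rule arg_cong2[of _ _ _ _ "(+)", OF add.IH])
next
  case (mono c l) thus ?case by (simp add: scal_def)
qed simp

lemma Gamma_hom_pr:
  assumes a: "homog \<mu> a"
  shows "Gamma_hom A q \<mu> (pr a) = (\<Sum>l | mset l = \<mu>. sg (Word l) (skew_coeff l * pair q l a))"
  unfolding Gamma_hom_def
proof (rule sum.cong[OF refl])
  fix l assume "l \<in> {l. mset l = \<mu>}"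
  hence "homog {#} (foldr (dR q) l a)" using homog_foldr_dR(1)[OF a, where w = l and p = q] by simp
  from homog_empty[OF this] have "foldr (dR q) l a = scal (pair q l a)" unfolding pair_def .
  hence "skew_partial_word A q l (pr a) = pr (scal (skew_coeff l * pair q l a))"
    by (simp add: skew_partial_word_pr scal_mult)
  thus "sg (Word l) (scalar_of A q (skew_partial_word A q l (pr a))) = sg (Word l) (skew_coeff l * pair q l a)"
    by (simp add: scalar_of_pr)
qed

lemma lookup_Gamma_hom:
  assumes "homog \<mu> a"
  shows "lk (Gamma_hom A q \<mu> (pr a)) (Word l) = (if mset l = \<mu> then skew_coeff l * pair q l a else 0)"
proof -
  have "lk (Gamma_hom A q \<mu> (pr a)) (Word l)
      = (\<Sum>l' | mset l' = \<mu>. if l' = l then skew_coeff l * pair q l a else 0)"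
    unfolding Gamma_hom_pr[OF assms] lookup_sum by (rule sum.cong[OF refl]) (auto simp: lookup_single)
  thus ?thesis by simp
qed

text \<open>Every coefficient is a nonzero multiple of a pairing, so linearity and injectivity can
  be read off coefficientwise. A component in \<open>S\<close>, which \<open>degrees\<close> omits,
  has zero pairings.\<close>

lemma lookup_Gamma: "lk (Gamma A q (pr a)) (Word l) = skew_coeff l * pair q l a"
proof -
  let ?D = "{\<beta>. hcomp \<beta> a \<notin> S}"
  have "lk (Gamma A q (pr a)) (Word l) = (\<Sum>\<mu>\<in>?D. if mset l = \<mu> then skew_coeff l * pair q l (hcomp \<mu> a) else 0)"
    unfolding Gamma_def degrees_pr homogeneous_parts_pr lookup_sum
    by (rule sum.cong[OF refl]) (rule lookup_Gamma_hom[OF homog_cmp])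
  also have "\<dots> = (if mset l \<in> ?D then skew_coeff l * pair q l (hcomp (mset l) a) else 0)"
    by (rule sum.delta'[OF nonzero_degrees_finite])
  also have "\<dots> = skew_coeff l * pair q l a"
    using S_pair[of "hcomp (mset l) a" l] by (simp add: pair_hcomp)
  finally show ?thesis .
qed

lemma Gamma_add: "Gamma A q (pr a \<oplus>\<^bsub>Uq A q\<^esub> pr b) = Gamma A q (pr a) + Gamma A q (pr b)"
proof (rule poly_mapping_eqI)
  fix w :: "'i word"
  show "lk (Gamma A q (pr a \<oplus>\<^bsub>Uq A q\<^esub> pr b)) w = lk (Gamma A q (pr a) + Gamma A q (pr b)) w"
    by (cases w) (simp only: pr_add lookup_add lookup_Gamma pair_right distrib_left)
qed

lemma Gamma_scal: "Gamma A q (Uq_scal A q c \<otimes>\<^bsub>Uq A q\<^esub> pr a) = scal c * Gamma A q (pr a)"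
proof (rule poly_mapping_eqI)
  fix w :: "'i word"
  show "lk (Gamma A q (Uq_scal A q c \<otimes>\<^bsub>Uq A q\<^esub> pr a)) w = lk (scal c * Gamma A q (pr a)) w"
    by (cases w) (simp only: Uq_scal_pr pr_mult scal_mult_lookup lookup_Gamma pair_right mult.left_commute)
qed

lemma Gamma_comp: assumes "homog \<mu> a" shows "Gamma A q (pr a) = Gamma_hom A q \<mu> (pr a)"
proof (rule poly_mapping_eqI)
  fix w :: "'i word"
  obtain l where w: "w = Word l" by (cases w)
  show "lk (Gamma A q (pr a)) w = lk (Gamma_hom A q \<mu> (pr a)) w"
    using pair_degree[OF assms, of l q] by (simp add: w lookup_Gamma lookup_Gamma_hom[OF assms])
qed

text \<open>Equal coefficients put the difference of the representatives into the radical, that is,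
  into \<open>S\<close>, the kernel of \<open>pr\<close>.\<close>

lemma Gamma_inj: assumes "Gamma A q (pr a) = Gamma A q (pr b)" shows "pr a = pr b"
proof -
  have "pair q w (a - b) = 0" for w
    using lookup_Gamma[of a w] lookup_Gamma[of b w] skew_coeff_nz[of w] by (simp add: assms pair_right)
  thus ?thesis by (simp add: pr_eq radical_eq_S)
qed

end

text \<open>The first three conjuncts identify \<open>Gamma\<close>, which is defined through chosen
  components, with the linear map prescribed on homogeneous elements; the last one is the
  injectivity.\<close>

theorem lemma76:
  fixes A :: "'i::finite \<Rightarrow> 'i \<Rightarrow> int"
    and q :: "'i \<Rightarrow> 'i \<Rightarrow> 'k::field_char_0"
    and \<tau> :: "'k \<Rightarrow> 'k"
  assumes "gen_cartan_matrix A" and "symmetrizable A"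
    and "indeterminate_parameters A q"
    and "\<And>i m. m > 0 \<Longrightarrow> \<exists>r. r ^ m = q i i"
    and "\<And>i m. m > 0 \<Longrightarrow> q i i ^ m \<noteq> 1"
    and "involutive_field_automorphism \<tau>" and "\<And>i j. \<tau> (q i j) = q j i"
  shows "(\<forall>x\<in>Uq_plus A q. \<forall>y\<in>Uq_plus A q. Gamma A q (x \<oplus>\<^bsub>Uq A q\<^esub> y) = Gamma A q x + Gamma A q y)
       \<and> (\<forall>c. \<forall>x\<in>Uq_plus A q. Gamma A q (Uq_scal A q c \<otimes>\<^bsub>Uq A q\<^esub> x) = scal c * Gamma A q x)
       \<and> (\<forall>\<mu>. \<forall>x\<in>Uq_plus_comp A q \<mu>. Gamma A q x =
            (\<Sum>l\<in>{l. mset l = \<mu>}.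
               Poly_Mapping.single (Word l) (scalar_of A q (skew_partial_word A q l x))))
       \<and> inj_on (Gamma A q) (Uq_plus A q)"
proof -
  interpret quantum_group A q by unfold_locales (fact assms)+
  show ?thesis
  proof (intro conjI ballI allI inj_onI)
    fix x y assume x: "x \<in> Uq_plus A q" and y: "y \<in> Uq_plus A q"
    from x obtain a where a: "x = pr a" by (rule Uq_plus_pr)
    from y obtain b where b: "y = pr b" by (rule Uq_plus_pr)
    show "Gamma A q (x \<oplus>\<^bsub>Uq A q\<^esub> y) = Gamma A q x + Gamma A q y"
      unfolding a b by (rule Gamma_add)
    show "x = y" if "Gamma A q x = Gamma A q y"
      using that unfolding a b by (rule Gamma_inj)
  next
    fix c x assume "x \<in> Uq_plus A q"
    then obtain a where a: "x = pr a" by (rule Uq_plus_pr)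
    show "Gamma A q (Uq_scal A q c \<otimes>\<^bsub>Uq A q\<^esub> x) = scal c * Gamma A q x"
      unfolding a by (rule Gamma_scal)
  next
    fix \<mu> x assume "x \<in> Uq_plus_comp A q \<mu>"
    then obtain a where "homog \<mu> a" and a: "x = pr a" unfolding Uq_plus_comp_pr by blast
    thus "Gamma A q x = (\<Sum>l\<in>{l. mset l = \<mu>}. sg (Word l) (scalar_of A q (skew_partial_word A q l x)))"
      unfolding a Gamma_hom_def[symmetric] by (intro Gamma_comp)
  qed
qed

end
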